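(* For every Hilbert module $\mathcal M$ in $\mathfrak B_1(\Omega)$, the sheaf $\mathcal S^{\mathcal M}$ is coherent (as a sheaf of $\mathcal O_\Omega$-modules).
   Context: $\Omega\subset\mathbb C^m$ is a bounded domain and $\mathfrak m_w\subset\mathbb C[\underline z]=\mathbb C[z_1,\dots,z_m]$ is the maximal ideal of polynomials vanishing at $w$. A Hilbert module over $\mathbb C[\underline z]$ is a Hilbert space with a $\mathbb C[\underline z]$-module structure in which every polynomial acts as a bounded operator. The class $\mathfrak B_1(\Omega)$ consists of the Hilbert modules $\mathcal M$ over $\mathbb C[\underline z]$ whose elements are holomorphic functions on $\Omega$, with module action given by pointwise multiplication, such that (rk) $\mathcal M$ has a reproducing kernel $K$ (the value $K(w,w)=0$ is allowed), and (fin) $\dim\mathcal M/\mathfrak m_w\mathcal M<\infty$ for all $w\in\Omega$, where $\mathfrak m_w\mathcal M=\{\sum_{j=1}^m(z_j-w_j)f_j:f_j\in\mathcal M\}$. $\mathcal O_\Omega$ is the sheaf of holomorphic functions on $\Omega$, with stalks $\mathcal O_w$. $\mathcal S^{\mathcal M}$ is the subsheaf of $\mathcal O_\Omega$ whose stalk at $w\in\Omega$ is the ideal $\{(f_1)_wh_1+\cdots+(f_n)_wh_n: n\in\mathbb N,\ f_i\in\mathcal M,\ h_i\in\mathcal O_w\}$ of $\mathcal O_w$ generated by the germs at $w$ of all $f\in\mathcal M$. *)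

theory Defs
  imports
    "HOL-Analysis.Analysis"
    "HOL-Algebra.Module"
    "HOL-Library.Poly_Mapping"
begin

section \<open>Holomorphic functions of several variables\<close>

text \<open>
  \<^term>\<open>f\<close> is complex differentiable at every point of \<^term>\<open>U\<close>. The predicate is only used for
  open \<^term>\<open>U\<close>.
\<close>

definition hol_on :: "(complex ^ 'm \<Rightarrow> complex) \<Rightarrow> (complex ^ 'm) set \<Rightarrow> bool"
    (infix "hol'_on" 50) where
  "f hol_on U \<longleftrightarrow>
     (\<forall>z\<in>U. \<exists>L. (f has_derivative L) (at z) \<and> (\<forall>c v. L (c *s v) = c * L v))"

text \<open>
  A function on a set \<^term>\<open>U\<close> is represented by its extension by zero to the whole space, so
  that equality of functions on \<^term>\<open>U\<close> is HOL equality and the algebraic operations are the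
  pointwise ones.
\<close>

definition zero_outside :: "(complex ^ 'm) set \<Rightarrow> (complex ^ 'm \<Rightarrow> complex) \<Rightarrow> bool" where
  "zero_outside U f \<longleftrightarrow> (\<forall>z. z \<notin> U \<longrightarrow> f z = 0)"

definition restr :: "(complex ^ 'm) set \<Rightarrow> (complex ^ 'm \<Rightarrow> complex) \<Rightarrow> (complex ^ 'm \<Rightarrow> complex)"
  where "restr V f = (\<lambda>z. if z \<in> V then f z else 0)"

definition hol_ring :: "(complex ^ 'm) set \<Rightarrow> (complex ^ 'm \<Rightarrow> complex) ring" where
  "hol_ring U =
     \<lparr>carrier = {f. f hol_on U \<and> zero_outside U f},
      monoid.mult = (\<lambda>f g z. f z * g z),
      one = restr U (\<lambda>_. 1),
      zero = (\<lambda>_. 0),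
      add = (\<lambda>f g z. f z + g z)\<rparr>"


section \<open>Germs\<close>

text \<open>The germ at \<^term>\<open>w\<close> is the class of all functions agreeing with \<^term>\<open>f\<close> near \<^term>\<open>w\<close>.\<close>

definition germ :: "complex ^ 'm \<Rightarrow> (complex ^ 'm \<Rightarrow> complex) \<Rightarrow> (complex ^ 'm \<Rightarrow> complex) set" where
  "germ w f = {g. \<forall>\<^sub>F z in nhds w. g z = f z}"

definition hol_stalk :: "complex ^ 'm \<Rightarrow> (complex ^ 'm \<Rightarrow> complex) set ring" where
  "hol_stalk w =
     \<lparr>carrier = {germ w f | f U. open U \<and> w \<in> U \<and> f hol_on U},
      monoid.mult = (\<lambda>A B. {h. \<exists>f\<in>A. \<exists>g\<in>B. \<forall>\<^sub>F z in nhds w. h z = f z * g z}),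
      one = germ w (\<lambda>_. 1),
      zero = germ w (\<lambda>_. 0),
      add = (\<lambda>A B. {h. \<exists>f\<in>A. \<exists>g\<in>B. \<forall>\<^sub>F z in nhds w. h z = f z + g z})\<rparr>"


section \<open>Sheaves of modules over the sheaf of holomorphic functions, and coherence\<close>

text \<open>
  A sheaf is given by its modules of sections \<^term>\<open>F U\<close> over the open subsets of
  \<^term>\<open>\<Omega>\<close> and by restriction maps, \<^term>\<open>r U V\<close> being the one from \<^term>\<open>U\<close>
  to \<^term>\<open>V\<close>.
\<close>

locale hol_module_sheaf =
  fixes \<Omega> :: "(complex ^ 'm) set"
    and F :: "(complex ^ 'm) set \<Rightarrow> (complex ^ 'm \<Rightarrow> complex, 'a) module"
    and r :: "(complex ^ 'm) set \<Rightarrow> (complex ^ 'm) set \<Rightarrow> 'a \<Rightarrow> 'a"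
  assumes sections_module:
      "\<lbrakk>open U; U \<subseteq> \<Omega>\<rbrakk> \<Longrightarrow> Module.module (hol_ring U) (F U)"
    and res_closed:
      "\<lbrakk>open U; U \<subseteq> \<Omega>; open V; V \<subseteq> U; s \<in> carrier (F U)\<rbrakk> \<Longrightarrow> r U V s \<in> carrier (F V)"
    and res_add:
      "\<lbrakk>open U; U \<subseteq> \<Omega>; open V; V \<subseteq> U; s \<in> carrier (F U); t \<in> carrier (F U)\<rbrakk>
        \<Longrightarrow> r U V (s \<oplus>\<^bsub>F U\<^esub> t) = r U V s \<oplus>\<^bsub>F V\<^esub> r U V t"
    and res_smult:
      "\<lbrakk>open U; U \<subseteq> \<Omega>; open V; V \<subseteq> U; a \<in> carrier (hol_ring U); s \<in> carrier (F U)\<rbrakk>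
        \<Longrightarrow> r U V (a \<odot>\<^bsub>F U\<^esub> s) = restr V a \<odot>\<^bsub>F V\<^esub> r U V s"
    and res_id:
      "\<lbrakk>open U; U \<subseteq> \<Omega>; s \<in> carrier (F U)\<rbrakk> \<Longrightarrow> r U U s = s"
    and res_trans:
      "\<lbrakk>open U; U \<subseteq> \<Omega>; open V; V \<subseteq> U; open W; W \<subseteq> V; s \<in> carrier (F U)\<rbrakk>
        \<Longrightarrow> r V W (r U V s) = r U W s"
    and glueing:
      "\<lbrakk>\<And>U. U \<in> \<U> \<Longrightarrow> open U \<and> U \<subseteq> \<Omega>;
        \<And>U. U \<in> \<U> \<Longrightarrow> \<sigma> U \<in> carrier (F U);
        \<And>U V. \<lbrakk>U \<in> \<U>; V \<in> \<U>\<rbrakk> \<Longrightarrow> r U (U \<inter> V) (\<sigma> U) = r V (U \<inter> V) (\<sigma> V)\<rbrakk>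
        \<Longrightarrow> \<exists>!t. t \<in> carrier (F (\<Union>\<U>)) \<and> (\<forall>U\<in>\<U>. r (\<Union>\<U>) U t = \<sigma> U)"

text \<open>
  Finite type over an open set \<^term>\<open>X\<close>: every point has an open neighbourhood \<^term>\<open>W\<close> with
  finitely many sections \<^term>\<open>s 0\<close>, \dots, \<^term>\<open>s (n - 1)\<close> over \<^term>\<open>W\<close> whose germs generate
  all stalks over \<^term>\<open>W\<close>; that is, every section near a point \<^term>\<open>y\<close> of \<^term>\<open>W\<close> is, on a
  possibly smaller neighbourhood of \<^term>\<open>y\<close>, a linear combination of them.
\<close>

definition finite_type ::
  "((complex ^ 'm) set \<Rightarrow> (complex ^ 'm \<Rightarrow> complex, 'a) module)
    \<Rightarrow> ((complex ^ 'm) set \<Rightarrow> (complex ^ 'm) set \<Rightarrow> 'a \<Rightarrow> 'a)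
    \<Rightarrow> (complex ^ 'm) set \<Rightarrow> bool" where
  "finite_type F r X \<longleftrightarrow>
     (\<forall>x\<in>X. \<exists>W (n::nat) s. open W \<and> x \<in> W \<and> W \<subseteq> X \<and> (\<forall>i<n. s i \<in> carrier (F W)) \<and>
        (\<forall>y\<in>W. \<forall>V t. open V \<and> y \<in> V \<and> V \<subseteq> W \<and> t \<in> carrier (F V) \<longrightarrow>
           (\<exists>V' a. open V' \<and> y \<in> V' \<and> V' \<subseteq> V \<and> (\<forall>i<n. a i \<in> carrier (hol_ring V')) \<and>
              r V V' t = (\<Oplus>\<^bsub>F V'\<^esub>i\<in>{..<n}. a i \<odot>\<^bsub>F V'\<^esub> r W V' (s i)))))"

text \<open>
  The sheaf of relations of sections \<^term>\<open>s 0\<close>, \dots, \<^term>\<open>s (n - 1)\<close> over \<^term>\<open>U\<close>, i.e.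
  the kernel of the morphism from the free module of rank \<^term>\<open>n\<close> over \<^term>\<open>U\<close> which they define.
  A tuple of length \<^term>\<open>n\<close> is continued by zero to a function on \<^typ>\<open>nat\<close>. The fields
  \<^const>\<open>monoid.mult\<close> and \<^const>\<open>one\<close> of a module record carry no meaning.
\<close>

definition relations ::
  "((complex ^ 'm) set \<Rightarrow> (complex ^ 'm \<Rightarrow> complex, 'a) module)
    \<Rightarrow> ((complex ^ 'm) set \<Rightarrow> (complex ^ 'm) set \<Rightarrow> 'a \<Rightarrow> 'a)
    \<Rightarrow> (complex ^ 'm) set \<Rightarrow> nat \<Rightarrow> (nat \<Rightarrow> 'a)
    \<Rightarrow> (complex ^ 'm) set \<Rightarrow> (complex ^ 'm \<Rightarrow> complex, nat \<Rightarrow> complex ^ 'm \<Rightarrow> complex) module" where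
  "relations F r U n s V =
     \<lparr>carrier = {a. (\<forall>i<n. a i \<in> carrier (hol_ring V)) \<and> (\<forall>i\<ge>n. a i = (\<lambda>_. 0)) \<and>
                    (\<Oplus>\<^bsub>F V\<^esub>i\<in>{..<n}. a i \<odot>\<^bsub>F V\<^esub> r U V (s i)) = \<zero>\<^bsub>F V\<^esub>},
      monoid.mult = undefined,
      one = undefined,
      zero = (\<lambda>_ _. 0),
      add = (\<lambda>a b i z. a i z + b i z),
      smult = (\<lambda>c a i z. c z * a i z)\<rparr>"

locale coherent_sheaf = hol_module_sheaf \<Omega> F r
  for \<Omega> :: "(complex ^ 'm) set"
    and F :: "(complex ^ 'm) set \<Rightarrow> (complex ^ 'm \<Rightarrow> complex, 'a) module"
    and r :: "(complex ^ 'm) set \<Rightarrow> (complex ^ 'm) set \<Rightarrow> 'a \<Rightarrow> 'a" +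
  assumes finite_type: "finite_type F r \<Omega>"
    and relations_finite_type:
      "\<lbrakk>open U; U \<subseteq> \<Omega>; \<And>i. i < n \<Longrightarrow> s i \<in> carrier (F U)\<rbrakk>
        \<Longrightarrow> finite_type (relations F r U n s) (\<lambda>_ V a i. restr V (a i)) U"


section \<open>The subsheaf generated by a set of functions\<close>

definition generated_stalk ::
  "(complex ^ 'm \<Rightarrow> complex) set \<Rightarrow> complex ^ 'm \<Rightarrow> (complex ^ 'm \<Rightarrow> complex) set set" where
  "generated_stalk M w =
     {\<Oplus>\<^bsub>hol_stalk w\<^esub>i\<in>{..<n}. germ w (f i) \<otimes>\<^bsub>hol_stalk w\<^esub> h i | (n::nat) f h.
        (\<forall>i<n. f i \<in> M \<and> h i \<in> carrier (hol_stalk w))}"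

definition generated_sheaf ::
  "(complex ^ 'm \<Rightarrow> complex) set
    \<Rightarrow> (complex ^ 'm) set \<Rightarrow> (complex ^ 'm \<Rightarrow> complex, complex ^ 'm \<Rightarrow> complex) module" where
  "generated_sheaf M U =
     \<lparr>carrier = {f \<in> carrier (hol_ring U). \<forall>w\<in>U. germ w f \<in> generated_stalk M w},
      monoid.mult = undefined,
      one = undefined,
      zero = \<zero>\<^bsub>hol_ring U\<^esub>,
      add = add (hol_ring U),
      smult = monoid.mult (hol_ring U)\<rparr>"


section \<open>Hilbert modules of holomorphic functions\<close>

text \<open>The elements of this type are the polynomials over the complex numbers in the variables
  indexed by \<^typ>\<open>'m\<close>.\<close>

type_synonym 'm cpoly = "('m \<Rightarrow>\<^sub>0 nat) \<Rightarrow>\<^sub>0 complex"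

definition cpoly_eval :: "'m cpoly \<Rightarrow> complex ^ 'm \<Rightarrow> complex" where
  "cpoly_eval p z =
     (\<Sum>\<alpha>\<in>Poly_Mapping.keys p.
        Poly_Mapping.lookup p \<alpha> * (\<Prod>j\<in>UNIV. (z $ j) ^ Poly_Mapping.lookup \<alpha> j))"

definition ip_norm :: "('a \<Rightarrow> 'a \<Rightarrow> complex) \<Rightarrow> 'a \<Rightarrow> real" where
  "ip_norm ip f = sqrt (Re (ip f f))"

text \<open>
  A complex Hilbert space whose elements are functions on \<^term>\<open>\<Omega>\<close> (extended by zero), with the
  pointwise vector space structure and the inner product \<^term>\<open>ip\<close>, linear in its first argument.
\<close>

locale hilbert_function_space =
  fixes \<Omega> :: "(complex ^ 'm) set"
    and M :: "(complex ^ 'm \<Rightarrow> complex) set"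
    and ip :: "(complex ^ 'm \<Rightarrow> complex) \<Rightarrow> (complex ^ 'm \<Rightarrow> complex) \<Rightarrow> complex"
  assumes on_domain: "f \<in> M \<Longrightarrow> zero_outside \<Omega> f"
    and zero_mem: "(\<lambda>_. 0) \<in> M"
    and add_mem: "\<lbrakk>f \<in> M; g \<in> M\<rbrakk> \<Longrightarrow> (\<lambda>z. f z + g z) \<in> M"
    and scale_mem: "f \<in> M \<Longrightarrow> (\<lambda>z. c * f z) \<in> M"
    and ip_add: "\<lbrakk>f \<in> M; g \<in> M; h \<in> M\<rbrakk> \<Longrightarrow> ip (\<lambda>z. f z + g z) h = ip f h + ip g h"
    and ip_scale: "\<lbrakk>f \<in> M; h \<in> M\<rbrakk> \<Longrightarrow> ip (\<lambda>z. c * f z) h = c * ip f h"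
    and ip_cnj: "\<lbrakk>f \<in> M; g \<in> M\<rbrakk> \<Longrightarrow> ip g f = cnj (ip f g)"
    and ip_pos: "\<lbrakk>f \<in> M; f \<noteq> (\<lambda>_. 0)\<rbrakk> \<Longrightarrow> 0 < Re (ip f f)"
    and complete: "Metric_space.mcomplete M (\<lambda>f g. ip_norm ip (\<lambda>z. f z - g z))"

text \<open>
  The space \<open>\<mm>\<^sub>w M\<close> for the maximal ideal of the polynomials vanishing at \<^term>\<open>w\<close>, and
  finite-dimensionality of the quotient \<open>M / \<mm>\<^sub>w M\<close>: it is spanned by the classes of finitely
  many elements.
\<close>

definition max_ideal_times ::
  "(complex ^ 'm \<Rightarrow> complex) set \<Rightarrow> complex ^ 'm \<Rightarrow> (complex ^ 'm \<Rightarrow> complex) set" where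
  "max_ideal_times M w = {\<lambda>z. \<Sum>j\<in>UNIV. (z $ j - w $ j) * f j z | f. \<forall>j. f j \<in> M}"

definition finite_codim ::
  "(complex ^ 'm \<Rightarrow> complex) set \<Rightarrow> (complex ^ 'm \<Rightarrow> complex) set \<Rightarrow> bool" where
  "finite_codim M N \<longleftrightarrow>
     (\<exists>B. finite B \<and> B \<subseteq> M \<and>
        (\<forall>f\<in>M. \<exists>c. \<exists>g\<in>N. f = (\<lambda>z. (\<Sum>b\<in>B. c b * b z) + g z)))"

text \<open>
  The class \<open>\<BB>\<^sub>1(\<Omega>)\<close>. Nothing forces the kernel to be positive on the diagonal, so that
  all elements of \<^term>\<open>M\<close> may vanish at a given point.
\<close>

locale class_B1 = hilbert_function_space \<Omega> M ip
  for \<Omega> :: "(complex ^ 'm) set"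
    and M :: "(complex ^ 'm \<Rightarrow> complex) set"
    and ip :: "(complex ^ 'm \<Rightarrow> complex) \<Rightarrow> (complex ^ 'm \<Rightarrow> complex) \<Rightarrow> complex" +
  assumes holomorphic: "f \<in> M \<Longrightarrow> f hol_on \<Omega>"
    and poly_mem: "f \<in> M \<Longrightarrow> (\<lambda>z. cpoly_eval p z * f z) \<in> M"
    and poly_bounded:
      "\<exists>C. \<forall>f\<in>M. ip_norm ip (\<lambda>z. cpoly_eval p z * f z) \<le> C * ip_norm ip f"
    and reproducing_kernel:
      "\<exists>K. \<forall>w\<in>\<Omega>. restr \<Omega> (\<lambda>z. K z w) \<in> M \<and> (\<forall>f\<in>M. f w = ip f (restr \<Omega> (\<lambda>z. K z w)))"
    and fin: "w \<in> \<Omega> \<Longrightarrow> finite_codim M (max_ideal_times M w)"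

end

theory Submission
  imports Defs "HOL-Complex_Analysis.Conformal_Mappings"
begin

text \<open>
  Only the holomorphy of the elements of \<open>M\<close> matters: the ideal sheaf generated by any set of
  holomorphic functions on \<open>\<Omega>\<close> is coherent. Both halves of coherence are proved by induction on the
  number of variables. After a shear, one of the given functions divides a polynomial \<open>W\<close> in \<open>z\<^sub>n\<close>, monic
  and with coefficients depending on the other variables only (Weierstrass preparation), and Cauchy
  integrals along small circles divide by \<open>W\<close> near every point.

  Finite type: dividing all elements of \<open>M\<close> by \<open>W\<close> on one and the same polydisc leaves tuples of
  functions of fewer variables; finitely many of these tuples generate all of them by induction, and the
  corresponding elements of \<open>M\<close> together with the divisor of \<open>W\<close> generate \<open>M\<close>.

  Relations (Oka's theorem): modulo trivial relations a relation consists of polynomials in \<open>z\<^sub>n\<close> of bounded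
  degree, whose coefficients solve a homogeneous linear system in fewer variables.
\<close>

text \<open>Both halves meet an obstacle of uniformity. Noetherian stalks would yield finitely many
  members of \<open>M\<close> generating the germs at one point, but the neighbourhood on which
  another member becomes a combination of them could shrink from member to member. Here the circle
  and polydisc of a division are dictated by a single member, so the remainders of all members live
  on a common domain, and the induction runs for families of tuples of any size.

  For relations, the point \<open>y\<close> at which a relation is given varies around the point
  \<open>w\<close> of preparation. Near \<open>y\<close> the polynomial \<open>W\<close> may have
  fewer than \<open>b\<close> zeros, and division by its Weierstrass factor at \<open>y\<close>
  would give a degree bound depending on \<open>y\<close>. What holds at every \<open>y\<close> is
  that \<open>(p(x) - p(v)) / (x - v)\<close> has degree below \<open>b\<close> in \<open>v\<close>
  whenever \<open>p\<close> has degree at most \<open>b\<close>. Integrated against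
  \<open>a / W\<close> over any circle free of zeros of \<open>W\<close>, it gives remainders of
  degree below \<open>b\<close>, hence one fixed linear system for all \<open>y\<close>.\<close>

section \<open>Complex differentiability in several variables\<close>

definition cdiff :: "(complex ^ 'm \<Rightarrow> complex) \<Rightarrow> complex ^ 'm \<Rightarrow> bool" where
  "cdiff f z \<longleftrightarrow> (\<exists>L. (f has_derivative L) (at z) \<and> (\<forall>c v. L (c *s v) = c * L v))"

lemma hol_on_iff_cdiff: "f hol_on U \<longleftrightarrow> (\<forall>z\<in>U. cdiff f z)"
  by (simp add: hol_on_def cdiff_def)

lemma cdiff_imp_isCont: "cdiff f z \<Longrightarrow> isCont f z"
  unfolding cdiff_def using has_derivative_continuous by blast

lemma hol_on_imp_continuous_on: "f hol_on U \<Longrightarrow> continuous_on U f"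
  by (meson cdiff_imp_isCont continuous_at_imp_continuous_on hol_on_iff_cdiff)

lemma cdiff_const: "cdiff (\<lambda>_. c) z"
  unfolding cdiff_def by (rule exI[of _ "\<lambda>_. 0"]) auto

lemma cdiff_coord: "cdiff (\<lambda>z. z $ j) z"
  unfolding cdiff_def
  by (rule exI[of _ "\<lambda>z. z $ j"]) (auto intro!: bounded_linear_imp_has_derivative bounded_linear_vec_nth)

lemma cdiff_add: "\<lbrakk>cdiff f z; cdiff g z\<rbrakk> \<Longrightarrow> cdiff (\<lambda>z. f z + g z) z"
  unfolding cdiff_def
  by (elim exE conjE, rule exI, rule conjI, erule (1) has_derivative_add) (auto simp: algebra_simps)

lemma cdiff_mult: "\<lbrakk>cdiff f z; cdiff g z\<rbrakk> \<Longrightarrow> cdiff (\<lambda>z. f z * g z) z"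
  unfolding cdiff_def
  by (elim exE conjE, rule exI, rule conjI, erule (1) has_derivative_mult) (auto simp: algebra_simps)

lemma cdiff_uminus: "cdiff f z \<Longrightarrow> cdiff (\<lambda>z. - f z) z"
  using cdiff_mult[OF cdiff_const[of "-1"], of f z] by simp

lemma cdiff_diff: "\<lbrakk>cdiff f z; cdiff g z\<rbrakk> \<Longrightarrow> cdiff (\<lambda>z. f z - g z) z"
  using cdiff_add[OF _ cdiff_uminus, of f z g] by simp

lemma cdiff_sum: "(\<And>i. i \<in> I \<Longrightarrow> cdiff (f i) z) \<Longrightarrow> cdiff (\<lambda>z. \<Sum>i\<in>I. f i z) z"
  by (induction I rule: infinite_finite_induct) (simp_all add: cdiff_const cdiff_add)

lemma cdiff_power: "cdiff f z \<Longrightarrow> cdiff (\<lambda>z. f z ^ k) z"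
  by (induction k) (simp_all add: cdiff_const cdiff_mult)

lemma cdiff_compose1:
  assumes "cdiff f z" "g field_differentiable at (f z)"
  shows "cdiff (\<lambda>z. g (f z)) z"
proof -
  obtain L where L: "(f has_derivative L) (at z)" "\<And>c v. L (c *s v) = c * L v"
    using assms(1) by (auto simp: cdiff_def)
  obtain d where d: "(g has_field_derivative d) (at (f z))"
    using assms(2) by (auto simp: field_differentiable_def)
  show ?thesis
    unfolding cdiff_def
    by (rule exI[of _ "\<lambda>v. d * L v"])
       (use has_derivative_compose[OF L(1) d[unfolded has_field_derivative_def]] L(2) in auto)
qed

lemma cdiff_inverse: "\<lbrakk>cdiff f z; f z \<noteq> 0\<rbrakk> \<Longrightarrow> cdiff (\<lambda>z. inverse (f z)) z"
  by (rule cdiff_compose1[where g = inverse])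
    (auto simp: field_differentiable_def intro: DERIV_inverse)

lemma cdiff_divide: "\<lbrakk>cdiff f z; cdiff g z; g z \<noteq> 0\<rbrakk> \<Longrightarrow> cdiff (\<lambda>z. f z / g z) z"
  unfolding divide_inverse by (intro cdiff_mult cdiff_inverse)

lemmas cdiff_intros =
  cdiff_const cdiff_coord cdiff_add cdiff_mult cdiff_uminus cdiff_diff cdiff_sum cdiff_power cdiff_divide

lemma cdiff_cong:
  assumes "cdiff f z" "\<forall>\<^sub>F x in nhds z. g x = f x"
  shows "cdiff g z"
proof -
  obtain L where L: "(f has_derivative L) (at z)" "\<forall>c v. L (c *s v) = c * L v"
    using assms(1) by (auto simp: cdiff_def)
  obtain S where "open S" "z \<in> S" "\<And>x. x \<in> S \<Longrightarrow> g x = f x"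
    using assms(2) by (auto simp: eventually_nhds)
  then have "(g has_derivative L) (at z)"
    using has_derivative_transform_within_open[OF L(1), of S g] by metis
  then show ?thesis using L(2) by (auto simp: cdiff_def)
qed

lemma cdiff_compose_vec:
  assumes "(T has_derivative T') (at z)" "\<And>c v. T' (c *s v) = c *s T' v" "cdiff f (T z)"
  shows "cdiff (\<lambda>z. f (T z)) z"
proof -
  obtain L where L: "(f has_derivative L) (at (T z))" "\<And>c v. L (c *s v) = c * L v"
    using assms(3) by (auto simp: cdiff_def)
  show ?thesis
    unfolding cdiff_def
    by (rule exI[of _ "\<lambda>v. L (T' v)"])
       (use has_derivative_compose[OF assms(1) L(1)] L(2) assms(2) in auto)
qed

lemma bounded_linear_scalar_left: "bounded_linear (\<lambda>t. t *s (v :: complex ^ 'm))"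
  by (simp add: linear_conv_bounded_linear[symmetric] linear_iff vec_eq_iff algebra_simps)

lemma cdiff_line:
  assumes "cdiff f (a + t *s v)"
  shows "(\<lambda>t. f (a + t *s v)) field_differentiable at t"
proof -
  obtain L where L: "(f has_derivative L) (at (a + t *s v))" "\<And>c v. L (c *s v) = c * L v"
    using assms by (auto simp: cdiff_def)
  have "((\<lambda>t. a + t *s v) has_derivative (\<lambda>h. h *s v)) (at t)"
    using has_derivative_add[OF has_derivative_const bounded_linear_imp_has_derivative[OF bounded_linear_scalar_left]]
    by simp
  from has_derivative_compose[OF this L(1)] have "((\<lambda>t. f (a + t *s v)) has_derivative (\<lambda>h. h * L v)) (at t)"
    using L(2) by simp
  then show ?thesis
    unfolding field_differentiable_def has_field_derivative_def
    by (intro exI[of _ "L v"]) (simp add: mult.commute[of _ "L v"])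
qed

text \<open>Slices are taken by overwriting one coordinate inside the fixed type, so that no product
  decomposition and no space of smaller dimension is involved.\<close>

definition upd :: "'m \<Rightarrow> complex ^ 'm \<Rightarrow> complex \<Rightarrow> complex ^ 'm" where
  "upd j z x = (\<chi> i. if i = j then x else z $ i)"

lemma upd_nth [simp]: "upd j z x $ i = (if i = j then x else z $ i)"
  by (simp add: upd_def)

lemma upd_same [simp]: "upd j z (z $ j) = z"
  by (simp add: vec_eq_iff)

lemma upd_upd [simp]: "upd j (upd j z x) y = upd j z y"
  by (simp add: vec_eq_iff)

lemma upd_eq_line: "upd j z x = upd j z 0 + x *s axis j 1"
  by (simp add: vec_eq_iff axis_def)

lemma continuous_on_upd [continuous_intros]:
  assumes "continuous_on S f" "continuous_on S g"
  shows "continuous_on S (\<lambda>p. upd j (f p) (g p))"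
  unfolding upd_def
proof (rule continuous_on_vec_lambda)
  show "continuous_on S (\<lambda>x. if i = j then g x else f x $ i)" for i
    by (cases "i = j") (use assms in \<open>auto intro!: continuous_intros\<close>)
qed

lemma cdiff_upd_line:
  assumes "cdiff f (upd j z x)"
  shows "(\<lambda>x. f (upd j z x)) field_differentiable at x"
  using cdiff_line[of f "upd j z 0" x "axis j 1"] assms by (simp add: upd_eq_line[symmetric])

lemma has_derivative_upd: "((\<lambda>z. upd j z x) has_derivative (\<lambda>h. upd j h 0)) (at z)"
proof -
  have "bounded_linear (\<lambda>h. upd j h 0)"
    by (simp add: linear_conv_bounded_linear[symmetric] linear_iff vec_eq_iff)
  then have "((\<lambda>z. upd j z 0 + x *s axis j 1) has_derivative (\<lambda>h. upd j h 0 + 0)) (at z)"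
    by (intro has_derivative_add has_derivative_const bounded_linear_imp_has_derivative)
  then show ?thesis by (simp add: upd_eq_line[symmetric])
qed

lemma cdiff_comp_upd:
  assumes "cdiff f (upd j z x)"
  shows "cdiff (\<lambda>z. f (upd j z x)) z"
  by (rule cdiff_compose_vec[OF has_derivative_upd _ assms]) (simp add: vec_eq_iff)

lemma hol_on_slice:
  assumes "f hol_on U" "\<And>x. x \<in> S \<Longrightarrow> upd j z x \<in> U"
  shows "(\<lambda>x. f (upd j z x)) holomorphic_on S"
  unfolding holomorphic_on_def
  using assms cdiff_upd_line by (metis field_differentiable_at_within hol_on_iff_cdiff)

subsection \<open>Circle integrals depending on a parameter\<close>

text \<open>The normalisation makes Cauchy's formula free of constants.\<close>

definition cint :: "complex \<Rightarrow> real \<Rightarrow> (complex \<Rightarrow> complex) \<Rightarrow> complex" where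
  "cint c r f = contour_integral (circlepath c r) f / (2 * of_real pi * \<i>)"

lemma cint_cong: "(\<And>x. x \<in> sphere c r \<Longrightarrow> f x = g x) \<Longrightarrow> 0 \<le> r \<Longrightarrow> cint c r f = cint c r g"
  unfolding cint_def by (subst contour_integral_cong[where f' = g]) auto

lemma contour_integrable_sphere:
  "continuous_on (sphere c r) f \<Longrightarrow> 0 \<le> r \<Longrightarrow> f contour_integrable_on circlepath c r"
  by (rule contour_integrable_continuous_circlepath) simp

lemma cint_diff:
  assumes "continuous_on (sphere c r) f" "continuous_on (sphere c r) g" "0 \<le> r"
  shows "cint c r (\<lambda>x. f x - g x) = cint c r f - cint c r g"
  using assms by (simp add: cint_def contour_integral_diff contour_integrable_sphere diff_divide_distrib)

lemma cint_cmult: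
  assumes "continuous_on (sphere c r) f" "0 \<le> r"
  shows "cint c r (\<lambda>x. a * f x) = a * cint c r f"
  using assms by (simp add: cint_def contour_integral_lmul contour_integrable_sphere)

lemma cint_sum:
  assumes "finite I" "\<And>i. i \<in> I \<Longrightarrow> continuous_on (sphere c r) (f i)" "0 \<le> r"
  shows "cint c r (\<lambda>x. \<Sum>i\<in>I. f i x) = (\<Sum>i\<in>I. cint c r (f i))"
  using assms by (simp add: cint_def contour_integral_sum contour_integrable_sphere sum_divide_distrib)

lemma cint_Cauchy:
  assumes "continuous_on (cball c r) f" "f holomorphic_on ball c r" "z \<in> ball c r"
  shows "cint c r (\<lambda>x. f x / (x - z)) = f z"
  using contour_integral_unique[OF Cauchy_integral_circlepath[OF assms(1,2)]] assms(3)
  by (auto simp: cint_def dist_norm norm_minus_commute)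

lemma cint_Cauchy_deriv:
  assumes "continuous_on (cball c r) f" "f holomorphic_on ball c r" "z \<in> ball c r"
  shows "cint c r (\<lambda>x. f x / (x - z)\<^sup>2) = deriv f z"
  using DERIV_imp_deriv[OF Cauchy_derivative_integral_circlepath(2)[OF assms]] by (simp add: cint_def)

text \<open>The derivative of the circle path contributes the factor that cancels the normalisation.
  An integral over a fixed real interval is the form to which the theorems on parameter integrals
  apply.\<close>

lemma cint_eq_integral:
  "cint c r f = integral {0..1} (\<lambda>t. f (circlepath c r t) * (of_real r * exp (2 * of_real pi * \<i> * of_real t)))"
  unfolding cint_def contour_integral_integral vector_derivative_circlepath
  by (subst integral_divide[symmetric]) (simp add: field_simps)

lemma continuous_on_cint:
  fixes \<psi> :: "'p::topological_space \<Rightarrow> complex \<Rightarrow> complex"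
  assumes "continuous_on (T \<times> sphere c r) (\<lambda>(p, x). \<psi> p x)" "0 \<le> r"
  shows "continuous_on T (\<lambda>p. cint c r (\<psi> p))"
  unfolding cint_eq_integral
proof -
  have *: "circlepath c r t \<in> sphere c r" for t
    using assms(2) by (simp add: circlepath dist_norm norm_mult)
  have "continuous_on (T \<times> cbox 0 1) (\<lambda>(p, t::real). \<psi> p (circlepath c r t) * (of_real r * exp (2 * of_real pi * \<i> * of_real t)))"
    unfolding split_beta
    by (intro continuous_intros continuous_on_compose2[OF assms(1)[unfolded split_beta], of _ "\<lambda>x. (fst x, circlepath c r (snd x))", simplified])
      (use * in \<open>auto simp: circlepath intro!: continuous_intros\<close>)
  from integral_continuous_on_param[OF this]
  show "continuous_on T (\<lambda>p. integral {0..1} (\<lambda>t. \<psi> p (circlepath c r t) * (of_real r * exp (2 * of_real pi * \<i> * of_real t))))"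
    by simp
qed

text \<open>Cauchy's formula writes the derivative as a circle integral of a jointly continuous
  integrand, so \<open>continuous_on_cint\<close> applies with the pair of parameter and point as
  the new parameter.\<close>

lemma continuous_on_deriv_param:
  fixes \<psi> :: "'p::topological_space \<Rightarrow> complex \<Rightarrow> complex"
  assumes cont: "continuous_on (T \<times> cball c r) (\<lambda>(p, x). \<psi> p x)"
    and hol: "\<And>p. p \<in> T \<Longrightarrow> \<psi> p holomorphic_on ball c r" and r: "0 < r"
  shows "continuous_on (T \<times> ball c r) (\<lambda>(p, x). deriv (\<psi> p) x)"
proof -
  have c: "continuous_on (cball c r) (\<psi> p)" if "p \<in> T" for p
    by (rule continuous_on_compose2[OF cont, of _ "\<lambda>x. (p, x)", simplified])
      (use that in \<open>auto intro!: continuous_intros\<close>)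
  have "continuous_on (T \<times> ball c r) (\<lambda>q. cint c r (\<lambda>u. \<psi> (fst q) u / (u - snd q)\<^sup>2))"
  proof (rule continuous_on_cint)
    show "continuous_on ((T \<times> ball c r) \<times> sphere c r) (\<lambda>(q, u). \<psi> (fst q) u / (u - snd q)\<^sup>2)"
      unfolding split_beta
      by (intro continuous_intros continuous_on_compose2[OF cont[unfolded split_beta], of _ "\<lambda>x. (fst (fst x), snd x)", simplified])
        (auto intro!: continuous_intros)
  qed (use r in simp)
  then show ?thesis
    by (rule continuous_on_eq) (use c hol in \<open>auto simp: cint_Cauchy_deriv\<close>)
qed

text \<open>Differentiation under the integral sign. The joint continuity of the derivative in
  \<open>p\<close>, which the Leibniz rule requires, comes from
  \<open>continuous_on_deriv_param\<close> with the roles of \<open>p\<close> and \<open>x\<close>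
  exchanged.\<close>

lemma cint_param_field_differentiable:
  fixes \<psi> :: "complex \<Rightarrow> complex \<Rightarrow> complex"
  assumes cont: "continuous_on (cball a d \<times> sphere c r) (\<lambda>(p, x). \<psi> p x)"
    and hol: "\<And>x. x \<in> sphere c r \<Longrightarrow> (\<lambda>p. \<psi> p x) holomorphic_on ball a d"
    and r: "0 \<le> r" "0 < d"
  shows "(\<lambda>p. cint c r (\<psi> p)) field_differentiable at a"
proof -
  have *: "circlepath c r t \<in> sphere c r" for t
    using r by (simp add: circlepath dist_norm norm_mult)
  have cp: "continuous_on A (circlepath c r)" for A
    by (auto simp: circlepath intro!: continuous_intros)
  define e where "e t = of_real r * exp (2 * of_real pi * \<i> * of_real t)" for t :: real
  have e: "continuous_on A e" for A
    unfolding e_def by (intro continuous_intros)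
  have cps: "continuous_on A (\<lambda>x. circlepath c r (snd x))" for A :: "(complex \<times> real) set"
    by (auto simp: circlepath intro!: continuous_intros)
  have es: "continuous_on A (\<lambda>x. e (snd x))" for A :: "(complex \<times> real) set"
    unfolding e_def by (intro continuous_intros)
  have cont': "continuous_on (sphere c r \<times> cball a d) (\<lambda>(x, p). \<psi> p x)"
    unfolding split_beta
    by (rule continuous_on_compose2[OF cont[unfolded split_beta], of _ "\<lambda>x. (snd x, fst x)", simplified])
      (auto intro!: continuous_intros)
  have cd: "continuous_on (sphere c r \<times> ball a d) (\<lambda>(x, p). deriv (\<lambda>p. \<psi> p x) p)"
    by (rule continuous_on_deriv_param[OF cont' hol r(2)])
  have "(\<lambda>p. integral (cbox 0 1) (\<lambda>t. \<psi> p (circlepath c r t) * e t)) field_differentiable at a within ball a d"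
  proof (rule leibniz_rule_field_differentiable)
    fix p t assume "p \<in> ball a d" "t \<in> cbox 0 (1::real)"
    then show "((\<lambda>p. \<psi> p (circlepath c r t) * e t) has_field_derivative
        deriv (\<lambda>p. \<psi> p (circlepath c r t)) p * e t) (at p within ball a d)"
      using hol[OF *] by (intro DERIV_cmult_right DERIV_subset[OF holomorphic_derivI[of _ "ball a d"]]) auto
  next
    fix p assume "p \<in> ball a d"
    then show "(\<lambda>t. \<psi> p (circlepath c r t) * e t) integrable_on cbox 0 1"
      by (intro integrable_continuous continuous_intros e
          continuous_on_compose2[OF cont[unfolded split_beta], of _ "\<lambda>t. (p, circlepath c r t)", simplified])
        (use * in \<open>auto intro!: continuous_intros cp\<close>)
  next
    show "continuous_on (ball a d \<times> cbox 0 1) (\<lambda>(p, t). deriv (\<lambda>p. \<psi> p (circlepath c r t)) p * e t)"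
      unfolding split_beta
      by (intro continuous_intros cps es
          continuous_on_compose2[OF cd[unfolded split_beta], of _ "\<lambda>x. (circlepath c r (snd x), fst x)", simplified])
        (use * in \<open>auto intro!: continuous_intros cps\<close>)
  qed (use r in auto)
  then show ?thesis
    using r at_within_open[of a "ball a d"] by (simp add: cint_eq_integral e_def)
qed

subsection \<open>Osgood's lemma\<close>

text \<open>A single radius serves all coordinates, so the polydiscs around one centre are nested
  and radii are combined by taking minima.\<close>

definition pd :: "complex ^ 'm \<Rightarrow> real \<Rightarrow> (complex ^ 'm) set" where
  "pd w r = {z. \<forall>j. dist (w $ j) (z $ j) < r}"

lemma pd_center [simp]: "w \<in> pd w r \<longleftrightarrow> 0 < r"
  by (simp add: pd_def)

lemma pd_mono: "r \<le> s \<Longrightarrow> pd w r \<subseteq> pd w s"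
  by (auto simp: pd_def intro: less_le_trans)

lemma open_pd: "open (pd w r)"
proof -
  have "pd w r = (\<Inter>j. (\<lambda>z. z $ j) -` ball (w $ j) r)"
    by (auto simp: pd_def)
  also have "open \<dots>"
    by (intro open_INT finite ballI open_vimage open_ball continuous_intros)
  finally show ?thesis .
qed

lemma convex_pd: "convex (pd w r)"
proof -
  have "pd w r = (\<Inter>j. (\<lambda>z. z $ j) -` ball (w $ j) r)"
    by (auto simp: pd_def)
  also have "convex \<dots>"
    by (intro convex_INT convex_linear_vimage bounded_linear.linear[OF bounded_linear_vec_nth] convex_ball)
  finally show ?thesis .
qed

lemma pd_subset_open:
  assumes "open U" "w \<in> U"
  obtains r where "0 < r" "pd w r \<subseteq> U"
proof -
  obtain e where e: "0 < e" "ball w e \<subseteq> U"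
    using assms open_contains_ball by blast
  \<comment> \<open>The norm is at most the sum of the moduli of the coordinates, which is then at
    most \<open>e / 2\<close>.\<close>
  define r where "r = e / (2 * real CARD('a))"
  have "pd w r \<subseteq> ball w e"
  proof
    fix z assume z: "z \<in> pd w r"
    have "norm (z - w) \<le> (\<Sum>j\<in>UNIV. norm ((z - w) $ j))"
      unfolding norm_vec_def by (rule L2_set_le_sum) simp
    also have "\<dots> \<le> (\<Sum>j\<in>(UNIV :: 'a set). r)"
      using z by (intro sum_mono) (auto simp: pd_def dist_norm norm_minus_commute less_imp_le)
    also have "\<dots> = e / 2"
      by (simp add: r_def)
    finally show "z \<in> ball w e"
      using e(1) by (simp add: dist_norm norm_minus_commute)
  qed
  moreover have "0 < r"
    using e(1) by (simp add: r_def)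
  ultimately show ?thesis using that e(2) by blast
qed

lemma eventually_nhds_pd: "eventually P (nhds w) \<longleftrightarrow> (\<exists>r>0. \<forall>z\<in>pd w r. P z)"
proof
  assume "eventually P (nhds w)"
  then obtain S where S: "open S" "w \<in> S" "\<And>z. z \<in> S \<Longrightarrow> P z"
    by (auto simp: eventually_nhds)
  then show "\<exists>r>0. \<forall>z\<in>pd w r. P z"
    using pd_subset_open[OF S(1,2)] by (metis subsetD)
next
  assume "\<exists>r>0. \<forall>z\<in>pd w r. P z"
  then show "eventually P (nhds w)"
    unfolding eventually_nhds using open_pd pd_center by blast
qed

lemma upd_in_pd: "\<lbrakk>z \<in> pd w r; dist (w $ j) x < r\<rbrakk> \<Longrightarrow> upd j z x \<in> pd w r"
  by (auto simp: pd_def)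

text \<open>The partial derivatives are continuous by Cauchy's formula on slices. The increment of
  \<open>f\<close> is then split into moves in one coordinate at a time, each compared with its
  linear part by the one-variable mean value inequality.\<close>

theorem Osgood:
  fixes f :: "complex ^ 'm \<Rightarrow> complex"
  assumes U: "open U" and cont: "continuous_on U f"
    and sep: "\<And>z j. z \<in> U \<Longrightarrow> (\<lambda>x. f (upd j z x)) field_differentiable at (z $ j)"
  shows "f hol_on U"
  unfolding hol_on_iff_cdiff
proof
  fix w assume w: "w \<in> U"
  obtain \<rho> where \<rho>: "0 < \<rho>" "pd w \<rho> \<subseteq> U"
    using pd_subset_open[OF U w] .
  define D where "D j z = deriv (\<lambda>x. f (upd j z x)) (z $ j)" for j z
  have der: "((\<lambda>x. f (upd j z x)) has_field_derivative D j (upd j z x)) (at x)" if "upd j z x \<in> U" for j z x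
    using sep[OF that, of j] by (simp add: D_def field_differentiable_derivI)
  have contD: "continuous_on (pd w \<rho>) (D j)" for j
  proof -
    define r where "r = \<rho> / 2"
    have r: "0 < r" "r < \<rho>"
      using \<rho>(1) by (auto simp: r_def)
    have *: "continuous_on (pd w \<rho> \<times> ball (w $ j) \<rho>) (\<lambda>(z, x). f (upd j z x))"
      unfolding split_beta using \<rho>(2)
      by (intro continuous_on_compose2[OF cont, of _ "\<lambda>p. upd j (fst p) (snd p)", simplified])
        (auto intro!: continuous_intros upd_in_pd)
    have "isCont (D j) y" if y: "y \<in> pd w \<rho>" for y
    proof -
      obtain e where e: "0 < e" "cball (y $ j) e \<subseteq> ball (w $ j) \<rho>"
        using open_contains_cball[of "ball (w $ j) \<rho>"] y by (auto simp: pd_def) (meson mem_ball)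
      have "continuous_on (pd w \<rho> \<times> ball (y $ j) e) (\<lambda>(z, x). deriv (\<lambda>x. f (upd j z x)) x)"
      proof (rule continuous_on_deriv_param)
        show "continuous_on (pd w \<rho> \<times> cball (y $ j) e) (\<lambda>(z, x). f (upd j z x))"
          by (rule continuous_on_subset[OF *]) (use e in auto)
        show "(\<lambda>x. f (upd j z x)) holomorphic_on ball (y $ j) e" if "z \<in> pd w \<rho>" for z
          unfolding holomorphic_on_open[OF open_ball]
        proof (intro ballI exI)
          fix x assume "x \<in> ball (y $ j) e"
          then have "x \<in> ball (w $ j) \<rho>" using e ball_subset_cball by blast
          then show "((\<lambda>x. f (upd j z x)) has_field_derivative D j (upd j z x)) (at x)"
            by (intro der) (use that \<rho>(2) in \<open>auto intro!: upd_in_pd\<close>)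
        qed
      qed (use e in auto)
      then have "continuous_on (pd w \<rho> \<inter> (\<lambda>z. z $ j) -` ball (y $ j) e) (D j)"
        using continuous_on_compose2[of _ "\<lambda>(z, x). deriv (\<lambda>x. f (upd j z x)) x"
            "pd w \<rho> \<inter> (\<lambda>z. z $ j) -` ball (y $ j) e" "\<lambda>z. (z, z $ j)"]
        unfolding D_def by (force intro!: continuous_intros)
      moreover have "open (pd w \<rho> \<inter> (\<lambda>z. z $ j) -` ball (y $ j) e)"
        by (intro open_Int open_pd open_vimage open_ball continuous_intros)
      ultimately show ?thesis
        using y e(1) by (simp add: continuous_on_eq_continuous_at)
    qed
    then show ?thesis
      by (simp add: continuous_at_imp_continuous_on)
  qed
  \<comment> \<open>\<open>cut J h\<close> retains the part of the increment \<open>h\<close> along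
    the coordinates in \<open>J\<close>. Letting \<open>J\<close> grow from the empty set to
    \<open>UNIV\<close> adds one coordinate move at each step.\<close>
  define cut where "cut J h = (\<chi> i. if i \<in> J then h $ i else 0)" for J and h :: "complex ^ 'm"
  have cut_norm: "norm (cut J h) \<le> norm h" for J h
    by (rule norm_le_componentwise_cart) (simp add: cut_def)
  have main: "\<forall>e>0. \<forall>\<^sub>F h in nhds 0. norm (f (w + cut J h) - f w - (\<Sum>j\<in>J. D j w * h $ j)) \<le> e * norm h"
    if "finite J" for J
    using that
  proof (induction J)
    case empty
    then show ?case by (auto simp: cut_def zero_vec_def[symmetric])
  next
    case (insert j J)
    show ?case
    proof (intro allI impI)
      fix e :: real assume e: "0 < e"
      have "isCont (D j) w"
        using contD[of j] \<rho>(1) continuous_on_eq_continuous_at[OF open_pd] pd_center by blast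
      then have "\<forall>\<^sub>F z in nhds w. dist (D j z) (D j w) < e / 2"
        using tendstoD[of "D j" "D j w" "nhds w" "e / 2"] e
        by (simp add: isCont_def tendsto_at_iff_tendsto_nhds)
      then obtain d0 where d0: "0 < d0" "\<And>z. z \<in> pd w d0 \<Longrightarrow> dist (D j z) (D j w) < e / 2"
        by (auto simp: eventually_nhds_pd)
      define d where "d = min d0 \<rho>"
      have d: "0 < d" "d \<le> \<rho>" "\<And>z. z \<in> pd w d \<Longrightarrow> dist (D j z) (D j w) < e / 2"
        using d0 \<rho>(1) pd_mono[of d d0 w] by (auto simp: d_def)
      have "\<forall>\<^sub>F h in nhds 0. norm (f (w + cut J h) - f w - (\<Sum>j\<in>J. D j w * h $ j)) \<le> e / 2 * norm h"
        using insert.IH[rule_format, of "e / 2"] e by (simp only: half_gt_zero)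
      moreover have "\<forall>\<^sub>F h in nhds (0 :: complex ^ 'm). norm h < d"
        using d(1) eventually_nhds_metric[of "\<lambda>h. norm h < d" "0 :: complex ^ 'm"] by auto
      ultimately show "\<forall>\<^sub>F h in nhds 0.
          norm (f (w + cut (insert j J) h) - f w - (\<Sum>j\<in>insert j J. D j w * h $ j)) \<le> e * norm h"
      proof eventually_elim
        case (elim h)
        have hd: "norm (h $ i) < d" for i
          using elim(2) Finite_Cartesian_Product.norm_nth_le[of h i] by linarith
        define z where "z = w + cut J h"
        \<comment> \<open>Subtracting the linear part leaves a function with derivative
          \<open>D j (upd j z x) - D j w\<close>, which the choice of \<open>d\<close> keeps below
          \<open>e / 2\<close>. The other \<open>e / 2\<close> is spent on the coordinates already
          moved.\<close>
        define g where "g x = f (upd j z x) - D j w * x" for x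
        have zu: "upd j z x \<in> pd w d" if "x \<in> ball (w $ j) d" for x
          using that hd d(1) by (auto simp: pd_def z_def cut_def dist_norm)
        have gder: "(g has_field_derivative (D j (upd j z x) - D j w)) (at x within ball (w $ j) d)"
          if "x \<in> ball (w $ j) d" for x
        proof -
          have "upd j z x \<in> U" using zu[OF that] d(2) \<rho>(2) pd_mono by blast
          from DERIV_diff[OF DERIV_subset[OF der[OF this]] DERIV_cmult_Id] show ?thesis
            unfolding g_def by simp
        qed
        have "norm (g (w $ j + h $ j) - g (w $ j)) \<le> e / 2 * norm (w $ j + h $ j - w $ j)"
          by (rule field_differentiable_bound[OF convex_ball gder])
            (use d zu hd in \<open>auto simp: dist_norm intro: less_imp_le\<close>)
        moreover have "upd j z (w $ j + h $ j) = w + cut (insert j J) h" "upd j z (w $ j) = w + cut J h"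
          using insert.hyps by (auto simp: vec_eq_iff z_def cut_def)
        ultimately have "norm (f (w + cut (insert j J) h) - f (w + cut J h) - D j w * h $ j) \<le> e / 2 * norm (h $ j)"
          by (simp add: g_def algebra_simps)
        also have "\<dots> \<le> e / 2 * norm h"
          using e by (intro mult_left_mono Finite_Cartesian_Product.norm_nth_le) auto
        finally have "norm ((f (w + cut (insert j J) h) - f (w + cut J h) - D j w * h $ j)
          + (f (w + cut J h) - f w - (\<Sum>j\<in>J. D j w * h $ j))) \<le> e / 2 * norm h + e / 2 * norm h"
          using elim(1) by (intro norm_triangle_le) auto
        then show ?case
          using insert.hyps by (simp add: algebra_simps)
      qed
    qed
  qed
  define L where "L h = (\<Sum>j\<in>UNIV. D j w * h $ j)" for h
  have cutU: "cut UNIV h = h" for h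
    by (simp add: cut_def)
  have lin: "bounded_linear L"
    unfolding linear_conv_bounded_linear[symmetric] linear_iff L_def
    by (simp add: algebra_simps sum.distrib scaleR_sum_right)
  have "(f has_derivative L) (at w)"
    unfolding has_derivative_at_alt
  proof (intro conjI allI impI)
    fix e :: real assume "0 < e"
    from main[OF finite_class.finite_UNIV, rule_format, OF this]
    obtain d where d: "0 < d" "\<And>h. norm h < d \<Longrightarrow> norm (f (w + h) - f w - L h) \<le> e * norm h"
      unfolding eventually_nhds_metric cutU L_def by auto
    show "\<exists>d>0. \<forall>y. norm (y - w) < d \<longrightarrow> norm (f y - f w - L (y - w)) \<le> e * norm (y - w)"
      using d(1) d(2)[of "y - w" for y] by auto
  qed (rule lin)
  moreover have "\<forall>c v. L (c *s v) = c * L v"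
    by (simp add: L_def sum_distrib_left algebra_simps)
  ultimately show "cdiff f w"
    by (auto simp: cdiff_def)
qed

text \<open>By \<open>Osgood\<close> it is enough to have joint continuity of the integral and, in
  each single coordinate, the Leibniz rule.\<close>

lemma hol_on_cint:
  fixes \<psi> :: "complex ^ 'm \<Rightarrow> complex \<Rightarrow> complex"
  assumes U: "open U" and cont: "continuous_on (U \<times> sphere c r) (\<lambda>(z, x). \<psi> z x)"
    and hol: "\<And>x. x \<in> sphere c r \<Longrightarrow> (\<lambda>z. \<psi> z x) hol_on U" and r: "0 \<le> r"
  shows "(\<lambda>z. cint c r (\<psi> z)) hol_on U"
proof (rule Osgood[OF U continuous_on_cint[OF cont r]])
  fix z j assume z: "z \<in> U"
  obtain \<rho> where \<rho>: "0 < \<rho>" "pd z \<rho> \<subseteq> U"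
    using pd_subset_open[OF U z] .
  have up: "upd j z x \<in> U" if "dist (z $ j) x \<le> \<rho> / 2" for x
    using that \<rho> upd_in_pd[of z z \<rho> j x] by auto
  show "(\<lambda>x. cint c r (\<psi> (upd j z x))) field_differentiable at (z $ j)"
  proof (rule cint_param_field_differentiable)
    show "continuous_on (cball (z $ j) (\<rho> / 2) \<times> sphere c r) (\<lambda>(p, x). \<psi> (upd j z p) x)"
      unfolding split_beta
      by (rule continuous_on_compose2[OF cont[unfolded split_beta], of _ "\<lambda>q. (upd j z (fst q), snd q)", simplified])
        (auto intro!: continuous_intros up)
    show "(\<lambda>p. \<psi> (upd j z p) x) holomorphic_on ball (z $ j) (\<rho> / 2)" if "x \<in> sphere c r" for x
      by (rule hol_on_slice[OF hol[OF that]]) (auto intro: up)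
  qed (use r \<rho> in auto)
qed

text \<open>\<open>Osgood\<close> reduces the claim to slices, where it is the one-variable theorem
  on uniform limits of holomorphic functions.\<close>

lemma hol_on_uniform_limit:
  fixes f :: "nat \<Rightarrow> complex ^ 'm \<Rightarrow> complex"
  assumes U: "open U" and hol: "\<And>k. f k hol_on U" and lim: "uniform_limit U f g sequentially"
  shows "g hol_on U"
proof (rule Osgood[OF U])
  show "continuous_on U g"
    using hol by (intro uniform_limit_theorem[OF _ lim] always_eventually allI hol_on_imp_continuous_on) auto
  fix z j assume z: "z \<in> U"
  obtain \<rho> where \<rho>: "0 < \<rho>" "pd z \<rho> \<subseteq> U"
    using pd_subset_open[OF U z] .
  have up: "upd j z x \<in> U" if "x \<in> cball (z $ j) (\<rho> / 2)" for x
    using that \<rho> upd_in_pd[of z z \<rho> j x] by auto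
  have lim': "uniform_limit (cball (z $ j) (\<rho> / 2)) (\<lambda>k x. f k (upd j z x)) (\<lambda>x. g (upd j z x)) sequentially"
    unfolding uniform_limit_iff
  proof (intro allI impI)
    fix e :: real assume "0 < e"
    then show "\<forall>\<^sub>F k in sequentially. \<forall>x\<in>cball (z $ j) (\<rho> / 2). dist (f k (upd j z x)) (g (upd j z x)) < e"
      by (rule eventually_mono[OF uniform_limitD[OF lim]]) (use up in auto)
  qed
  have "(\<lambda>x. f k (upd j z x)) holomorphic_on cball (z $ j) (\<rho> / 2)" for k
    by (rule hol_on_slice[OF hol up])
  then have "\<forall>\<^sub>F k in sequentially. continuous_on (cball (z $ j) (\<rho> / 2)) (\<lambda>x. f k (upd j z x)) \<and>
      (\<lambda>x. f k (upd j z x)) holomorphic_on ball (z $ j) (\<rho> / 2)"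
    by (intro always_eventually allI conjI)
      (auto intro: holomorphic_on_imp_continuous_on holomorphic_on_subset[OF _ ball_subset_cball])
  from holomorphic_uniform_limit[OF this lim' trivial_limit_sequentially]
  have "(\<lambda>x. g (upd j z x)) holomorphic_on ball (z $ j) (\<rho> / 2)"
    by blast
  then show "(\<lambda>x. g (upd j z x)) field_differentiable at (z $ j)"
    using \<rho>(1) by (auto intro: holomorphic_on_imp_differentiable_at)
qed

section \<open>Local generation of modules of relations\<close>

text \<open>The coordinates outside \<^term>\<open>S\<close> play the role of parameters, which lets an induction on the
  number of variables take place inside a fixed type.\<close>

definition dep_on :: "'m set \<Rightarrow> (complex ^ 'm) set \<Rightarrow> (complex ^ 'm \<Rightarrow> complex) \<Rightarrow> bool" where
  "dep_on S D f \<longleftrightarrow> f hol_on D \<and> (\<forall>z\<in>D. \<forall>z'\<in>D. (\<forall>j\<in>S. z $ j = z' $ j) \<longrightarrow> f z = f z')"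

lemma dep_onD: "\<lbrakk>dep_on S D f; z \<in> D; z' \<in> D; \<And>j. j \<in> S \<Longrightarrow> z $ j = z' $ j\<rbrakk> \<Longrightarrow> f z = f z'"
  unfolding dep_on_def by blast

lemma dep_on_hol: "dep_on S D f \<Longrightarrow> f hol_on D"
  by (simp add: dep_on_def)

lemma dep_on_cdiff: "dep_on S D f \<Longrightarrow> z \<in> D \<Longrightarrow> cdiff f z"
  by (simp add: dep_on_def hol_on_iff_cdiff)

lemma dep_on_subset: "dep_on S D f \<Longrightarrow> D' \<subseteq> D \<Longrightarrow> dep_on S D' f"
  unfolding dep_on_def hol_on_iff_cdiff by blast

lemma dep_on_mono: "dep_on S D f \<Longrightarrow> S \<subseteq> S' \<Longrightarrow> dep_on S' D f"
  unfolding dep_on_def by blast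

lemma dep_on_const: "dep_on S D (\<lambda>_. c)"
  by (simp add: dep_on_def hol_on_iff_cdiff cdiff_const)

lemma dep_on_coord: "j \<in> S \<Longrightarrow> dep_on S D (\<lambda>z. z $ j)"
  unfolding dep_on_def hol_on_iff_cdiff by (auto intro: cdiff_coord)

lemma dep_on_binop:
  assumes "dep_on S D f" "dep_on S D g" "\<And>z. \<lbrakk>z \<in> D; cdiff f z; cdiff g z\<rbrakk> \<Longrightarrow> cdiff (\<lambda>z. h (f z) (g z)) z"
  shows "dep_on S D (\<lambda>z. h (f z) (g z))"
  unfolding dep_on_def hol_on_iff_cdiff
proof (intro conjI ballI impI)
  show "cdiff (\<lambda>z. h (f z) (g z)) z" if "z \<in> D" for z
    using that assms by (blast intro: dep_on_cdiff)
  fix z z' assume "z \<in> D" "z' \<in> D" "\<forall>j\<in>S. z $ j = z' $ j"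
  then have "f z = f z'" "g z = g z'"
    using dep_onD[OF assms(1)] dep_onD[OF assms(2)] by blast+
  then show "h (f z) (g z) = h (f z') (g z')"
    by (simp only:)
qed

lemma dep_on_add: "\<lbrakk>dep_on S D f; dep_on S D g\<rbrakk> \<Longrightarrow> dep_on S D (\<lambda>z. f z + g z)"
  by (rule dep_on_binop[where h = "(+)"]) (auto intro: cdiff_add)

lemma dep_on_mult: "\<lbrakk>dep_on S D f; dep_on S D g\<rbrakk> \<Longrightarrow> dep_on S D (\<lambda>z. f z * g z)"
  by (rule dep_on_binop[where h = "(*)"]) (auto intro: cdiff_mult)

lemma dep_on_uminus: "dep_on S D f \<Longrightarrow> dep_on S D (\<lambda>z. - f z)"
  using dep_on_mult[OF dep_on_const[of S D "-1"], of f] by simp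

lemma dep_on_diff: "\<lbrakk>dep_on S D f; dep_on S D g\<rbrakk> \<Longrightarrow> dep_on S D (\<lambda>z. f z - g z)"
  using dep_on_add[OF _ dep_on_uminus, of S D f g] by simp

lemma dep_on_sum: "(\<And>i. i \<in> I \<Longrightarrow> dep_on S D (f i)) \<Longrightarrow> dep_on S D (\<lambda>z. \<Sum>i\<in>I. f i z)"
  by (induction I rule: infinite_finite_induct) (simp_all add: dep_on_const dep_on_add)

lemma dep_on_power: "dep_on S D f \<Longrightarrow> dep_on S D (\<lambda>z. f z ^ k)"
  by (induction k) (simp_all add: dep_on_const dep_on_mult)

lemma dep_on_inverse:
  "\<lbrakk>dep_on S D f; \<And>z. z \<in> D \<Longrightarrow> f z \<noteq> 0\<rbrakk> \<Longrightarrow> dep_on S D (\<lambda>z. inverse (f z))"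
  by (rule dep_on_binop[where h = "\<lambda>a b. inverse a" and g = f]) (auto intro: cdiff_inverse)

lemma dep_on_divide:
  "\<lbrakk>dep_on S D f; dep_on S D g; \<And>z. z \<in> D \<Longrightarrow> g z \<noteq> 0\<rbrakk> \<Longrightarrow> dep_on S D (\<lambda>z. f z / g z)"
  unfolding divide_inverse by (intro dep_on_mult dep_on_inverse)

text \<open>This is where a variable disappears: circle integrals over coordinate \<open>n\<close>
  have integrands of the form \<open>f (upd n z x)\<close>.\<close>

lemma dep_on_slice:
  assumes "dep_on S D f" "\<And>z. z \<in> D' \<Longrightarrow> upd n z x \<in> D"
  shows "dep_on (S - {n}) D' (\<lambda>z. f (upd n z x))"
  unfolding dep_on_def hol_on_iff_cdiff
proof (intro conjI ballI impI)
  show "cdiff (\<lambda>z. f (upd n z x)) z" if "z \<in> D'" for z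
    by (rule cdiff_comp_upd[OF dep_on_cdiff[OF assms(1) assms(2)[OF that]]])
  show "f (upd n z x) = f (upd n z' x)" if "z \<in> D'" "z' \<in> D'" "\<forall>j\<in>S - {n}. z $ j = z' $ j" for z z'
    by (rule dep_onD[OF assms(1)]) (use that assms(2) in auto)
qed

lemma dep_on_cint:
  fixes \<psi> :: "complex ^ 'm \<Rightarrow> complex \<Rightarrow> complex"
  assumes "open D" "continuous_on (D \<times> sphere c r) (\<lambda>q. \<psi> (fst q) (snd q))" "0 \<le> r"
    and \<psi>: "\<And>x. x \<in> sphere c r \<Longrightarrow> dep_on S D (\<lambda>z. \<psi> z x)"
  shows "dep_on S D (\<lambda>z. cint c r (\<psi> z))"
  unfolding dep_on_def
proof (intro conjI ballI impI)
  show "(\<lambda>z. cint c r (\<psi> z)) hol_on D"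
    by (rule hol_on_cint) (use assms dep_on_hol[OF \<psi>] in \<open>auto simp: split_beta\<close>)
  show "cint c r (\<psi> z) = cint c r (\<psi> z')" if "z \<in> D" "z' \<in> D" "\<forall>j\<in>S. z $ j = z' $ j" for z z'
    by (rule cint_cong[OF _ assms(3)], rule dep_onD[OF \<psi>]) (use that in auto)
qed

lemma dep_on_if: "\<lbrakk>P \<Longrightarrow> dep_on S D f; \<not> P \<Longrightarrow> dep_on S D g\<rbrakk> \<Longrightarrow> dep_on S D (\<lambda>z. if P then f z else g z)"
  by (cases P) auto

lemmas dep_on_intros = dep_on_const dep_on_coord dep_on_add dep_on_mult dep_on_uminus dep_on_diff
  dep_on_sum dep_on_power dep_on_if

text \<open>Germs are handled through representatives: this predicate together with equality
  eventually in \<open>nhds y\<close> stands for the stalk at \<open>y\<close>.\<close>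

definition hol_near :: "complex ^ 'm \<Rightarrow> (complex ^ 'm \<Rightarrow> complex) \<Rightarrow> bool" where
  "hol_near y f \<longleftrightarrow> (\<forall>\<^sub>F z in nhds y. cdiff f z)"

lemma hol_near_add: "\<lbrakk>hol_near y f; hol_near y g\<rbrakk> \<Longrightarrow> hol_near y (\<lambda>z. f z + g z)"
  unfolding hol_near_def by (erule (1) eventually_elim2) (rule cdiff_add)

lemma hol_near_mult: "\<lbrakk>hol_near y f; hol_near y g\<rbrakk> \<Longrightarrow> hol_near y (\<lambda>z. f z * g z)"
  unfolding hol_near_def by (erule (1) eventually_elim2) (rule cdiff_mult)

lemma hol_near_diff: "\<lbrakk>hol_near y f; hol_near y g\<rbrakk> \<Longrightarrow> hol_near y (\<lambda>z. f z - g z)"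
  unfolding hol_near_def by (erule (1) eventually_elim2) (rule cdiff_diff)

lemma hol_near_const: "hol_near y (\<lambda>_. c)"
  by (simp add: hol_near_def cdiff_const)

lemma hol_near_uminus: "hol_near y f \<Longrightarrow> hol_near y (\<lambda>z. - f z)"
  using hol_near_diff[OF hol_near_const[of y 0]] by simp

lemma hol_near_sum: "(\<And>i. i \<in> I \<Longrightarrow> hol_near y (f i)) \<Longrightarrow> hol_near y (\<lambda>z. \<Sum>i\<in>I. f i z)"
  by (induction I rule: infinite_finite_induct) (simp_all add: hol_near_const hol_near_add)

lemmas hol_near_intros = hol_near_const hol_near_add hol_near_mult hol_near_uminus hol_near_diff hol_near_sum

lemma hol_on_hol_near: "\<lbrakk>f hol_on U; open U; y \<in> U\<rbrakk> \<Longrightarrow> hol_near y f"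
  unfolding hol_near_def hol_on_iff_cdiff eventually_nhds by blast

lemma dep_on_hol_near: "\<lbrakk>dep_on S U f; open U; y \<in> U\<rbrakk> \<Longrightarrow> hol_near y f"
  by (rule hol_on_hol_near[OF dep_on_hol])

lemma hol_near_inverse: "\<lbrakk>hol_near y f; f y \<noteq> 0\<rbrakk> \<Longrightarrow> hol_near y (\<lambda>z. inverse (f z))"
proof -
  assume *: "hol_near y f" "f y \<noteq> 0"
  have "isCont f y"
    using eventually_nhds_x_imp_x[OF *(1)[unfolded hol_near_def]] by (rule cdiff_imp_isCont)
  then have "\<forall>\<^sub>F z in nhds y. f z \<noteq> 0"
    unfolding isCont_def tendsto_at_iff_tendsto_nhds
    by (rule tendsto_imp_eventually_ne) (rule *(2))
  with *(1) show ?thesis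
    unfolding hol_near_def by eventually_elim (rule cdiff_inverse)
qed

text \<open>\<open>E\<close> indexes simultaneous linear equations, \<open>I\<close> the unknowns
  and \<open>\<Lambda>\<close> the generating solutions. There is a deliberate asymmetry: the
  generators depend on the coordinates in \<open>S\<close> only, but they must generate solutions
  \<open>a\<close> that depend on all coordinates. In the induction the solutions to be generated
  are remainders of arbitrary germs, which are free of the coordinate \<open>n\<close> but not of
  the parameters. Several equations are allowed because comparing coefficients turns one relation
  into a system.\<close>

definition gen_rel ::
  "'m set \<Rightarrow> (complex ^ 'm) set \<Rightarrow> 'e set \<Rightarrow> 'i set \<Rightarrow> ('e \<Rightarrow> 'i \<Rightarrow> complex ^ 'm \<Rightarrow> complex)
    \<Rightarrow> 'l set \<Rightarrow> ('l \<Rightarrow> 'i \<Rightarrow> complex ^ 'm \<Rightarrow> complex) \<Rightarrow> bool" where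
  "gen_rel S D E I s \<Lambda> G \<longleftrightarrow>
     finite \<Lambda> \<and> (\<forall>l\<in>\<Lambda>. \<forall>i\<in>I. dep_on S D (G l i)) \<and>
     (\<forall>l\<in>\<Lambda>. \<forall>e\<in>E. \<forall>z\<in>D. (\<Sum>i\<in>I. G l i z * s e i z) = 0) \<and>
     (\<forall>y\<in>D. \<forall>a. (\<forall>i\<in>I. hol_near y (a i)) \<and> (\<forall>e\<in>E. \<forall>\<^sub>F z in nhds y. (\<Sum>i\<in>I. a i z * s e i z) = 0) \<longrightarrow>
        (\<exists>c. (\<forall>l\<in>\<Lambda>. hol_near y (c l)) \<and> (\<forall>i\<in>I. \<forall>\<^sub>F z in nhds y. a i z = (\<Sum>l\<in>\<Lambda>. c l z * G l i z))))"

definition fin_rel ::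
  "'m set \<Rightarrow> complex ^ 'm \<Rightarrow> 'e set \<Rightarrow> 'i set \<Rightarrow> ('e \<Rightarrow> 'i \<Rightarrow> complex ^ 'm \<Rightarrow> complex) \<Rightarrow> bool" where
  "fin_rel S w E I s \<longleftrightarrow> (\<exists>\<rho>>0. \<exists>(N::nat) G. gen_rel S (pd w \<rho>) E I s {..<N} G)"

lemma gen_rel_subset: "\<lbrakk>gen_rel S D E I s \<Lambda> G; D' \<subseteq> D\<rbrakk> \<Longrightarrow> gen_rel S D' E I s \<Lambda> G"
  unfolding gen_rel_def by (auto intro: dep_on_subset)

lemma gen_relD:
  assumes "gen_rel S D E I s \<Lambda> G" "y \<in> D" "\<And>i. i \<in> I \<Longrightarrow> hol_near y (a i)"
    "\<And>e. e \<in> E \<Longrightarrow> \<forall>\<^sub>F z in nhds y. (\<Sum>i\<in>I. a i z * s e i z) = 0"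
  obtains c where "\<And>l. l \<in> \<Lambda> \<Longrightarrow> hol_near y (c l)"
    "\<And>i. i \<in> I \<Longrightarrow> \<forall>\<^sub>F z in nhds y. a i z = (\<Sum>l\<in>\<Lambda>. c l z * G l i z)"
proof -
  have "\<forall>y\<in>D. \<forall>a. (\<forall>i\<in>I. hol_near y (a i)) \<and> (\<forall>e\<in>E. \<forall>\<^sub>F z in nhds y. (\<Sum>i\<in>I. a i z * s e i z) = 0) \<longrightarrow>
      (\<exists>c. (\<forall>l\<in>\<Lambda>. hol_near y (c l)) \<and> (\<forall>i\<in>I. \<forall>\<^sub>F z in nhds y. a i z = (\<Sum>l\<in>\<Lambda>. c l z * G l i z)))"
    using assms(1) unfolding gen_rel_def by (elim conjE)
  from this[rule_format, of y a] assms(2-4) that show ?thesis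
    by blast
qed

lemma gen_rel_dep: "\<lbrakk>gen_rel S D E I s \<Lambda> G; l \<in> \<Lambda>; i \<in> I\<rbrakk> \<Longrightarrow> dep_on S D (G l i)"
  by (simp add: gen_rel_def)

lemma gen_rel_zero: "\<lbrakk>gen_rel S D E I s \<Lambda> G; l \<in> \<Lambda>; e \<in> E; z \<in> D\<rbrakk> \<Longrightarrow> (\<Sum>i\<in>I. G l i z * s e i z) = 0"
  by (simp add: gen_rel_def)

lemma gen_rel_finite: "gen_rel S D E I s \<Lambda> G \<Longrightarrow> finite \<Lambda>"
  by (simp add: gen_rel_def)

text \<open>Renumbers the generators, so that a proof may index them by whatever finite set is
  convenient, for instance a disjoint sum.\<close>

lemma fin_relI:
  fixes G :: "'l \<Rightarrow> 'i \<Rightarrow> complex ^ 'm \<Rightarrow> complex"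
  assumes "0 < \<rho>" and G: "gen_rel S (pd w \<rho>) E I s \<Lambda> G"
  shows "fin_rel S w E I s"
proof -
  obtain h where h: "bij_betw h {..<card \<Lambda>} \<Lambda>"
    using bij_betw_from_nat_into_finite gen_rel_finite[OF G] by blast
  note inv = bij_betw_inv_into[OF h]
  have "gen_rel S (pd w \<rho>) E I s {..<card \<Lambda>} (\<lambda>k. G (h k))"
    unfolding gen_rel_def
  proof (intro conjI ballI allI impI, goal_cases)
    case (2 l i)
    then show ?case using G bij_betwE[OF h] by (auto simp: gen_rel_def)
  next
    case (3 l e z)
    then show ?case using G bij_betwE[OF h] by (auto simp: gen_rel_def)
  next
    case (4 y a)
    obtain c where c: "\<And>l. l \<in> \<Lambda> \<Longrightarrow> hol_near y (c l)"
      "\<And>i. i \<in> I \<Longrightarrow> \<forall>\<^sub>F z in nhds y. a i z = (\<Sum>l\<in>\<Lambda>. c l z * G l i z)"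
      by (rule gen_relD[OF G 4(1), of a]) (use 4(2) in blast)+
    have "(\<Sum>l\<in>\<Lambda>. c l z * G l i z) = (\<Sum>k<card \<Lambda>. c (h k) z * G (h k) i z)" for i z
      by (rule sum.reindex_bij_betw[OF h, symmetric])
    with c show ?case
      using bij_betwE[OF h] by (intro exI[of _ "\<lambda>k. c (h k)"]) auto
  qed simp
  then show ?thesis
    unfolding fin_rel_def using assms(1) by blast
qed

text \<open>Allows unknowns indexed by pairs, as they arise from the coefficients of several
  polynomials.\<close>

lemma fin_rel_reindex:
  assumes h: "bij_betw h J I" and J: "fin_rel S w E J (\<lambda>e j. s e (h j))"
  shows "fin_rel S w E I s"
proof -
  obtain \<rho> N G where \<rho>: "0 < \<rho>" and G: "gen_rel S (pd w \<rho>) E J (\<lambda>e j. s e (h j)) {..<N::nat} G"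
    using J by (auto simp: fin_rel_def)
  define k where "k = inv_into J h"
  have k: "bij_betw k I J"
    unfolding k_def by (rule bij_betw_inv_into[OF h])
  have hk: "h (k i) = i" "k i \<in> J" if "i \<in> I" for i
    using that h k by (auto simp: k_def bij_betw_inv_into_right dest: bij_betwE)
  have kh: "k (h j) = j" "h j \<in> I" if "j \<in> J" for j
    using that h by (auto simp: k_def bij_betw_inv_into_left dest: bij_betwE)
  have sum: "(\<Sum>j\<in>J. F (h j)) = (\<Sum>i\<in>I. F i)" for F :: "_ \<Rightarrow> complex"
    by (rule sum.reindex_bij_betw[OF h])
  have "gen_rel S (pd w \<rho>) E I s {..<N} (\<lambda>l i. G l (k i))"
    unfolding gen_rel_def
  proof (intro conjI ballI allI impI, goal_cases)
    case (2 l i)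
    then show ?case using gen_rel_dep[OF G] hk by simp
  next
    case (3 l e z)
    have "(\<Sum>i\<in>I. G l (k i) z * s e i z) = (\<Sum>j\<in>J. G l (k (h j)) z * s e (h j) z)"
      by (rule sum[symmetric])
    also have "\<dots> = (\<Sum>j\<in>J. G l j z * s e (h j) z)"
      by (rule sum.cong) (simp_all add: kh)
    finally show ?case using gen_rel_zero[OF G 3] by simp
  next
    case (4 y a)
    have sj: "\<forall>\<^sub>F z in nhds y. (\<Sum>j\<in>J. a (h j) z * s e (h j) z) = 0" if "e \<in> E" for e
      using 4 that unfolding sum[of "\<lambda>i. a i z * s e i z" for e z] by blast
    obtain c where c: "\<And>l. l \<in> {..<N} \<Longrightarrow> hol_near y (c l)"
      "\<And>j. j \<in> J \<Longrightarrow> \<forall>\<^sub>F z in nhds y. a (h j) z = (\<Sum>l<N. c l z * G l j z)"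
      by (rule gen_relD[OF G 4(1), of "\<lambda>j. a (h j)"]) (use 4(2) kh(2) sj in blast)+
    show ?case
    proof (intro exI[of _ c] conjI ballI)
      show "\<forall>\<^sub>F z in nhds y. a i z = (\<Sum>l<N. c l z * G l (k i) z)" if "i \<in> I" for i
        using c(2)[OF hk(2)[OF that]] hk(1)[OF that] by simp
    qed (use c in auto)
  qed simp
  then show ?thesis
    unfolding fin_rel_def using \<rho> by blast
qed

text \<open>Equations are added one at a time. If \<open>G\<close> generates the solutions of the
  equations in \<open>E\<close>, then evaluating the new equation on each \<open>G l\<close> gives
  functions \<open>t l\<close>, and a combination of the \<open>G l\<close> solves the new equation
  exactly when its coefficients form a relation of the \<open>t l\<close>. Generators
  \<open>H\<close> of these relations, combined with \<open>G\<close>, generate the solutions of the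
  larger system.\<close>

lemma fin_rel_vector:
  fixes s :: "'e \<Rightarrow> nat \<Rightarrow> complex ^ 'm \<Rightarrow> complex"
  assumes scalar: "\<And>(n::nat) t. (\<And>i. i < n \<Longrightarrow> \<exists>\<rho>>0. dep_on S (pd w \<rho>) (t i)) \<Longrightarrow> fin_rel S w {()} {..<n} (\<lambda>_. t)"
    and E: "finite E" and s: "\<And>e i. e \<in> E \<Longrightarrow> i < n \<Longrightarrow> \<exists>\<rho>>0. dep_on S (pd w \<rho>) (s e i)"
  shows "fin_rel S w E {..<n} s"
  using E s
proof (induction E)
  case empty
  have "gen_rel S (pd w 1) {} {..<n} s {..<n} (\<lambda>l i z. if i = l then 1 else 0)"
    unfolding gen_rel_def
  proof (intro conjI ballI allI impI, goal_cases)
    case (4 y a)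
    then show ?case by (intro exI[of _ a]) (auto intro!: always_eventually simp: if_distrib cong: if_cong)
  qed (auto intro!: dep_on_intros)
  then show ?case by (rule fin_relI[rotated]) simp
next
  case (insert e E)
  then obtain \<rho> N G where \<rho>: "0 < \<rho>" and G: "gen_rel S (pd w \<rho>) E {..<n} s {..<N::nat} G"
    by (auto simp: fin_rel_def)
  have "\<exists>\<rho>e. \<forall>i<n. 0 < \<rho>e i \<and> dep_on S (pd w (\<rho>e i)) (s e i)"
    using insert.prems by (intro choice) auto
  then obtain \<rho>e where \<rho>e: "\<And>i. i < n \<Longrightarrow> 0 < \<rho>e i" "\<And>i. i < n \<Longrightarrow> dep_on S (pd w (\<rho>e i)) (s e i)"
    by blast
  define \<rho>1 where "\<rho>1 = Min (insert \<rho> (\<rho>e ` {..<n}))"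
  have \<rho>1: "0 < \<rho>1" "\<rho>1 \<le> \<rho>" "\<And>i. i < n \<Longrightarrow> \<rho>1 \<le> \<rho>e i"
    using \<rho> \<rho>e by (auto simp: \<rho>1_def)
  define t where "t l z = (\<Sum>i<n. G l i z * s e i z)" for l z
  have G1: "gen_rel S (pd w \<rho>1) E {..<n} s {..<N} G"
    by (rule gen_rel_subset[OF G pd_mono[OF \<rho>1(2)]])
  have s1: "dep_on S (pd w \<rho>1) (s e i)" if "i < n" for i
    by (rule dep_on_subset[OF \<rho>e(2) pd_mono[OF \<rho>1(3)]]) (use that in auto)
  have "dep_on S (pd w \<rho>1) (t l)" if "l < N" for l
    unfolding t_def using that by (intro dep_on_intros s1 gen_rel_dep[OF G1]) auto
  then have "fin_rel S w {()} {..<N} (\<lambda>_. t)"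
    using \<rho>1(1) by (intro scalar) blast
  then obtain \<rho>2 N' H where \<rho>2: "0 < \<rho>2" and H: "gen_rel S (pd w \<rho>2) {()} {..<N} (\<lambda>_. t) {..<N'::nat} H"
    by (auto simp: fin_rel_def)
  define \<rho>3 where "\<rho>3 = min \<rho>1 \<rho>2"
  have \<rho>3: "0 < \<rho>3" "pd w \<rho>3 \<subseteq> pd w \<rho>1" "pd w \<rho>3 \<subseteq> pd w \<rho>2"
    using \<rho>1 \<rho>2 by (auto simp: \<rho>3_def intro!: pd_mono)
  note G3 = gen_rel_subset[OF G1 \<rho>3(2)] and H3 = gen_rel_subset[OF H \<rho>3(3)]
  have "gen_rel S (pd w \<rho>3) (insert e E) {..<n} s {..<N'} (\<lambda>k i z. \<Sum>l<N. H k l z * G l i z)"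
    unfolding gen_rel_def
  proof (intro conjI ballI allI impI, goal_cases)
    case (2 k i)
    then show ?case by (intro dep_on_intros gen_rel_dep[OF G3] gen_rel_dep[OF H3]) auto
  next
    case (3 k e' z)
    have "(\<Sum>i<n. (\<Sum>l<N. H k l z * G l i z) * s e' i z) = (\<Sum>l<N. H k l z * (\<Sum>i<n. G l i z * s e' i z))"
      by (simp add: sum_distrib_left sum_distrib_right mult.assoc) (rule sum.swap)
    also have "\<dots> = 0"
    proof (cases "e' = e")
      case True
      then show ?thesis using gen_rel_zero[OF H3, of k "()" z] 3 by (simp add: t_def)
    next
      case False
      then show ?thesis using gen_rel_zero[OF G3, of _ e' z] 3 by simp
    qed
    finally show ?case .
  next
    case (4 y a)
    obtain c where c: "\<And>l. l \<in> {..<N} \<Longrightarrow> hol_near y (c l)"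
      "\<And>i. i \<in> {..<n} \<Longrightarrow> \<forall>\<^sub>F z in nhds y. a i z = (\<Sum>l<N. c l z * G l i z)"
      by (rule gen_relD[OF G3 4(1), of a]) (use 4(2) in blast)+
    have "\<forall>\<^sub>F z in nhds y. \<forall>i\<in>{..<n}. a i z = (\<Sum>l<N. c l z * G l i z)"
      by (rule eventually_ball_finite) (use c in auto)
    moreover have "\<forall>\<^sub>F z in nhds y. (\<Sum>i<n. a i z * s e i z) = 0"
      using 4 by blast
    ultimately have ct: "\<forall>\<^sub>F z in nhds y. (\<Sum>l<N. c l z * t l z) = 0"
    proof eventually_elim
      case (elim z)
      have "(\<Sum>l<N. c l z * t l z) = (\<Sum>i<n. (\<Sum>l<N. c l z * G l i z) * s e i z)"
        by (simp add: t_def sum_distrib_left sum_distrib_right mult.assoc) (rule sum.swap)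
      with elim show ?case by simp
    qed
    obtain d where d: "\<And>k. k \<in> {..<N'} \<Longrightarrow> hol_near y (d k)"
      "\<And>l. l \<in> {..<N} \<Longrightarrow> \<forall>\<^sub>F z in nhds y. c l z = (\<Sum>k<N'. d k z * H k l z)"
      by (rule gen_relD[OF H3 4(1), of c]) (use c(1) ct in blast)+
    have d': "\<forall>\<^sub>F z in nhds y. \<forall>l\<in>{..<N}. c l z = (\<Sum>k<N'. d k z * H k l z)"
      by (rule eventually_ball_finite) (use d in auto)
    show ?case
    proof (intro exI[of _ d] conjI ballI)
      fix i assume "i \<in> {..<n}"
      then have "\<forall>\<^sub>F z in nhds y. a i z = (\<Sum>l<N. c l z * G l i z)" using c by simp
      with d' show "\<forall>\<^sub>F z in nhds y. a i z = (\<Sum>k<N'. d k z * (\<Sum>l<N. H k l z * G l i z))"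
      proof eventually_elim
        case (elim z)
        have "(\<Sum>k<N'. d k z * (\<Sum>l<N. H k l z * G l i z)) = (\<Sum>l<N. (\<Sum>k<N'. d k z * H k l z) * G l i z)"
          by (simp add: sum_distrib_left sum_distrib_right mult.assoc) (rule sum.swap)
        with elim show ?case by simp
      qed
    qed (use d in auto)
  qed simp
  then show ?case by (rule fin_relI[OF \<rho>3(1)])
qed

section \<open>Relations in the two cases without division\<close>

lemma sum_mult_delta:
  fixes c f :: "nat \<Rightarrow> 'a::semiring_0"
  shows "i < n \<Longrightarrow> (\<Sum>l<n. c l * (if i = l then f l else 0)) = c i * f i"
    and "i < n \<Longrightarrow> (\<Sum>l<n. (if l = i then f l else 0) * c l) = f i * c i"
  by (simp_all add: if_distrib[of "\<lambda>x. _ * x"] if_distrib[of "\<lambda>x. x * _"] cong: if_cong)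

text \<open>Every tuple is a relation, so the unit vectors generate.\<close>

lemma fin_rel_zero:
  fixes n :: nat
  assumes "0 < \<rho>" "\<And>i z. i < n \<Longrightarrow> z \<in> pd w \<rho> \<Longrightarrow> s i z = 0"
  shows "fin_rel S w {()} {..<n} (\<lambda>_. s)"
proof -
  have "gen_rel S (pd w \<rho>) {()} {..<n} (\<lambda>_. s) {..<n} (\<lambda>l i z. if i = l then 1 else 0)"
    unfolding gen_rel_def
  proof (intro conjI ballI allI impI, goal_cases)
    case (4 y a)
    then show ?case
      by (intro exI[of _ a] conjI ballI) (simp_all add: sum_mult_delta)
  qed (use assms in \<open>auto intro!: dep_on_intros\<close>)
  then show ?thesis by (rule fin_relI[OF assms(1)])
qed

lemma dep_on_nonzero_near:
  assumes \<rho>: "0 < \<rho>" and f: "dep_on S (pd w \<rho>) f" and fw: "f w \<noteq> 0"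
  obtains \<rho>' where "0 < \<rho>'" "pd w \<rho>' \<subseteq> pd w \<rho>" "\<And>z. z \<in> pd w \<rho>' \<Longrightarrow> f z \<noteq> 0"
proof -
  have "isCont f w"
    using dep_on_cdiff[OF f, of w] \<rho> by (simp add: cdiff_imp_isCont)
  then have "\<forall>\<^sub>F z in nhds w. f z \<noteq> 0"
    unfolding isCont_def tendsto_at_iff_tendsto_nhds
    by (rule tendsto_imp_eventually_ne) (rule fw)
  then obtain \<rho>1 where \<rho>1: "0 < \<rho>1" "\<And>z. z \<in> pd w \<rho>1 \<Longrightarrow> f z \<noteq> 0"
    by (auto simp: eventually_nhds_pd)
  show ?thesis
    by (rule that[of "min \<rho> \<rho>1"])
      (use \<rho> \<rho>1 pd_mono[of "min \<rho> \<rho>1" \<rho> w] pd_mono[of "min \<rho> \<rho>1" \<rho>1 w] in auto)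
qed

text \<open>Near \<open>w\<close> a relation can be solved for its entry at \<open>q\<close>; the
  other entries are free and determine it.\<close>

lemma fin_rel_nonzero:
  fixes n :: nat
  assumes \<rho>: "0 < \<rho>" and s: "\<And>i. i < n \<Longrightarrow> dep_on S (pd w \<rho>) (s i)" and q: "q < n" "s q w \<noteq> 0"
  shows "fin_rel S w {()} {..<n} (\<lambda>_. s)"
proof -
  obtain \<rho>2 where \<rho>2: "0 < \<rho>2" "pd w \<rho>2 \<subseteq> pd w \<rho>" "\<And>z. z \<in> pd w \<rho>2 \<Longrightarrow> s q z \<noteq> 0"
    by (rule dep_on_nonzero_near[OF \<rho> s[OF q(1)] q(2)]) (assumption | rule that)+
  note s2 = dep_on_subset[OF s \<rho>2(2)]
  \<comment> \<open>The Koszul relation with \<open>s q\<close> in place \<open>l\<close> and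
    \<open>- s l\<close> in place \<open>q\<close>; it is zero for \<open>l = q\<close>. A relation
    \<open>a\<close> is the combination of these with coefficients \<open>a l / s q\<close>.\<close>
  define G where "G l i z = (if i = l then s q z else 0) - (if i = q then s l z else 0)" for l i z
  have G: "(\<Sum>l<n. c l * G l i z) = c i * s q z - (if i = q then \<Sum>l<n. c l * s l z else 0)" if "i < n" for c i z
    using that by (cases "i = q") (simp_all add: G_def right_diff_distrib sum_subtractf sum_mult_delta)
  have "gen_rel S (pd w \<rho>2) {()} {..<n} (\<lambda>_. s) {..<n} G"
    unfolding gen_rel_def
  proof (intro conjI ballI allI impI, goal_cases)
    case (2 l i)
    then show ?case unfolding G_def using q(1) by (intro dep_on_intros s2) auto
  next
    case (3 l e z)
    then show ?case
      using q(1) by (simp add: G_def left_diff_distrib sum_subtractf sum_mult_delta)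
  next
    case (4 y a)
    have sq: "hol_near y (s q)"
      by (rule dep_on_hol_near[OF s2[OF q(1)] open_pd 4(1)])
    have "\<forall>\<^sub>F z in nhds y. z \<in> pd w \<rho>2"
      using open_pd 4(1) by (rule eventually_nhds_in_open)
    moreover have "\<forall>\<^sub>F z in nhds y. (\<Sum>i<n. a i z * s i z) = 0"
      using 4 by blast
    ultimately have "\<forall>\<^sub>F z in nhds y. \<forall>i<n. a i z = (\<Sum>l<n. (a l z * inverse (s q z)) * G l i z)"
    proof eventually_elim
      case (elim z)
      have "(\<Sum>l<n. a l z * inverse (s q z) * s l z) = 0"
        using arg_cong[OF elim(2), of "\<lambda>x. inverse (s q z) * x"] by (simp add: sum_distrib_left mult_ac)
      then show ?case
        using elim(1) \<rho>2(3) by (simp add: G)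
    qed
    then have "\<forall>\<^sub>F z in nhds y. a i z = (\<Sum>l<n. (a l z * inverse (s q z)) * G l i z)" if "i < n" for i
      by (rule eventually_mono) (use that in blast)
    moreover have "hol_near y (\<lambda>z. a l z * inverse (s q z))" if "l < n" for l
      using 4 that sq \<rho>2(3) by (intro hol_near_mult hol_near_inverse) auto
    ultimately show ?case by (intro exI[of _ "\<lambda>l z. a l z * inverse (s q z)"]) auto
  qed simp
  then show ?thesis by (rule fin_relI[OF \<rho>2(1)])
qed

section \<open>Shears\<close>

lemma eventually_nhds_comp:
  "\<lbrakk>isCont T x; \<forall>\<^sub>F z in nhds (T x). P z\<rbrakk> \<Longrightarrow> \<forall>\<^sub>F z in nhds x. P (T z)"
  unfolding isCont_def tendsto_at_iff_tendsto_nhds by (simp add: filterlim_iff)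

text \<open>For \<open>u $ n = 0\<close> this linear change of coordinates around \<open>w\<close>
  preserves the coordinate \<open>n\<close>, has the shear by \<open>- u\<close> as its inverse, and
  tilts the axis \<open>n\<close> through \<open>w\<close> into the direction
  \<open>axis n 1 + u\<close>.\<close>

definition shear :: "'m \<Rightarrow> complex ^ 'm \<Rightarrow> complex ^ 'm \<Rightarrow> complex ^ 'm \<Rightarrow> complex ^ 'm" where
  "shear n w u z = z + (z $ n - w $ n) *s u"

lemma shear_shear: "u $ n = 0 \<Longrightarrow> shear n w u (shear n w (- u) z) = z"
  by (simp add: shear_def vec_eq_iff)

lemma shear_center: "shear n w u w = w"
  by (simp add: shear_def vec_eq_iff)

lemma has_derivative_shear: "(shear n w u has_derivative (\<lambda>h. h + h $ n *s u)) (at z)"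
proof -
  have "bounded_linear (\<lambda>h. h + h $ n *s u)"
    by (simp add: linear_conv_bounded_linear[symmetric] linear_iff vec_eq_iff algebra_simps)
  then have "((\<lambda>z. (z + z $ n *s u) - w $ n *s u) has_derivative (\<lambda>h. (h + h $ n *s u) - 0)) (at z)"
    by (intro has_derivative_diff has_derivative_const bounded_linear_imp_has_derivative)
  moreover have "(\<lambda>z. (z + z $ n *s u) - w $ n *s u) = shear n w u"
    by (auto simp: shear_def vec_eq_iff algebra_simps)
  ultimately show ?thesis by simp
qed

lemma isCont_shear: "isCont (shear n w u) z"
  using has_derivative_continuous[OF has_derivative_shear] .

lemma cdiff_shear: "cdiff f (shear n w u z) \<Longrightarrow> cdiff (\<lambda>z. f (shear n w u z)) z"
  by (rule cdiff_compose_vec[OF has_derivative_shear]) (auto simp: vec_eq_iff algebra_simps)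

lemma hol_near_shear:
  assumes "hol_near (shear n w u y) f"
  shows "hol_near y (\<lambda>z. f (shear n w u z))"
  unfolding hol_near_def
  by (rule eventually_mono[OF eventually_nhds_comp[OF isCont_shear assms[unfolded hol_near_def]]])
    (rule cdiff_shear)

text \<open>Since \<open>n\<close> lies in \<open>S\<close>, the sheared coordinates in
  \<open>S\<close> are functions of the old coordinates in \<open>S\<close>; a shear introduces no
  dependence on the parameters.\<close>

lemma dep_on_shear:
  assumes "dep_on S D f" "n \<in> S" "shear n w u ` D' \<subseteq> D"
  shows "dep_on S D' (\<lambda>z. f (shear n w u z))"
  unfolding dep_on_def hol_on_iff_cdiff
proof (intro conjI ballI impI)
  show "cdiff (\<lambda>z. f (shear n w u z)) z" if "z \<in> D'" for z
    by (rule cdiff_shear, rule dep_on_cdiff[OF assms(1)]) (use that assms(3) in blast)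
  fix z z' assume *: "z \<in> D'" "z' \<in> D'" "\<forall>j\<in>S. z $ j = z' $ j"
  then have "shear n w u z $ j = shear n w u z' $ j" if "j \<in> S" for j
    using that assms(2) by (simp add: shear_def)
  then show "f (shear n w u z) = f (shear n w u z')"
    by (intro dep_onD[OF assms(1)]) (use * assms(3) in blast)+
qed

lemma shear_pd:
  assumes "0 < \<rho>"
  obtains \<rho>' where "0 < \<rho>'" "shear n w u ` pd w \<rho>' \<subseteq> pd w \<rho>"
proof -
  have "\<forall>\<^sub>F z in nhds (shear n w u w). z \<in> pd w \<rho>"
    using assms by (intro eventually_nhds_in_open open_pd) (simp add: shear_center)
  from eventually_nhds_comp[OF isCont_shear this] show ?thesis
    using that by (auto simp: eventually_nhds_pd)
qed

text \<open>A relation at \<open>y\<close> is carried to the preimage \<open>R y\<close> of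
  \<open>y\<close> under the shear \<open>T\<close>, expanded there, and the expansion is carried
  back by the inverse shear \<open>R\<close>.\<close>

lemma fin_rel_shear:
  assumes n: "n \<in> S" "u $ n = 0" and fr: "fin_rel S w E I (\<lambda>e i z. s e i (shear n w u z))"
  shows "fin_rel S w E I s"
proof -
  obtain \<rho> N G where \<rho>: "0 < \<rho>" and G: "gen_rel S (pd w \<rho>) E I (\<lambda>e i z. s e i (shear n w u z)) {..<N::nat} G"
    using fr by (auto simp: fin_rel_def)
  obtain \<rho>' where \<rho>': "0 < \<rho>'" "shear n w (- u) ` pd w \<rho>' \<subseteq> pd w \<rho>"
    using shear_pd[OF \<rho>] .
  define T R where "T = shear n w u" and "R = shear n w (- u)"
  have TR: "T (R z) = z" and RT: "R (T z) = z" for z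
    using shear_shear[of u n w z] shear_shear[of "- u" n w z] n(2) by (simp_all add: T_def R_def)
  have R: "R z \<in> pd w \<rho>" if "z \<in> pd w \<rho>'" for z
    using \<rho>'(2) that by (auto simp: R_def)
  have "gen_rel S (pd w \<rho>') E I s {..<N} (\<lambda>l i z. G l i (R z))"
    unfolding gen_rel_def
  proof (intro conjI ballI allI impI, goal_cases)
    case (2 l i)
    then show ?case
      unfolding R_def by (intro dep_on_shear[OF gen_rel_dep[OF G]] n \<rho>'(2))
  next
    case (3 l e z)
    then show ?case
      using gen_rel_zero[OF G 3(1,2) R[OF 3(3)]] by (simp add: T_def[symmetric] TR)
  next
    case (4 y a)
    have rel: "\<forall>\<^sub>F z in nhds (R y). (\<Sum>i\<in>I. a i (T z) * s e i (shear n w u z)) = 0" if "e \<in> E" for e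
      using eventually_nhds_comp[OF isCont_shear[where n = n and w = w and u = u and z = "R y", folded T_def],
        of "\<lambda>z. (\<Sum>i\<in>I. a i z * s e i z) = 0"] 4(2) that by (simp add: TR T_def[symmetric])
    have hol: "hol_near (R y) (\<lambda>z. a i (T z))" if "i \<in> I" for i
      unfolding T_def by (rule hol_near_shear) (use 4(2) that in \<open>simp add: T_def[symmetric] TR\<close>)
    obtain c where c: "\<And>l. l \<in> {..<N} \<Longrightarrow> hol_near (R y) (c l)"
      "\<And>i. i \<in> I \<Longrightarrow> \<forall>\<^sub>F z in nhds (R y). a i (T z) = (\<Sum>l<N. c l z * G l i z)"
      by (rule gen_relD[OF G R[OF 4(1)], of "\<lambda>i z. a i (T z)"]) (use hol rel in blast)+
    have "\<forall>\<^sub>F z in nhds y. a i z = (\<Sum>l<N. c l (R z) * G l i (R z))" if "i \<in> I" for i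
      using eventually_nhds_comp[OF isCont_shear[where n = n and w = w and u = "- u" and z = y, folded R_def] c(2)[OF that]]
      by (simp add: TR)
    moreover have "hol_near y (\<lambda>z. c l (R z))" if "l < N" for l
      unfolding R_def by (rule hol_near_shear) (use c(1) that in \<open>simp add: R_def[symmetric]\<close>)
    ultimately show ?case by (intro exI[of _ "\<lambda>l z. c l (R z)"]) auto
  qed simp
  then show ?thesis by (rule fin_relI[OF \<rho>'(1)])
qed

subsection \<open>Weierstrass division\<close>

text \<open>The coefficient of \<open>v ^ k\<close> in the divided difference
  \<open>(p(x) - p(v)) / (x - v)\<close>. Each \<open>x ^ l - v ^ l\<close> contributes the terms
  \<open>x ^ (l - 1 - k) * v ^ k\<close> with \<open>k < l\<close>, whence the lower bound
  \<open>Suc k\<close>.\<close>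

definition dpoly :: "nat \<Rightarrow> (nat \<Rightarrow> 'a) \<Rightarrow> 'a \<Rightarrow> nat \<Rightarrow> 'a::comm_ring_1" where
  "dpoly b p x k = (\<Sum>l\<in>{Suc k..b}. p l * x ^ (l - Suc k))"

lemma dpoly:
  fixes p :: "nat \<Rightarrow> 'a::comm_ring_1"
  shows "(\<Sum>l\<le>b. p l * x ^ l) - (\<Sum>l\<le>b. p l * v ^ l) = (x - v) * (\<Sum>k<b. dpoly b p x k * v ^ k)"
proof -
  have "(\<Sum>k<b. dpoly b p x k * v ^ k) = (\<Sum>k<b. \<Sum>l\<in>{Suc k..b}. p l * (x ^ (l - Suc k) * v ^ k))"
    by (simp add: dpoly_def sum_distrib_right mult.assoc)
  also have "\<dots> = (\<Sum>l\<le>b. \<Sum>k<l. p l * (x ^ (l - Suc k) * v ^ k))"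
    unfolding sum.Sigma[OF finite_lessThan ballI[OF finite_atLeastAtMost]]
      sum.Sigma[OF finite_atMost ballI[OF finite_lessThan]]
    by (rule sum.reindex_bij_witness[of _ "\<lambda>(l, k). (k, l)" "\<lambda>(k, l). (l, k)"]) auto
  also have "(x - v) * \<dots> = (\<Sum>l\<le>b. p l * ((x - v) * (\<Sum>k<l. v ^ k * x ^ (l - Suc k))))"
    by (simp add: sum_distrib_left mult_ac)
  also have "\<dots> = (\<Sum>l\<le>b. p l * (x ^ l - v ^ l))"
  proof (rule sum.cong)
    fix l
    have "- (v ^ l - x ^ l) = (- (v - x)) * (\<Sum>k<l. x ^ (l - Suc k) * v ^ k)"
      unfolding power_diff_sumr2[of v l x] by (simp only: minus_mult_left)
    then show "p l * ((x - v) * (\<Sum>k<l. v ^ k * x ^ (l - Suc k))) = p l * (x ^ l - v ^ l)"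
      by (simp add: mult.commute)
  qed simp
  finally show ?thesis
    by (simp add: right_diff_distrib sum_subtractf)
qed

text \<open>The circle is centred at \<open>y\<^sub>n\<close> and need not enclose all zeros of \<open>W\<close>. The remainder is nevertheless
  a polynomial, so the division makes sense at every point \<open>y\<close> and not only at the point at which
  \<open>W\<close> was prepared. The sums in \<open>W\<close> are polynomials in \<open>x - c\<close>, where \<open>c\<close> is fixed independently of
  \<open>y\<close>: the same coefficients serve for all \<open>y\<close>.\<close>

locale division_at =
  fixes n :: "'m::finite" and c :: complex and y :: "complex ^ 'm" and r \<epsilon> \<rho> :: real and b :: nat
    and A :: "nat \<Rightarrow> complex ^ 'm \<Rightarrow> complex"
  assumes r: "0 < r" "r < \<rho>" and eps: "0 < \<epsilon>" "\<epsilon> \<le> r"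
    and A: "\<And>l. l \<le> b \<Longrightarrow> dep_on (UNIV - {n}) (pd y \<rho>) (A l)"
    and nz: "\<And>z x. \<lbrakk>z \<in> pd y \<epsilon>; x \<in> sphere (y $ n) r\<rbrakk> \<Longrightarrow> (\<Sum>l\<le>b. A l z * (x - c) ^ l) \<noteq> 0"
begin

definition W :: "complex ^ 'm \<Rightarrow> complex \<Rightarrow> complex" where
  "W z x = (\<Sum>l\<le>b. A l z * (x - c) ^ l)"

text \<open>The Cauchy integral of \<open>a / W\<close> along coordinate \<open>n\<close>;
  \<open>W\<close> may have zeros inside the circle, so this is in general not \<open>a / W\<close>
  itself.\<close>

definition quo :: "(complex ^ 'm \<Rightarrow> complex) \<Rightarrow> complex ^ 'm \<Rightarrow> complex" where
  "quo a z = cint (y $ n) r (\<lambda>x. a (upd n z x) / W z x / (x - z $ n))"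

text \<open>The coefficient of \<open>(z $ n - c) ^ k\<close> after the Cauchy kernel in
  \<open>quo\<close> has been multiplied by the difference \<open>p(x) - p(z $ n)\<close>, which
  cancels the pole. The choice \<open>p = A\<close> gives the remainder on division by
  \<open>W\<close>; other \<open>p\<close> serve for the last entry of a relation.\<close>

definition rem :: "(complex ^ 'm \<Rightarrow> complex) \<Rightarrow> (nat \<Rightarrow> complex ^ 'm \<Rightarrow> complex) \<Rightarrow> nat \<Rightarrow> complex ^ 'm \<Rightarrow> complex" where
  "rem a p k z = cint (y $ n) r (\<lambda>x. a (upd n z x) / W z x * dpoly b (\<lambda>l. p l z) (x - c) k)"

lemma sub: "pd y \<epsilon> \<subseteq> pd y \<rho>"
  by (rule pd_mono) (use r eps in auto)

lemma upd_in: "\<lbrakk>z \<in> pd y \<epsilon>; x \<in> cball (y $ n) r\<rbrakk> \<Longrightarrow> upd n z x \<in> pd y \<rho>"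
  by (rule upd_in_pd) (use r sub in auto)

lemma cont_slice:
  assumes "a hol_on pd y \<rho>" "z \<in> pd y \<epsilon>"
  shows "continuous_on (sphere (y $ n) r) (\<lambda>x. a (upd n z x))"
    "continuous_on (cball (y $ n) r) (\<lambda>x. a (upd n z x))"
    "(\<lambda>x. a (upd n z x)) holomorphic_on ball (y $ n) r"
proof -
  have "(\<lambda>x. a (upd n z x)) holomorphic_on cball (y $ n) r"
    by (rule hol_on_slice[OF assms(1) upd_in[OF assms(2)]])
  then show "continuous_on (cball (y $ n) r) (\<lambda>x. a (upd n z x))"
    "(\<lambda>x. a (upd n z x)) holomorphic_on ball (y $ n) r"
    by (auto intro: holomorphic_on_imp_continuous_on holomorphic_on_subset[OF _ ball_subset_cball])
  then show "continuous_on (sphere (y $ n) r) (\<lambda>x. a (upd n z x))"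
    by (auto intro: continuous_on_subset[OF _ sphere_cball])
qed

lemma z_in_ball: "z \<in> pd y \<epsilon> \<Longrightarrow> z $ n \<in> ball (y $ n) r"
  using eps by (auto simp: pd_def intro: less_le_trans)

lemma ne: "\<lbrakk>z \<in> pd y \<epsilon>; x \<in> sphere (y $ n) r\<rbrakk> \<Longrightarrow> x - z $ n \<noteq> 0"
  using z_in_ball[of z] by auto

lemma W_ne: "\<lbrakk>z \<in> pd y \<epsilon>; x \<in> sphere (y $ n) r\<rbrakk> \<Longrightarrow> W z x \<noteq> 0"
  using nz by (simp add: W_def)

lemma cont_W: "continuous_on X (W z)"
  unfolding W_def by (intro continuous_intros)

text \<open>The identity \<open>dpoly\<close>, divided by \<open>x - z $ n\<close> and integrated
  against \<open>a / W\<close>. The value of \<open>p\<close> at \<open>z $ n\<close> is constant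
  along the circle and splits off as a multiple of \<open>quo a z\<close>.\<close>

lemma rem_sum:
  assumes a: "a hol_on pd y \<rho>" and z: "z \<in> pd y \<epsilon>"
  shows "(\<Sum>k<b. rem a p k z * (z $ n - c) ^ k) =
    cint (y $ n) r (\<lambda>x. a (upd n z x) * (\<Sum>l\<le>b. p l z * (x - c) ^ l) / W z x / (x - z $ n))
      - (\<Sum>l\<le>b. p l z * (z $ n - c) ^ l) * quo a z"
proof -
  let ?S = "sphere (y $ n) r"
  have W0: "\<forall>x\<in>?S. W z x \<noteq> 0"
    using W_ne[OF z] by blast
  have n0: "\<forall>x\<in>?S. x - z $ n \<noteq> 0"
    using ne[OF z] by blast
  have cd: "continuous_on ?S (\<lambda>x. dpoly b (\<lambda>l. p l z) (x - c) k)" for k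
    unfolding dpoly_def by (intro continuous_intros)
  note ci = continuous_intros cont_slice(1)[OF a z] cont_W W0 n0 cd
  have "(\<Sum>k<b. rem a p k z * (z $ n - c) ^ k) =
      (\<Sum>k<b. cint (y $ n) r (\<lambda>x. (z $ n - c) ^ k * (a (upd n z x) / W z x * dpoly b (\<lambda>l. p l z) (x - c) k)))"
    unfolding rem_def
    by (intro sum.cong refl, subst cint_cmult) (use r in \<open>auto intro!: ci simp: W0 mult.commute\<close>)
  also have "\<dots> = cint (y $ n) r (\<lambda>x. \<Sum>k<b. (z $ n - c) ^ k * (a (upd n z x) / W z x * dpoly b (\<lambda>l. p l z) (x - c) k))"
    by (rule cint_sum[symmetric]) (use r in \<open>auto intro!: ci simp: W0\<close>)
  also have "\<dots> = cint (y $ n) r (\<lambda>x. a (upd n z x) * (\<Sum>l\<le>b. p l z * (x - c) ^ l) / W z x / (x - z $ n)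
      - (\<Sum>l\<le>b. p l z * (z $ n - c) ^ l) * (a (upd n z x) / W z x / (x - z $ n)))"
  proof (rule cint_cong)
    fix x assume x: "x \<in> ?S"
    have "(\<Sum>k<b. (z $ n - c) ^ k * (a (upd n z x) / W z x * dpoly b (\<lambda>l. p l z) (x - c) k))
        = a (upd n z x) / W z x * (\<Sum>k<b. dpoly b (\<lambda>l. p l z) (x - c) k * (z $ n - c) ^ k)"
      by (simp add: sum_distrib_left mult_ac)
    also have "\<dots> = a (upd n z x) / W z x *
        (((\<Sum>l\<le>b. p l z * (x - c) ^ l) - (\<Sum>l\<le>b. p l z * (z $ n - c) ^ l)) / (x - z $ n))"
      using dpoly[of "\<lambda>l. p l z" "x - c" b "z $ n - c"] n0 x by simp
    finally show "(\<Sum>k<b. (z $ n - c) ^ k * (a (upd n z x) / W z x * dpoly b (\<lambda>l. p l z) (x - c) k)) =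
        a (upd n z x) * (\<Sum>l\<le>b. p l z * (x - c) ^ l) / W z x / (x - z $ n)
        - (\<Sum>l\<le>b. p l z * (z $ n - c) ^ l) * (a (upd n z x) / W z x / (x - z $ n))"
      by (simp add: diff_divide_distrib right_diff_distrib mult_ac)
  qed (use r in simp)
  also have "\<dots> = cint (y $ n) r (\<lambda>x. a (upd n z x) * (\<Sum>l\<le>b. p l z * (x - c) ^ l) / W z x / (x - z $ n))
      - (\<Sum>l\<le>b. p l z * (z $ n - c) ^ l) * quo a z"
  proof -
    have c1: "continuous_on ?S (\<lambda>x. a (upd n z x) * (\<Sum>l\<le>b. p l z * (x - c) ^ l) / W z x / (x - z $ n))"
      by (intro ci)
    have c2: "continuous_on ?S (\<lambda>x. a (upd n z x) / W z x / (x - z $ n))"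
      by (intro ci)
    have c3: "continuous_on ?S (\<lambda>x. (\<Sum>l\<le>b. p l z * (z $ n - c) ^ l) * (a (upd n z x) / W z x / (x - z $ n)))"
      by (intro ci)
    show ?thesis
      unfolding quo_def cint_diff[OF c1 c3 less_imp_le[OF r(1)]] cint_cmult[OF c2 less_imp_le[OF r(1)]] ..
  qed
  finally show ?thesis .
qed

lemma cint_slice:
  assumes "a hol_on pd y \<rho>" "z \<in> pd y \<epsilon>"
  shows "cint (y $ n) r (\<lambda>x. a (upd n z x) / (x - z $ n)) = a z"
  using cint_Cauchy[OF cont_slice(2,3)[OF assms] z_in_ball[OF assms(2)]] by simp

text \<open>For \<open>p = A\<close> the polynomial in the integral of \<open>rem_sum\<close> is
  \<open>W\<close> itself and cancels, leaving Cauchy's formula for \<open>a\<close>.\<close>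

lemma division:
  assumes a: "a hol_on pd y \<rho>" and z: "z \<in> pd y \<epsilon>"
  shows "a z = (\<Sum>k<b. rem a A k z * (z $ n - c) ^ k) + quo a z * (\<Sum>l\<le>b. A l z * (z $ n - c) ^ l)"
proof -
  have "cint (y $ n) r (\<lambda>x. a (upd n z x) * (\<Sum>l\<le>b. A l z * (x - c) ^ l) / W z x / (x - z $ n)) =
      cint (y $ n) r (\<lambda>x. a (upd n z x) / (x - z $ n))"
    by (rule cint_cong) (use W_ne[OF z] r in \<open>auto simp: W_def\<close>)
  then show ?thesis
    using rem_sum[OF a z, of A] cint_slice[OF a z] by simp
qed

text \<open>The last component \<open>a'\<close> of a relation is reduced by the coefficients of the other ones, not divided by
  \<open>W\<close> itself: this makes the remainders satisfy the relation identically.\<close>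

lemma division_relation:
  assumes J: "finite J" and a: "\<And>j. j \<in> J \<Longrightarrow> a j hol_on pd y \<rho>" "a' hol_on pd y \<rho>"
    and p: "\<And>j l. j \<in> J \<Longrightarrow> l \<le> b \<Longrightarrow> dep_on (UNIV - {n}) (pd y \<rho>) (p j l)"
    and rel: "\<And>z. z \<in> pd y \<rho> \<Longrightarrow>
      (\<Sum>j\<in>J. a j z * (\<Sum>l\<le>b. p j l z * (z $ n - c) ^ l)) + a' z * (\<Sum>l\<le>b. A l z * (z $ n - c) ^ l) = 0"
    and z: "z \<in> pd y \<epsilon>"
  shows "a' z = (\<Sum>k<b. (- (\<Sum>j\<in>J. rem (a j) (p j) k z)) * (z $ n - c) ^ k)
    - (\<Sum>j\<in>J. quo (a j) z * (\<Sum>l\<le>b. p j l z * (z $ n - c) ^ l))"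
proof -
  let ?S = "sphere (y $ n) r"
  have W0: "\<forall>x\<in>?S. W z x \<noteq> 0"
    using W_ne[OF z] by blast
  have n0: "\<forall>x\<in>?S. x - z $ n \<noteq> 0"
    using ne[OF z] by blast
  \<comment> \<open>The relation will be used at the points \<open>upd n z x\<close> of the circle,
    where the coefficients still have their values at \<open>z\<close>.\<close>
  have indep: "f (upd n z x) = f z" if "dep_on (UNIV - {n}) (pd y \<rho>) f" "x \<in> ?S" for f x
    using that z sub by (intro dep_onD[OF that(1)] upd_in) auto
  have "(\<Sum>k<b. (\<Sum>j\<in>J. rem (a j) (p j) k z) * (z $ n - c) ^ k) =
      (\<Sum>j\<in>J. \<Sum>k<b. rem (a j) (p j) k z * (z $ n - c) ^ k)"
    by (simp add: sum_distrib_right) (rule sum.swap)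
  also have "\<dots> = (\<Sum>j\<in>J. cint (y $ n) r (\<lambda>x. a j (upd n z x) * (\<Sum>l\<le>b. p j l z * (x - c) ^ l) / W z x / (x - z $ n)))
      - (\<Sum>j\<in>J. quo (a j) z * (\<Sum>l\<le>b. p j l z * (z $ n - c) ^ l))"
    by (simp only: rem_sum[OF a(1) z] sum_subtractf mult.commute[of "quo _ _"] cong: sum.cong)
  also have "(\<Sum>j\<in>J. cint (y $ n) r (\<lambda>x. a j (upd n z x) * (\<Sum>l\<le>b. p j l z * (x - c) ^ l) / W z x / (x - z $ n)))
      = cint (y $ n) r (\<lambda>x. \<Sum>j\<in>J. a j (upd n z x) * (\<Sum>l\<le>b. p j l z * (x - c) ^ l) / W z x / (x - z $ n))"
    by (rule cint_sum[symmetric]) (use J r W0 n0 in \<open>auto intro!: continuous_intros cont_slice(1)[OF a(1) z] cont_W\<close>)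
  \<comment> \<open>On the circle the relation can be divided by \<open>W\<close>, which replaces
    the sum of all \<open>a j * p j / W\<close> by \<open>- a'\<close>; Cauchy's formula then
    returns \<open>- a' z\<close>.\<close>
  also have "\<dots> = cint (y $ n) r (\<lambda>x. (-1) * (a' (upd n z x) / (x - z $ n)))"
  proof (rule cint_cong)
    fix x assume x: "x \<in> ?S"
    have "(\<Sum>j\<in>J. a j (upd n z x) * (\<Sum>l\<le>b. p j l z * (x - c) ^ l)) + a' (upd n z x) * W z x = 0"
      using rel[of "upd n z x"] upd_in[OF z, of x] x by (simp add: W_def indep[OF A x] indep[OF p x])
    then have "(\<Sum>j\<in>J. a j (upd n z x) * (\<Sum>l\<le>b. p j l z * (x - c) ^ l)) / W z x = - a' (upd n z x)"
      using W0 x by (simp add: field_simps eq_neg_iff_add_eq_0)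
    then show "(\<Sum>j\<in>J. a j (upd n z x) * (\<Sum>l\<le>b. p j l z * (x - c) ^ l) / W z x / (x - z $ n)) =
        (-1) * (a' (upd n z x) / (x - z $ n))"
      by (simp only: sum_divide_distrib[symmetric]) simp
  qed (use r in simp)
  also have "\<dots> = (-1) * a' z"
    by (subst cint_cmult) (use r n0 in \<open>auto intro!: continuous_intros cont_slice(1)[OF a(2) z] simp: cint_slice[OF a(2) z]\<close>)
  finally have "(\<Sum>k<b. (\<Sum>j\<in>J. rem (a j) (p j) k z) * (z $ n - c) ^ k) =
      (-1) * a' z - (\<Sum>j\<in>J. quo (a j) z * (\<Sum>l\<le>b. p j l z * (z $ n - c) ^ l))" .
  then show ?thesis
    by (simp only: mult_minus_left sum_negf) simp
qed

lemma cont_pair: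
  assumes "a hol_on pd y \<rho>"
  shows "continuous_on (pd y \<epsilon> \<times> sphere (y $ n) r) (\<lambda>q. a (upd n (fst q) (snd q)))"
  by (rule continuous_on_compose2[OF hol_on_imp_continuous_on[OF assms], of _ "\<lambda>q. upd n (fst q) (snd q)"])
    (auto intro!: continuous_intros upd_in)

lemma cont_fst: "f hol_on pd y \<rho> \<Longrightarrow> continuous_on (pd y \<epsilon> \<times> X) (\<lambda>q. f (fst q))"
  by (rule continuous_on_compose2[OF hol_on_imp_continuous_on, of f "pd y \<rho>" _ fst])
    (use sub in \<open>auto intro!: continuous_intros\<close>)

lemma dep_on_quo:
  assumes a: "dep_on S (pd y \<rho>) a" and n: "n \<in> S" and AS: "\<And>l. l \<le> b \<Longrightarrow> dep_on (S - {n}) (pd y \<rho>) (A l)"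
  shows "dep_on S (pd y \<epsilon>) (quo a)"
  unfolding quo_def
proof (rule dep_on_cint[OF open_pd _ less_imp_le[OF r(1)]])
  show "continuous_on (pd y \<epsilon> \<times> sphere (y $ n) r) (\<lambda>q. a (upd n (fst q) (snd q)) / W (fst q) (snd q) / (snd q - fst q $ n))"
    unfolding W_def using ne nz
    by (intro continuous_intros cont_pair dep_on_hol[OF a] cont_fst dep_on_hol[OF A]) auto
  note AS' = dep_on_mono[OF dep_on_subset[OF AS sub] Diff_subset]
  show "dep_on S (pd y \<epsilon>) (\<lambda>z. a (upd n z x) / W z x / (x - z $ n))" if "x \<in> sphere (y $ n) r" for x
    unfolding W_def using nz ne that n
    by (intro dep_on_divide dep_on_intros dep_on_mono[OF dep_on_slice[OF a] Diff_subset] AS') (auto intro: upd_in)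
qed

text \<open>Unlike in \<open>quo\<close>, the kernel \<open>x - z $ n\<close> is gone, and the
  remaining occurrence of \<open>z\<close> under \<open>a\<close> has its coordinate
  \<open>n\<close> overwritten. Remainders therefore live in one variable fewer, which drives both
  inductions.\<close>

lemma dep_on_rem:
  assumes a: "dep_on S (pd y \<rho>) a" and AS: "\<And>l. l \<le> b \<Longrightarrow> dep_on (S - {n}) (pd y \<rho>) (A l)"
    and p: "\<And>l. l \<le> b \<Longrightarrow> dep_on (S - {n}) (pd y \<rho>) (p l)"
  shows "dep_on (S - {n}) (pd y \<epsilon>) (rem a p k)"
  unfolding rem_def
proof (rule dep_on_cint[OF open_pd _ less_imp_le[OF r(1)]])
  show "continuous_on (pd y \<epsilon> \<times> sphere (y $ n) r)
      (\<lambda>q. a (upd n (fst q) (snd q)) / W (fst q) (snd q) * dpoly b (\<lambda>l. p l (fst q)) (snd q - c) k)"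
    unfolding W_def dpoly_def using nz
    by (intro continuous_intros cont_pair dep_on_hol[OF a] cont_fst dep_on_hol[OF A] dep_on_hol[OF p]) auto
  show "dep_on (S - {n}) (pd y \<epsilon>) (\<lambda>z. a (upd n z x) / W z x * dpoly b (\<lambda>l. p l z) (x - c) k)"
    if "x \<in> sphere (y $ n) r" for x
    unfolding W_def dpoly_def using nz that
    by (intro dep_on_divide dep_on_intros dep_on_slice[OF a] dep_on_subset[OF AS sub] dep_on_subset[OF p sub])
      (auto intro: upd_in)
qed

end

subsection \<open>Weierstrass preparation\<close>

lemma dep_on_uniform_limit:
  fixes f :: "nat \<Rightarrow> complex ^ 'm \<Rightarrow> complex"
  assumes D: "open D" and f: "\<And>k. dep_on S D (f k)" and lim: "uniform_limit D f g sequentially"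
  shows "dep_on S D g"
  unfolding dep_on_def
proof (intro conjI ballI impI)
  show "g hol_on D"
    by (rule hol_on_uniform_limit[OF D dep_on_hol[OF f] lim])
  fix z z' assume *: "z \<in> D" "z' \<in> D" "\<forall>j\<in>S. z $ j = z' $ j"
  have "f k z = f k z'" for k
    by (rule dep_onD[OF f]) (use * in auto)
  then have "(\<lambda>k. f k z) \<longlonglongrightarrow> g z'"
    using tendsto_uniform_limitI[OF lim *(2)] by simp
  then show "g z = g z'"
    using tendsto_uniform_limitI[OF lim *(1)] LIMSEQ_unique by blast
qed

lemma dep_on_suminf:
  fixes f :: "nat \<Rightarrow> complex ^ 'm \<Rightarrow> complex"
  assumes D: "open D" and f: "\<And>k. dep_on S D (f k)"
    and M: "\<And>k z. z \<in> D \<Longrightarrow> norm (f k z) \<le> M k" "summable M"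
  shows "dep_on S D (\<lambda>z. suminf (\<lambda>k. f k z))"
  by (rule dep_on_uniform_limit[OF D dep_on_sum Weierstrass_m_test[OF M]]) (auto intro: f)

text \<open>The sequence \<open>q\<close> is the sequence of power series coefficients of the function by which
  \<open>\<zeta>\<^sup>b + \<Sum>\<^sub>i e\<^sub>i \<zeta>\<^sup>i\<close> must be multiplied to become a polynomial: the product is to have no terms of
  degree exceeding \<open>b\<close>. It is the fixed point of a contraction for the norm \<open>sup\<^sub>i \<bar>q\<^sub>i\<bar> r\<^sup>i\<close>.\<close>

lemma preparation_series:
  fixes e :: "nat \<Rightarrow> complex ^ 'm \<Rightarrow> complex"
  assumes D: "open D" and e: "\<And>i. dep_on S D (e i)"
    and r: "0 < r" and small: "\<And>z n. z \<in> D \<Longrightarrow> (\<Sum>i<n. norm (e i z) * r ^ i) \<le> r ^ b / 2"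
  obtains q :: "nat \<Rightarrow> complex ^ 'm \<Rightarrow> complex" where "\<And>i. dep_on S D (q i)"
    "\<And>i z. z \<in> D \<Longrightarrow> norm (q i z) * r ^ i \<le> 2"
    "\<And>i z. z \<in> D \<Longrightarrow> q i z + (\<Sum>j\<le>i+b. e j z * q (i + b - j) z) = (if i = 0 then 1 else 0)"
proof -
  \<comment> \<open>Picard iterates, started at zero, of the required identity solved for
    \<open>q i z\<close>.\<close>
  define Q where "Q = rec_nat (\<lambda>i z. 0) (\<lambda>_ q i z. (if i = 0 then 1 else 0) - (\<Sum>j\<le>i+b. e j z * q (i + b - j) z))"
  have Q0: "Q 0 i z = 0" and QS: "Q (Suc k) i z = (if i = 0 then 1 else 0) - (\<Sum>j\<le>i+b. e j z * Q k (i + b - j) z)" for k i z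
    by (simp_all add: Q_def)
  have dQ: "dep_on S D (Q k i)" for k i
  proof (induction k arbitrary: i)
    case 0
    then show ?case unfolding Q0[abs_def] by (rule dep_on_const)
  next
    case (Suc k)
    then show ?case unfolding QS[abs_def] by (intro dep_on_intros e) auto
  qed
  define d where "d k i z = Q (Suc k) i z - Q k i z" for k i z
  have d: "norm (d k i z) * r ^ i \<le> (1/2) ^ k" if z: "z \<in> D" for k i z
  proof (induction k arbitrary: i)
    case 0
    then show ?case by (simp add: d_def QS Q0)
  next
    case (Suc k)
    have "d (Suc k) i z = - (\<Sum>j\<le>i+b. e j z * d k (i + b - j) z)"
      unfolding d_def QS[of "Suc k" i z] QS[of k i z] by (simp add: right_diff_distrib sum_subtractf)
    then have "norm (d (Suc k) i z) * r ^ i \<le> (\<Sum>j\<le>i+b. norm (e j z) * norm (d k (i + b - j) z)) * r ^ i"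
      using r by (intro mult_right_mono) (auto simp: norm_mult intro!: sum_norm_le)
    \<comment> \<open>The weights \<open>r ^ j\<close> and \<open>r ^ (i + b - j)\<close> multiply
      to \<open>r ^ i * r ^ b\<close>. The index shift by \<open>b\<close> thus costs a division by
      \<open>r ^ b\<close>, and \<open>small\<close> makes up for it with a factor 1/2 to
      spare.\<close>
    also have "\<dots> = (\<Sum>j\<le>i+b. norm (e j z) * r ^ j * (norm (d k (i + b - j) z) * r ^ (i + b - j))) / r ^ b"
    proof -
      have "r ^ j * r ^ (i + b - j) = r ^ i * r ^ b" if "j \<le> i + b" for j
        using that by (simp add: power_add[symmetric])
      then have "(\<Sum>j\<le>i+b. norm (e j z) * r ^ j * (norm (d k (i + b - j) z) * r ^ (i + b - j))) =
          (\<Sum>j\<le>i+b. norm (e j z) * norm (d k (i + b - j) z) * (r ^ i * r ^ b))"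
        by (intro sum.cong refl) (simp add: mult_ac)
      then show ?thesis
        using r by (simp add: sum_distrib_right[symmetric])
    qed
    also have "\<dots> \<le> (\<Sum>j\<le>i+b. norm (e j z) * r ^ j * (1/2) ^ k) / r ^ b"
      using r Suc by (intro divide_right_mono sum_mono mult_left_mono) auto
    also have "\<dots> = (\<Sum>j<Suc (i+b). norm (e j z) * r ^ j) * (1/2) ^ k / r ^ b"
      by (simp add: sum_distrib_right lessThan_Suc_atMost)
    also have "\<dots> \<le> (r ^ b / 2) * (1/2) ^ k / r ^ b"
      using r by (intro divide_right_mono mult_right_mono small z) auto
    finally show ?case
      using r by simp
  qed
  have sumd: "(\<Sum>k<n. d k i z) = Q n i z" for n i z
    by (induction n) (simp_all add: d_def Q0)
  define q where "q i z = suminf (\<lambda>k. d k i z)" for i z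
  have dM: "norm (d k i z) \<le> (1/2) ^ k / r ^ i" if "z \<in> D" for k i z
    using d[OF that, of k i] r by (simp add: field_simps)
  have sM: "summable (\<lambda>k. (1/2) ^ k / r ^ i)" for i
    by (intro summable_divide summable_geometric) simp
  have lim: "(\<lambda>n. Q n i z) \<longlonglongrightarrow> q i z" if "z \<in> D" for i z
  proof -
    have "summable (\<lambda>k. d k i z)"
      by (rule summable_comparison_test'[OF sM dM[OF that]])
    then show ?thesis
      unfolding q_def sumd[symmetric] by (rule summable_LIMSEQ)
  qed
  show ?thesis
  proof (rule that)
    show "dep_on S D (q i)" for i
      unfolding q_def[abs_def]
      by (rule dep_on_suminf[OF D _ dM sM]) (auto simp: d_def[abs_def] intro!: dep_on_intros dQ)
    show "norm (q i z) * r ^ i \<le> 2" if z: "z \<in> D" for i z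
    proof (rule LIMSEQ_le_const2)
      show "(\<lambda>n. norm (Q n i z) * r ^ i) \<longlonglongrightarrow> norm (q i z) * r ^ i"
        by (intro tendsto_intros lim z)
      have "norm (Q n i z) * r ^ i \<le> 2" for n
      proof -
        have "norm (Q n i z) * r ^ i \<le> (\<Sum>k<n. norm (d k i z)) * r ^ i"
          unfolding sumd[symmetric] using r by (intro mult_right_mono norm_sum) auto
        also have "\<dots> \<le> (\<Sum>k<n. (1/2) ^ k)"
          unfolding sum_distrib_right by (intro sum_mono d z)
        also have "\<dots> \<le> 2"
          by (simp add: sum_gp_strict)
        finally show ?thesis .
      qed
      then show "\<exists>N. \<forall>n\<ge>N. norm (Q n i z) * r ^ i \<le> 2" by blast
    qed
    show "q i z + (\<Sum>j\<le>i+b. e j z * q (i + b - j) z) = (if i = 0 then 1 else 0)" if z: "z \<in> D" for i z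
    proof -
      have l1: "(\<lambda>n. Q (Suc n) i z) \<longlonglongrightarrow> q i z"
        by (rule LIMSEQ_Suc[OF lim[OF z]])
      have l2: "(\<lambda>n. Q (Suc n) i z) \<longlonglongrightarrow> (if i = 0 then 1 else 0) - (\<Sum>j\<le>i+b. e j z * q (i + b - j) z)"
        unfolding QS by (intro tendsto_intros lim z)
      show ?thesis
        unfolding LIMSEQ_unique[OF l1 l2] by (rule diff_add_cancel)
    qed
  qed
qed

lemma norm_cint_le:
  assumes "continuous_on (sphere c r) f" "\<And>x. x \<in> sphere c r \<Longrightarrow> norm (f x) \<le> B" "0 \<le> B" "0 < r"
  shows "norm (cint c r f) \<le> B * r"
proof -
  have "norm (contour_integral (circlepath c r) f) \<le> B * (2 * pi * r)"
  proof (rule has_contour_integral_bound_circlepath)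
    show "(f has_contour_integral contour_integral (circlepath c r) f) (circlepath c r)"
      using contour_integrable_sphere[OF assms(1)] assms(4) by (simp add: has_contour_integral_integral)
    show "norm (f x) \<le> B" if "norm (x - c) = r" for x
      using that assms(2) by (simp add: dist_norm norm_minus_commute)
  qed (use assms in auto)
  then show ?thesis
    by (simp add: cint_def norm_divide norm_mult field_simps)
qed

text \<open>Taylor coefficients are written as integrals over one fixed circle so that, with a
  parameter in \<open>f\<close>, \<open>dep_on_cint\<close> shows them to be holomorphic in
  it.\<close>

lemma cint_power_series:
  assumes f: "f holomorphic_on ball c R" and r: "0 < r" "r < R" and x: "x \<in> ball c r"
  shows "(\<lambda>i. cint c r (\<lambda>u. f u / (u - c) ^ Suc i) * (x - c) ^ i) sums f x"
proof -
  have h: "f holomorphic_on cball c r"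
    by (rule holomorphic_on_subset[OF f]) (use r in auto)
  have "cint c r (\<lambda>u. f u / (u - c) ^ Suc i) = (deriv ^^ i) f c / fact i" for i
    unfolding cint_def
    by (subst contour_integral_unique[OF Cauchy_has_contour_integral_higher_derivative_circlepath])
      (use h r in \<open>auto intro: holomorphic_on_imp_continuous_on holomorphic_on_subset[OF _ ball_subset_cball]\<close>)
  then show ?thesis
    using holomorphic_power_series[OF holomorphic_on_subset[OF h ball_subset_cball] x] by simp
qed

text \<open>An open condition along a compact piece of the slice through \<open>y\<close> persists
  on all nearby slices, by the tube lemma.\<close>

lemma upd_tube:
  assumes "open V" "compact K" "\<And>x. x \<in> K \<Longrightarrow> upd n y x \<in> V"
  obtains \<epsilon> where "0 < \<epsilon>" "\<And>z x. \<lbrakk>z \<in> pd y \<epsilon>; x \<in> K\<rbrakk> \<Longrightarrow> upd n z x \<in> V"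
proof -
  define X where "X = (\<lambda>q. upd n (fst q) (snd q)) -` V"
  have "open X"
    unfolding X_def by (intro open_vimage assms(1) continuous_intros)
  moreover have "{y} \<times> K \<subseteq> X"
    using assms(3) by (auto simp: X_def)
  ultimately obtain Y where Y: "y \<in> Y" "open Y" "Y \<times> K \<subseteq> X"
    using Elementary_Topology.tube_lemma[OF assms(2), of X y] by blast
  obtain \<epsilon> where \<epsilon>: "0 < \<epsilon>" "pd y \<epsilon> \<subseteq> Y"
    using pd_subset_open[OF Y(2,1)] .
  show ?thesis
  proof (rule that[OF \<epsilon>(1)])
    fix z x assume "z \<in> pd y \<epsilon>" "x \<in> K"
    then have "(z, x) \<in> X" using Y(3) \<epsilon>(2) by blast
    then show "upd n z x \<in> V" by (simp add: X_def)
  qed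
qed

text \<open>On the slice through \<open>w\<close> the function is
  \<open>(x - w $ n) ^ b * g x\<close> with \<open>g\<close> free of zeros. Multiplied by
  \<open>u = 1 / g\<close>, it becomes \<open>t ^ b + e\<close> with
  \<open>t = z $ n - w $ n\<close>, where \<open>e\<close> vanishes on that slice and hence is small
  on nearby ones. Expanding \<open>e\<close> in powers of \<open>t\<close> and multiplying by the
  series from \<open>preparation_series\<close> cancels every term of degree above \<open>b\<close>
  and makes the coefficient of \<open>t ^ b\<close> equal to 1.\<close>

lemma Weierstrass_preparation:
  fixes f :: "complex ^ 'm \<Rightarrow> complex"
  assumes \<rho>: "0 < \<rho>" and f: "dep_on S (pd w \<rho>) f" and n: "n \<in> S" and fw: "f w = 0"
    and x0: "x0 \<in> ball (w $ n) \<rho>" "f (upd n w x0) \<noteq> 0"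
  obtains \<rho>' b A q where "0 < \<rho>'" "\<rho>' \<le> \<rho>" "\<And>k. k < b \<Longrightarrow> dep_on (S - {n}) (pd w \<rho>') (A k)"
    "dep_on S (pd w \<rho>') q"
    "\<And>z. z \<in> pd w \<rho>' \<Longrightarrow> q z * f z = (z $ n - w $ n) ^ b + (\<Sum>k<b. A k z * (z $ n - w $ n) ^ k)"
proof -
  define F where "F x = f (upd n w x)" for x
  have Fw: "F (w $ n) = 0"
    using fw by (simp add: F_def)
  have "F holomorphic_on ball (w $ n) \<rho>"
    unfolding F_def by (rule hol_on_slice[OF dep_on_hol[OF f] upd_in_pd]) (use \<rho> in auto)
  moreover have "\<not> F constant_on ball (w $ n) \<rho>"
    using Fw x0 \<rho> unfolding constant_on_def F_def by (metis centre_in_ball fw upd_same)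
  ultimately obtain g r b where g: "0 < r" "ball (w $ n) r \<subseteq> ball (w $ n) \<rho>" "g holomorphic_on ball (w $ n) r"
    "\<And>x. x \<in> ball (w $ n) r \<Longrightarrow> F x = (x - w $ n) ^ b * g x" "\<And>x. x \<in> ball (w $ n) r \<Longrightarrow> g x \<noteq> 0"
    using Fw \<rho> by (auto elim: holomorphic_factor_zero_nonconstant[where \<xi> = "w $ n" and S = "ball (w $ n) \<rho>" and f = F])
  have r\<rho>: "r \<le> \<rho>"
    using g(1,2) by (simp add: ball_subset_ball_iff)
  define u where "u z = inverse (g (z $ n))" for z :: "complex ^ 'm"
  have zn: "z $ n \<in> ball (w $ n) r" if "z \<in> pd w r" for z
    using that by (simp add: pd_def)
  have u: "dep_on S (pd w r) u"
    unfolding dep_on_def hol_on_iff_cdiff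
  proof (intro conjI ballI impI)
    show "cdiff u z" if "z \<in> pd w r" for z
      unfolding u_def using zn[OF that] g(3,5) open_ball
      by (intro cdiff_inverse cdiff_compose1[OF cdiff_coord] holomorphic_on_imp_differentiable_at[OF g(3)]) auto
    show "u z = u z'" if "\<forall>j\<in>S. z $ j = z' $ j" for z z'
      using that n by (simp add: u_def)
  qed
  define e where "e z = f z * u z - (z $ n - w $ n) ^ b" for z
  have e: "dep_on S (pd w r) e"
    unfolding e_def by (intro dep_on_intros u n dep_on_subset[OF f pd_mono[OF r\<rho>]])
  have ew: "e (upd n w x) = 0" if "x \<in> ball (w $ n) r" for x
    using g(4,5)[OF that] by (simp add: e_def u_def F_def)
  \<comment> \<open>The circle of radius \<open>r1\<close> computes the Taylor coefficients of
    \<open>e\<close>. Cauchy's estimate \<open>\<delta> / r1 ^ i\<close> weighted with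
    \<open>r0 ^ i\<close> is geometric with ratio 1/2.\<close>
  define r1 where "r1 = r / 2"
  define r0 where "r0 = r1 / 2"
  have r1: "0 < r1" "r1 < r" and r0: "0 < r0" "r0 < r1" "r1 = 2 * r0"
    using g(1) by (auto simp: r1_def r0_def)
  \<comment> \<open>The geometric series doubles \<open>\<delta>\<close>, giving the bound
    \<open>r0 ^ b / 2\<close> required by \<open>preparation_series\<close>.\<close>
  define \<delta> where "\<delta> = r0 ^ b / 4"
  have \<delta>: "0 < \<delta>"
    using r0 by (simp add: \<delta>_def)
  have "open (pd w r \<inter> e -` ball 0 \<delta>)"
    by (intro continuous_open_preimage hol_on_imp_continuous_on dep_on_hol[OF e] open_pd open_ball)
  moreover have "upd n w x \<in> pd w r \<inter> e -` ball 0 \<delta>" if "x \<in> sphere (w $ n) r1" for x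
    using that r1 \<delta> ew[of x] upd_in_pd[of w w r n x] g(1) by simp
  ultimately obtain \<epsilon> where \<epsilon>: "0 < \<epsilon>"
    "\<And>z x. \<lbrakk>z \<in> pd w \<epsilon>; x \<in> sphere (w $ n) r1\<rbrakk> \<Longrightarrow> upd n z x \<in> pd w r \<inter> e -` ball 0 \<delta>"
    by (rule upd_tube[OF _ compact_sphere]) blast+
  define \<rho>1 where "\<rho>1 = min \<epsilon> r"
  have \<rho>1: "0 < \<rho>1" "\<rho>1 \<le> r" "pd w \<rho>1 \<subseteq> pd w \<epsilon>" "pd w \<rho>1 \<subseteq> pd w r"
    using \<epsilon>(1) g(1) by (auto simp: \<rho>1_def intro!: pd_mono)
  have up: "upd n z x \<in> pd w r" if "z \<in> pd w \<rho>1" "x \<in> ball (w $ n) r" for z x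
    using that \<rho>1(4) by (intro upd_in_pd) auto
  define E where "E i z = cint (w $ n) r1 (\<lambda>x. e (upd n z x) / (x - w $ n) ^ Suc i)" for i z
  have x0: "x - w $ n \<noteq> 0" if "x \<in> sphere (w $ n) r1" for x
    using that r1(1) by auto
  have dE: "dep_on (S - {n}) (pd w \<rho>1) (E i)" for i
    unfolding E_def
  proof (rule dep_on_cint[OF open_pd _ less_imp_le[OF r1(1)]])
    have "continuous_on (pd w \<rho>1 \<times> sphere (w $ n) r1) (\<lambda>q. e (upd n (fst q) (snd q)))"
      by (rule continuous_on_compose2[OF hol_on_imp_continuous_on[OF dep_on_hol[OF e]], of _ "\<lambda>q. upd n (fst q) (snd q)"])
        (use r1 in \<open>auto intro!: continuous_intros up\<close>)
    then show "continuous_on (pd w \<rho>1 \<times> sphere (w $ n) r1)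
        (\<lambda>q. e (upd n (fst q) (snd q)) / (snd q - w $ n) ^ Suc i)"
      by (intro continuous_intros) (use x0 in auto)
    show "dep_on (S - {n}) (pd w \<rho>1) (\<lambda>z. e (upd n z x) / (x - w $ n) ^ Suc i)" if "x \<in> sphere (w $ n) r1" for x
      by (intro dep_on_divide dep_on_const dep_on_slice[OF e] up) (use that r1 x0 in auto)
  qed
  have ch: "(\<lambda>x. e (upd n z x)) holomorphic_on ball (w $ n) r" if "z \<in> pd w \<rho>1" for z
    by (rule hol_on_slice[OF dep_on_hol[OF e] up[OF that]])
  have Eb: "norm (E i z) \<le> \<delta> / r1 ^ i" if z: "z \<in> pd w \<rho>1" for i z
  proof -
    have "norm (E i z) \<le> (\<delta> / r1 ^ Suc i) * r1"
      unfolding E_def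
    proof (rule norm_cint_le)
      show "continuous_on (sphere (w $ n) r1) (\<lambda>x. e (upd n z x) / (x - w $ n) ^ Suc i)"
        using holomorphic_on_imp_continuous_on[OF ch[OF z]] r1 x0
        by (intro continuous_intros) (auto intro: continuous_on_subset)
      show "norm (e (upd n z x) / (x - w $ n) ^ Suc i) \<le> \<delta> / r1 ^ Suc i" if x: "x \<in> sphere (w $ n) r1" for x
      proof -
        have "norm (x - w $ n) = r1"
          using x by (simp add: dist_norm norm_minus_commute)
        moreover have "norm (e (upd n z x)) \<le> \<delta>"
          using \<epsilon>(2)[of z x] z x \<rho>1(3) by auto
        ultimately show ?thesis
          using r1 by (simp add: norm_divide norm_power divide_right_mono del: power_Suc)
      qed
    qed (use r1 \<delta> in auto)
    then show ?thesis using r1 by simp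
  qed
  have small: "(\<Sum>i<k. norm (E i z) * r0 ^ i) \<le> r0 ^ b / 2" if z: "z \<in> pd w \<rho>1" for z k
  proof -
    have "(\<Sum>i<k. norm (E i z) * r0 ^ i) \<le> (\<Sum>i<k. \<delta> / r1 ^ i * r0 ^ i)"
      using r0 by (intro sum_mono mult_right_mono Eb z) auto
    also have "\<dots> = \<delta> * (\<Sum>i<k. (1/2) ^ i)"
      unfolding sum_distrib_left using r0 by (intro sum.cong) (auto simp: r0(3) power_mult_distrib power_divide)
    also have "\<dots> \<le> \<delta> * 2"
      using \<delta> by (intro mult_left_mono) (auto simp: sum_gp_strict)
    finally show ?thesis by (simp add: \<delta>_def)
  qed
  obtain q where q: "\<And>i. dep_on (S - {n}) (pd w \<rho>1) (q i)"
    "\<And>i z. z \<in> pd w \<rho>1 \<Longrightarrow> norm (q i z) * r0 ^ i \<le> 2"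
    "\<And>i z. z \<in> pd w \<rho>1 \<Longrightarrow> q i z + (\<Sum>j\<le>i+b. E j z * q (i + b - j) z) = (if i = 0 then 1 else 0)"
    by (rule preparation_series[OF open_pd dE r0(1) small]) (assumption | rule that)+
  \<comment> \<open>The bound \<open>2 / r0 ^ i\<close> on the coefficients of the series gives
    geometric convergence once the modulus of \<open>z $ n - w $ n\<close> is at most
    \<open>r0 / 2\<close>.\<close>
  define \<rho>' where "\<rho>' = min \<rho>1 (r0 / 2)"
  have \<rho>': "0 < \<rho>'" "\<rho>' \<le> \<rho>" "pd w \<rho>' \<subseteq> pd w \<rho>1" "pd w \<rho>' \<subseteq> pd w r" "\<rho>' \<le> r0 / 2"
    using \<rho>1 r\<rho> r0 by (auto simp: \<rho>'_def intro!: pd_mono)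
  have \<zeta>: "norm (z $ n - w $ n) \<le> r0 / 2" if "z \<in> pd w \<rho>'" for z
  proof -
    have "dist (w $ n) (z $ n) < \<rho>'"
      using that by (simp add: pd_def)
    then show ?thesis
      using \<rho>'(5) by (simp add: dist_norm norm_minus_commute)
  qed
  define qq where "qq z = suminf (\<lambda>i. q i z * (z $ n - w $ n) ^ i)" for z
  have qM: "norm (q i z * (z $ n - w $ n) ^ i) \<le> 2 * (1/2) ^ i" if z: "z \<in> pd w \<rho>'" for i z
  proof -
    have "norm (q i z * (z $ n - w $ n) ^ i) \<le> norm (q i z) * (r0 / 2) ^ i"
      unfolding norm_mult norm_power by (intro mult_left_mono power_mono \<zeta> z) auto
    also have "\<dots> = (norm (q i z) * r0 ^ i) * (1/2) ^ i"
      by (simp add: power_divide)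
    also have "\<dots> \<le> 2 * (1/2) ^ i"
      using q(2) z \<rho>'(3) by (intro mult_right_mono) auto
    finally show ?thesis .
  qed
  have sM: "summable (\<lambda>i. 2 * (1/2 :: real) ^ i)"
    by (intro summable_mult summable_geometric) simp
  have dqq: "dep_on S (pd w \<rho>') qq"
    unfolding qq_def[abs_def]
    by (rule dep_on_suminf[OF open_pd _ qM sM])
      (use n in \<open>auto intro!: dep_on_intros dep_on_mono[OF dep_on_subset[OF q(1) \<rho>'(3)]]\<close>)
  define h where "h k z = (\<Sum>j\<le>k. E j z * q (k - j) z)" for k z
  show ?thesis
  proof (rule that[OF \<rho>'(1,2)])
    show "dep_on (S - {n}) (pd w \<rho>') (h k)" for k
      unfolding h_def by (intro dep_on_intros dep_on_subset[OF q(1) \<rho>'(3)] dep_on_subset[OF dE \<rho>'(3)])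
    show "dep_on S (pd w \<rho>') (\<lambda>z. qq z * u z)"
      by (intro dep_on_intros dqq dep_on_subset[OF u \<rho>'(4)])
    fix z assume z: "z \<in> pd w \<rho>'"
    define t where "t = z $ n - w $ n"
    have z1: "z \<in> pd w \<rho>1" using z \<rho>'(3) by blast
    have zr1: "z $ n \<in> ball (w $ n) r1"
      using \<zeta>[OF z] r0 by (simp add: dist_norm norm_minus_commute)
    have Es: "(\<lambda>i. E i z * t ^ i) sums e z"
      using cint_power_series[OF ch[OF z1] r1 zr1] by (simp add: E_def t_def)
    have Eh: "norm (E i z * t ^ i) \<le> \<delta> * (1/2) ^ i" for i
    proof -
      have "norm (E i z * t ^ i) \<le> \<delta> / r1 ^ i * r0 ^ i"
        unfolding norm_mult norm_power t_def
        using \<zeta>[OF z] r0 r1 \<delta> by (intro mult_mono power_mono Eb z1) auto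
      then show ?thesis
        using r0 by (simp add: r0(3) power_mult_distrib power_divide)
    qed
    have sh: "summable (\<lambda>i. \<delta> * (1/2 :: real) ^ i)"
      by (intro summable_mult summable_geometric) simp
    have En: "summable (\<lambda>i. norm (E i z * t ^ i))"
      by (rule summable_comparison_test'[OF sh, of 0]) (use Eh in auto)
    have qn: "summable (\<lambda>i. norm (q i z * t ^ i))"
      unfolding t_def by (rule summable_comparison_test'[OF sM, of 0]) (use qM[OF z] in auto)
    have qs: "(\<lambda>i. q i z * t ^ i) sums qq z"
      unfolding qq_def t_def[symmetric] by (rule summable_sums[OF summable_norm_cancel[OF qn]])
    have "(\<Sum>i\<le>k. E i z * t ^ i * (q (k - i) z * t ^ (k - i))) = h k z * t ^ k" for k
      unfolding h_def sum_distrib_right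
      by (intro sum.cong) (auto simp: mult_ac power_add[symmetric])
    then have hs: "(\<lambda>k. h k z * t ^ k) sums (e z * qq z)"
      using Cauchy_product_sums[OF En qn] sums_unique[OF Es] sums_unique[OF qs] by simp
    have "(\<lambda>i. h (i + b) z * t ^ (i + b)) sums (e z * qq z - (\<Sum>k<b. h k z * t ^ k))"
      using sums_split_initial_segment[OF hs, of b] by simp
    \<comment> \<open>From degree \<open>b\<close> on, the coefficients of \<open>e * qq\<close> are
      prescribed by the equation for \<open>q\<close>, so the tail sums to
      \<open>(1 - qq z) * t ^ b\<close>. The terms below degree \<open>b\<close> are the
      coefficients of the Weierstrass polynomial.\<close>
    moreover have "h (i + b) z * t ^ (i + b) = ((if i = 0 then 1 else 0) - q i z * t ^ i) * t ^ b" for i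
    proof -
      have "h (i + b) z = (if i = 0 then 1 else 0) - q i z"
        using q(3)[OF z1, of i] by (simp only: h_def eq_diff_eq add.commute)
      then show ?thesis
        by (cases "i = 0") (simp_all add: power_add left_diff_distrib)
    qed
    moreover have "(\<lambda>i. ((if i = 0 then 1 else 0) - q i z * t ^ i) * t ^ b) sums ((1 - qq z) * t ^ b)"
      using sums_single[of 0 "\<lambda>_. 1 :: complex"] by (intro sums_mult2 sums_diff qs) simp
    ultimately have "e z * qq z - (\<Sum>k<b. h k z * t ^ k) = (1 - qq z) * t ^ b"
      using sums_unique2 by simp
    moreover have "f z * u z = e z + t ^ b"
      by (simp add: e_def t_def)
    ultimately have "qq z * (f z * u z) = t ^ b + (\<Sum>k<b. h k z * t ^ k)"
      by (simp add: algebra_simps)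
    then show "qq z * u z * f z = (z $ n - w $ n) ^ b + (\<Sum>k<b. h k z * (z $ n - w $ n) ^ k)"
      by (simp add: t_def mult_ac)
  qed
qed

subsection \<open>Oka's theorem\<close>

lemma hol_near_pd:
  assumes "finite I" "\<And>i. i \<in> I \<Longrightarrow> hol_near y (f i)" "\<forall>\<^sub>F z in nhds y. P z"
  obtains \<rho> where "0 < \<rho>" "\<And>i. i \<in> I \<Longrightarrow> f i hol_on pd y \<rho>" "\<And>z. z \<in> pd y \<rho> \<Longrightarrow> P z"
proof -
  have "\<forall>\<^sub>F z in nhds y. \<forall>i\<in>I. cdiff (f i) z"
    using assms(1,2) by (intro eventually_ball_finite) (auto simp: hol_near_def)
  with assms(3) have "\<forall>\<^sub>F z in nhds y. (\<forall>i\<in>I. cdiff (f i) z) \<and> P z"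
    by (rule eventually_conj[rotated])
  then show ?thesis
    using that unfolding eventually_nhds_pd hol_on_iff_cdiff by blast
qed

text \<open>Finitely many roots have finitely many distances from \<open>x0\<close>, whereas there
  are infinitely many radii below \<open>R\<close>.\<close>

lemma monic_nonzero_near:
  fixes a :: "nat \<Rightarrow> complex"
  assumes "a b = 1" "0 < R"
  obtains r where "0 < r" "r < R" "\<And>x. x \<in> sphere x0 r \<Longrightarrow> (\<Sum>l\<le>b. a l * (x - c) ^ l) \<noteq> 0"
proof -
  have "finite {x. (\<Sum>l\<le>b. a l * x ^ l) = 0}"
    using assms(1) polyfun_finite_roots[of a b] by force
  then have "finite ((\<lambda>x. dist x0 (x + c)) ` {x. (\<Sum>l\<le>b. a l * x ^ l) = 0})"
    by blast
  moreover have "infinite {0<..<R}"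
    using assms(2) by simp
  ultimately obtain r where "r \<in> {0<..<R}" "r \<notin> (\<lambda>x. dist x0 (x + c)) ` {x. (\<Sum>l\<le>b. a l * x ^ l) = 0}"
    by (meson finite_subset subsetI)
  then show ?thesis
    using that[of r] by (force simp: image_iff)
qed

text \<open>Being monic, \<open>W\<close> has a circle free of zeros on the slice through any point
  \<open>y\<close>, and \<open>upd_tube\<close> keeps it free of zeros for nearby parameters.
  Division is thus available around every point, not only around the one of preparation.\<close>

lemma division_at_exists:
  assumes R: "0 < R" and A: "\<And>l. l \<le> b \<Longrightarrow> dep_on (UNIV - {n}) (pd y R) (A l)" and monic: "\<And>z. A b z = 1"
  obtains r \<epsilon> where "division_at n c y r \<epsilon> R b A"
proof -
  obtain r where r: "0 < r" "r < R" "\<And>x. x \<in> sphere (y $ n) r \<Longrightarrow> (\<Sum>l\<le>b. A l y * (x - c) ^ l) \<noteq> 0"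
    using monic_nonzero_near[of "\<lambda>l. A l y" b R "y $ n" c] monic R by metis
  define V where "V = pd y R \<inter> (\<lambda>z. \<Sum>l\<le>b. A l z * (z $ n - c) ^ l) -` (- {0})"
  have "continuous_on (pd y R) (\<lambda>z. \<Sum>l\<le>b. A l z * (z $ n - c) ^ l)"
    using A by (intro continuous_intros hol_on_imp_continuous_on dep_on_hol[of "UNIV - {n}"]) auto
  then have V: "open V"
    unfolding V_def by (intro continuous_open_preimage open_pd) auto
  have indep: "A l (upd n z x) = A l z" if "l \<le> b" "z \<in> pd y R" "upd n z x \<in> pd y R" for l z x
    by (rule dep_onD[OF A]) (use that in auto)
  have up: "upd n y x \<in> pd y R" if "x \<in> sphere (y $ n) r" for x
    using that r R upd_in_pd[of y y R n x] by simp
  have "upd n y x \<in> V" if "x \<in> sphere (y $ n) r" for x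
    using that r(3)[OF that] up[OF that] R by (simp add: V_def indep)
  then obtain \<epsilon> where \<epsilon>: "0 < \<epsilon>" "\<And>z x. \<lbrakk>z \<in> pd y \<epsilon>; x \<in> sphere (y $ n) r\<rbrakk> \<Longrightarrow> upd n z x \<in> V"
    by (rule upd_tube[OF V compact_sphere]) (assumption | rule that)+
  \<comment> \<open>The minimum with \<open>r\<close> ensures that \<open>z $ n\<close> stays inside
    the circle of integration.\<close>
  have "division_at n c y r (min \<epsilon> r) R b A"
  proof
    show "dep_on (UNIV - {n}) (pd y R) (A l)" if "l \<le> b" for l by (rule A[OF that])
    fix z x assume z: "z \<in> pd y (min \<epsilon> r)" and x: "x \<in> sphere (y $ n) r"
    have "z \<in> pd y \<epsilon>" "z \<in> pd y R"
      using z pd_mono[of "min \<epsilon> r" \<epsilon> y] pd_mono[of "min \<epsilon> r" R y] min.coboundedI2[of r R \<epsilon>] r(2) by auto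
    with \<epsilon>(2)[OF _ x] have "upd n z x \<in> V" by blast
    then show "(\<Sum>l\<le>b. A l z * (x - c) ^ l) \<noteq> 0"
      using \<open>z \<in> pd y R\<close> by (auto simp: V_def indep)
  qed (use r \<epsilon> in auto)
  then show ?thesis by (rule that)
qed

lemma regular_division:
  fixes f :: "complex ^ 'm \<Rightarrow> complex"
  assumes \<rho>: "0 < \<rho>" and f: "dep_on S (pd w \<rho>) f" and n: "n \<in> S" and fw: "f w = 0"
    and x0: "x0 \<in> ball (w $ n) \<rho>" "f (upd n w x0) \<noteq> 0"
  obtains \<rho>' b A Q r \<epsilon> where "0 < \<rho>'" "\<rho>' \<le> \<rho>" "\<And>l. l \<le> b \<Longrightarrow> dep_on (S - {n}) (pd w \<rho>') (A l)"
    "\<And>z. A b z = 1" "dep_on S (pd w \<rho>') Q"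
    "\<And>z. z \<in> pd w \<rho>' \<Longrightarrow> (\<Sum>l\<le>b. A l z * (z $ n - w $ n) ^ l) = Q z * f z"
    "division_at n (w $ n) w r \<epsilon> \<rho>' b A"
proof -
  obtain \<rho>' b A0 Q where \<rho>': "0 < \<rho>'" "\<rho>' \<le> \<rho>" and A0: "\<And>k. k < b \<Longrightarrow> dep_on (S - {n}) (pd w \<rho>') (A0 k)"
    and Q: "dep_on S (pd w \<rho>') Q"
    and QA0: "\<And>z. z \<in> pd w \<rho>' \<Longrightarrow> Q z * f z = (z $ n - w $ n) ^ b + (\<Sum>k<b. A0 k z * (z $ n - w $ n) ^ k)"
    by (rule Weierstrass_preparation[OF \<rho> f n fw x0]) blast
  \<comment> \<open>The leading coefficient 1 joins the list, so that \<open>W\<close> is a single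
    sum over \<open>l \<le> b\<close>.\<close>
  define A where "A l = (if l = b then (\<lambda>_. 1) else A0 l)" for l
  have A: "dep_on (S - {n}) (pd w \<rho>') (A l)" if "l \<le> b" for l
    using that A0 by (auto simp: A_def dep_on_const)
  have Ab: "A b z = 1" for z
    by (simp add: A_def)
  have AU: "dep_on (UNIV - {n}) (pd w \<rho>') (A l)" if "l \<le> b" for l
    by (rule dep_on_mono[OF A[OF that]]) auto
  have W: "(\<Sum>l\<le>b. A l z * (z $ n - w $ n) ^ l) = Q z * f z" if "z \<in> pd w \<rho>'" for z
    using QA0[OF that] by (simp add: lessThan_Suc_atMost[symmetric] A_def)
  obtain r \<epsilon> where "division_at n (w $ n) w r \<epsilon> \<rho>' b A"
    by (rule division_at_exists[where b = b and A = A and c = "w $ n", OF \<rho>'(1) AU Ab])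
  with \<rho>' A Ab Q W show ?thesis
    by (rule that)
qed

text \<open>Degrees at most \<open>b - 1\<close> and at most \<open>b\<close> add up to less than
  \<open>2 * b\<close>, which is the number of equations in the linear system below.\<close>

lemma poly_mult_coeffs:
  fixes f g :: "nat \<Rightarrow> 'a::comm_ring_1"
  shows "(\<Sum>k<b. f k * t ^ k) * (\<Sum>l\<le>b. g l * t ^ l) =
    (\<Sum>e<2*b. (\<Sum>k<b. f k * (if k \<le> e \<and> e - k \<le> b then g (e - k) else 0)) * t ^ e)"
proof -
  have "(\<Sum>l\<le>b. g l * t ^ l) * t ^ k = (\<Sum>e<2*b. (if k \<le> e \<and> e - k \<le> b then g (e - k) else 0) * t ^ e)"
    if "k < b" for k
  proof -
    have "(\<Sum>e<2*b. (if k \<le> e \<and> e - k \<le> b then g (e - k) else 0) * t ^ e) =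
        (\<Sum>e\<in>{k..k+b}. g (e - k) * t ^ e)"
      by (rule sum.mono_neutral_cong_right) (use that in auto)
    also have "\<dots> = (\<Sum>l\<le>b. g l * t ^ (l + k))"
      by (rule sum.reindex_bij_witness[of _ "\<lambda>l. l + k" "\<lambda>e. e - k"]) auto
    finally show ?thesis
      by (simp add: sum_distrib_right power_add mult.assoc)
  qed
  then have "(\<Sum>k<b. f k * t ^ k) * (\<Sum>l\<le>b. g l * t ^ l) =
      (\<Sum>k<b. f k * (\<Sum>e<2*b. (if k \<le> e \<and> e - k \<le> b then g (e - k) else 0) * t ^ e))"
    by (simp add: sum_distrib_right mult_ac)
  also have "\<dots> = (\<Sum>e<2*b. (\<Sum>k<b. f k * (if k \<le> e \<and> e - k \<le> b then g (e - k) else 0)) * t ^ e)"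
    unfolding sum_distrib_left sum_distrib_right by (subst sum.swap) (simp add: mult.assoc)
  finally show ?thesis .
qed

text \<open>A ball is infinite, so a polynomial vanishing on it has no nonzero coefficient; the
  shift by \<open>c\<close> is injective and preserves infinity.\<close>

lemma polyfun_zero_on_ball:
  fixes a :: "nat \<Rightarrow> complex"
  assumes "0 < \<epsilon>" "\<And>x. x \<in> ball x0 \<epsilon> \<Longrightarrow> (\<Sum>e<m. a e * (x - c) ^ e) = 0" "e < m"
  shows "a e = 0"
proof (rule ccontr)
  assume "a e \<noteq> 0"
  obtain m' where m': "m = Suc m'"
    using assms(3) by (cases m) auto
  have "finite {x. (\<Sum>i\<le>m'. a i * x ^ i) = 0}"
    using polyfun_finite_roots[of a m'] \<open>a e \<noteq> 0\<close> assms(3) m' by (metis less_Suc_eq_le)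
  moreover have "(\<lambda>x. x - c) ` ball x0 \<epsilon> \<subseteq> {x. (\<Sum>i\<le>m'. a i * x ^ i) = 0}"
    using assms(2) by (auto simp: m' lessThan_Suc_atMost)
  ultimately have "finite ((\<lambda>x. x - c) ` ball x0 \<epsilon>)"
    by (rule finite_subset[rotated])
  then have "finite (ball x0 \<epsilon>)"
    by (rule finite_imageD) (simp add: inj_on_def)
  then show False
    using assms(1) uncountable_ball countable_finite by blast
qed

text \<open>A relation of the \<open>s\<^sub>j = P\<^sub>j + t\<^sub>j W\<close> becomes one of the \<open>P\<^sub>j\<close> and \<open>W\<close>. Modulo the trivial relations
  (\<open>Inr m\<close> below) it consists of polynomials of degree \<open>< b\<close> in \<open>z\<^sub>n - c\<close>, whose coefficients solve the
  linear system \<open>sys\<close> over the functions of the other variables (solutions \<open>Inl l\<close>). Finally \<open>W = Q s\<^sub>q\<close>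
  turns the generators back into relations \<open>H\<close> of the \<open>s\<^sub>j\<close>; no inverse of \<open>Q\<close> is needed.\<close>

lemma oka_step:
  fixes s :: "nat \<Rightarrow> complex ^ 'm \<Rightarrow> complex" and N :: nat
  assumes n: "n \<in> S"
    and IH: "\<And>(M::nat) (E::nat set) t. \<lbrakk>finite E; \<And>e i. e \<in> E \<Longrightarrow> i < M \<Longrightarrow> \<exists>\<rho>>0. dep_on (S - {n}) (pd w \<rho>) (t e i)\<rbrakk>
      \<Longrightarrow> fin_rel (S - {n}) w E {..<M} t"
    and \<rho>: "0 < \<rho>" and s: "\<And>i. i < N \<Longrightarrow> dep_on S (pd w \<rho>) (s i)"
    and q0: "q0 < N" "s q0 w = 0" "x0 \<in> ball (w $ n) \<rho>" "s q0 (upd n w x0) \<noteq> 0"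
  shows "fin_rel S w {()} {..<N} (\<lambda>_. s)"
proof -
  define c where "c = w $ n"
  obtain \<rho>1 b A Q r \<epsilon> where \<rho>1: "0 < \<rho>1" "\<rho>1 \<le> \<rho>"
    and A: "\<And>l. l \<le> b \<Longrightarrow> dep_on (S - {n}) (pd w \<rho>1) (A l)" and Ab: "\<And>z. A b z = 1"
    and Q: "dep_on S (pd w \<rho>1) Q"
    and QA: "\<And>z. z \<in> pd w \<rho>1 \<Longrightarrow> (\<Sum>l\<le>b. A l z * (z $ n - c) ^ l) = Q z * s q0 z"
    and "division_at n c w r \<epsilon> \<rho>1 b A"
    by (rule regular_division[OF \<rho> s[OF q0(1)] n q0(2-4), folded c_def]) (assumption | rule that)+
  define W where "W z = (\<Sum>l\<le>b. A l z * (z $ n - c) ^ l)" for z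
  have W: "W z = Q z * s q0 z" if "z \<in> pd w \<rho>1" for z
    unfolding W_def by (rule QA[OF that])
  interpret D: division_at n c w r \<epsilon> \<rho>1 b A by fact
  have \<epsilon>: "0 < \<epsilon>" "pd w \<epsilon> \<subseteq> pd w \<rho>1"
    using D.eps D.sub by auto
  have s1: "dep_on S (pd w \<rho>1) (s i)" if "i < N" for i
    by (rule dep_on_subset[OF s[OF that] pd_mono[OF \<rho>1(2)]])
  define t where "t j = D.quo (s j)" for j
  \<comment> \<open>A zero coefficient of degree \<open>b\<close> pads the remainder, so that it has
    the same format as the coefficients \<open>A\<close> of \<open>W\<close>.\<close>
  define P where "P j l = (if l < b then D.rem (s j) A l else (\<lambda>_. 0))" for j l
  define Pp where "Pp j z = (\<Sum>l\<le>b. P j l z * (z $ n - c) ^ l)" for j z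
  have t: "dep_on S (pd w \<epsilon>) (t j)" if "j < N" for j
    unfolding t_def by (rule D.dep_on_quo[OF s1[OF that] n A])
  have P: "dep_on (S - {n}) (pd w \<epsilon>) (P j l)" if "j < N" for j l
    unfolding P_def by (cases "l < b") (simp_all add: dep_on_const D.dep_on_rem[OF s1[OF that] A A])
  have sP: "s j z = Pp j z + t j z * W z" if "j < N" "z \<in> pd w \<epsilon>" for j z
  proof -
    have "Pp j z = (\<Sum>k<b. D.rem (s j) A k z * (z $ n - c) ^ k)"
      unfolding Pp_def P_def lessThan_Suc_atMost[symmetric] by simp
    then show ?thesis
      using D.division[OF dep_on_hol[OF s1[OF that(1)]] that(2)] by (simp add: t_def W_def)
  qed
  \<comment> \<open>Entry \<open>N\<close>, one past the given functions, stands for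
    \<open>W\<close>.\<close>
  define C where "C j l = (if j = N then A l else P j l)" for j l
  have C: "dep_on (S - {n}) (pd w \<epsilon>) (C j l)" if "j \<le> N" "l \<le> b" for j l
    using that P dep_on_subset[OF A \<epsilon>(2)] by (auto simp: C_def)
  \<comment> \<open>The unknown \<open>(j, k)\<close> is the coefficient of degree \<open>k\<close>
    in the factor of entry \<open>j\<close>; \<open>sys e (j, k)\<close> is its coefficient in the
    equation which says that the whole sum has no term of degree \<open>e\<close>.\<close>
  define sys where "sys e i z = (let (j, k) = i in if k \<le> e \<and> e - k \<le> b then C j (e - k) z else 0)"
    for e :: nat and i :: "nat \<times> nat" and z
  define I where "I = {..N} \<times> {..<b}"
  have sys: "dep_on (S - {n}) (pd w \<epsilon>) (sys e i)" if "i \<in> I" for e i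
    using that unfolding sys_def I_def by (auto intro!: dep_on_if dep_on_const C)
  have conv: "(\<Sum>j\<le>N. (\<Sum>k<b. x (j, k) * v ^ k) * (\<Sum>l\<le>b. C j l z * v ^ l)) =
      (\<Sum>e<2*b. (\<Sum>i\<in>I. x i * sys e i z) * v ^ e)" for x v z
  proof -
    have "(\<Sum>j\<le>N. (\<Sum>k<b. x (j, k) * v ^ k) * (\<Sum>l\<le>b. C j l z * v ^ l)) =
        (\<Sum>j\<le>N. \<Sum>e<2*b. (\<Sum>k<b. x (j, k) * sys e (j, k) z) * v ^ e)"
      by (rule sum.cong[OF refl], subst poly_mult_coeffs) (simp add: sys_def)
    also have "\<dots> = (\<Sum>e<2*b. (\<Sum>j\<le>N. \<Sum>k<b. x (j, k) * sys e (j, k) z) * v ^ e)"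
      unfolding sum_distrib_right by (rule sum.swap)
    finally show ?thesis
      by (simp add: I_def sum.cartesian_product)
  qed
  have "finite I"
    by (simp add: I_def)
  then obtain h where h: "bij_betw h {..<card I} I"
    using bij_betw_from_nat_into_finite by blast
  have "fin_rel (S - {n}) w {..<2*b} I sys"
    by (rule fin_rel_reindex[OF h], rule IH)
      (use \<epsilon>(1) bij_betwE[OF h] in \<open>auto intro!: exI[of _ \<epsilon>] sys\<close>)
  then obtain \<rho>2 N' G where \<rho>2: "0 < \<rho>2" and "gen_rel (S - {n}) (pd w \<rho>2) {..<2*b} I sys {..<N'::nat} G"
    by (auto simp: fin_rel_def)
  define \<rho>3 where "\<rho>3 = min \<epsilon> \<rho>2"
  have \<rho>3: "0 < \<rho>3" "pd w \<rho>3 \<subseteq> pd w \<epsilon>" "pd w \<rho>3 \<subseteq> pd w \<rho>2"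
    using \<epsilon> \<rho>2 by (auto simp: \<rho>3_def intro!: pd_mono)
  have \<rho>31: "pd w \<rho>3 \<subseteq> pd w \<rho>1"
    using \<rho>3(2) \<epsilon>(2) by blast
  have G: "gen_rel (S - {n}) (pd w \<rho>3) {..<2*b} I sys {..<N'} G"
    by (rule gen_rel_subset) fact+
  define \<Lambda> where "\<Lambda> = {..<N'} <+> {..<N}"
  \<comment> \<open>Generators for the relations of the \<open>Pp j\<close> and \<open>W\<close>.
    \<open>Inr m\<close> is the Koszul relation with \<open>W\<close> in place \<open>m\<close> and
    \<open>- Pp m\<close> in place \<open>N\<close>.\<close>
  define Y where "Y \<kappa> j z = (case \<kappa> of Inl l \<Rightarrow> \<Sum>k<b. G l (j, k) z * (z $ n - c) ^ k
      | Inr m \<Rightarrow> if j = N then - Pp m z else if j = m then W z else 0)" for \<kappa> :: "nat + nat" and j z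
  \<comment> \<open>For a relation \<open>Y\<close> of the \<open>Pp j\<close> and \<open>W\<close>,
    substituting \<open>s j = Pp j + t j * W\<close> shows that the sum of the
    \<open>Y j * s j\<close> is \<open>- (Y N - (sum of Y m * t m)) * W\<close>. As
    \<open>W = Q * s q0\<close>, the added multiple of \<open>Q\<close> in place \<open>q0\<close>
    compensates for it.\<close>
  define H where "H \<kappa> i z = Y \<kappa> i z + (if i = q0 then (Y \<kappa> N z - (\<Sum>m<N. Y \<kappa> m z * t m z)) * Q z else 0)"
    for \<kappa> i z
  have sumL: "(\<Sum>\<kappa>\<in>\<Lambda>. f \<kappa>) = (\<Sum>l<N'. f (Inl l)) + (\<Sum>m<N. f (Inr m))" for f :: "nat + nat \<Rightarrow> complex"
    unfolding \<Lambda>_def by (simp add: sum.Plus)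
  note dsub = dep_on_mono[OF _ Diff_subset[of S "{n}"]]
  have WS: "dep_on S (pd w \<rho>3) W"
    unfolding W_def by (intro dep_on_intros n dsub dep_on_subset[OF A \<rho>31]) auto
  have PpS: "dep_on S (pd w \<rho>3) (Pp m)" if "m < N" for m
    unfolding Pp_def by (intro dep_on_intros n dsub dep_on_subset[OF P[OF that] \<rho>3(2)])
  have YS: "dep_on S (pd w \<rho>3) (Y \<kappa> j)" if "\<kappa> \<in> \<Lambda>" "j \<le> N" for \<kappa> j
  proof (cases \<kappa>)
    case (Inl l)
    have "dep_on S (pd w \<rho>3) (G l (j, k))" if "k < b" for k
      by (rule dsub[OF gen_rel_dep[OF G]]) (use Inl that \<open>\<kappa> \<in> \<Lambda>\<close> \<open>j \<le> N\<close> in \<open>auto simp: I_def \<Lambda>_def\<close>)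
    then show ?thesis
      unfolding Y_def Inl sum.case by (intro dep_on_intros n) auto
  next
    case (Inr m)
    then show ?thesis
      using that unfolding Y_def \<Lambda>_def by (auto intro!: dep_on_intros PpS WS)
  qed
  have Yrel: "(\<Sum>j<N. Y \<kappa> j z * Pp j z) + Y \<kappa> N z * W z = 0" if "\<kappa> \<in> \<Lambda>" "z \<in> pd w \<rho>3" for \<kappa> z
  proof (cases \<kappa>)
    case (Inl l)
    have "(\<Sum>j<N. Y \<kappa> j z * Pp j z) + Y \<kappa> N z * W z =
        (\<Sum>j\<le>N. (\<Sum>k<b. G l (j, k) z * (z $ n - c) ^ k) * (\<Sum>i\<le>b. C j i z * (z $ n - c) ^ i))"
      using Inl by (simp add: Y_def Pp_def W_def C_def lessThan_Suc_atMost[symmetric])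
    also have "\<dots> = 0"
      unfolding conv[of "\<lambda>i. G l i z"] using gen_rel_zero[OF G _ _ that(2), of l] that(1) Inl
      by (auto simp: \<Lambda>_def intro!: sum.neutral)
    finally show ?thesis .
  next
    case (Inr m)
    then have "m < N" using that(1) by (auto simp: \<Lambda>_def)
    have "(\<Sum>j<N. Y \<kappa> j z * Pp j z) = (\<Sum>j<N. (if j = m then W z else 0) * Pp j z)"
      using Inr by (intro sum.cong) (auto simp: Y_def)
    also have "\<dots> = W z * Pp m z"
      using \<open>m < N\<close> by (simp add: sum_mult_delta)
    finally show ?thesis
      using Inr by (simp add: Y_def)
  qed
  have "gen_rel S (pd w \<rho>3) {()} {..<N} (\<lambda>_. s) \<Lambda> H"
    unfolding gen_rel_def
  proof (intro conjI ballI allI impI)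
    show "finite \<Lambda>" by (simp add: \<Lambda>_def)
    show "dep_on S (pd w \<rho>3) (H \<kappa> i)" if "\<kappa> \<in> \<Lambda>" "i \<in> {..<N}" for \<kappa> i
      unfolding H_def using that
      by (intro dep_on_intros YS dep_on_subset[OF t \<rho>3(2)] dep_on_subset[OF Q \<rho>31]) auto
    show "(\<Sum>i<N. H \<kappa> i z * s i z) = 0" if \<kappa>: "\<kappa> \<in> \<Lambda>" and z: "z \<in> pd w \<rho>3" for \<kappa> z
    proof -
      have zW: "W z = Q z * s q0 z" and zs: "\<And>j. j < N \<Longrightarrow> s j z = Pp j z + t j z * W z"
        using z \<rho>31 \<rho>3(2) W sP by blast+
      have "(\<Sum>i<N. H \<kappa> i z * s i z) = (\<Sum>i<N. Y \<kappa> i z * s i z)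
          + (\<Sum>i<N. (if i = q0 then (Y \<kappa> N z - (\<Sum>m<N. Y \<kappa> m z * t m z)) * Q z else 0) * s i z)"
        by (simp only: H_def distrib_right sum.distrib)
      also have "\<dots> = (\<Sum>i<N. Y \<kappa> i z * s i z) + (Y \<kappa> N z - (\<Sum>m<N. Y \<kappa> m z * t m z)) * W z"
        using q0(1) by (simp add: sum_mult_delta zW)
      also have "(\<Sum>i<N. Y \<kappa> i z * s i z) = (\<Sum>i<N. Y \<kappa> i z * Pp i z) + (\<Sum>m<N. Y \<kappa> m z * t m z) * W z"
        by (simp add: zs sum_distrib_left algebra_simps sum.distrib)
      finally show ?thesis
        using Yrel[OF \<kappa> z] by (simp add: algebra_simps)
    qed
    fix y a assume y: "y \<in> pd w \<rho>3"
      and a: "(\<forall>i\<in>{..<N}. hol_near y (a i)) \<and> (\<forall>e\<in>{()}. \<forall>\<^sub>F z in nhds y. (\<Sum>i<N. a i z * s i z) = 0)"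
    \<comment> \<open>With this last entry a relation of the \<open>s j\<close> becomes one of the
      \<open>Pp j\<close> and \<open>W\<close>.\<close>
    define a' where "a' z = (\<Sum>m<N. a m z * t m z)" for z
    have tn: "hol_near y (t m)" if "m < N" for m
      by (rule dep_on_hol_near[OF t[OF that] open_pd]) (use y \<rho>3(2) in blast)
    have a'n: "hol_near y a'"
      unfolding a'_def using a tn by (intro hol_near_intros) auto
    have ev: "\<forall>\<^sub>F z in nhds y. z \<in> pd w \<rho>3 \<and> (\<Sum>j<N. a j z * Pp j z) + a' z * W z = 0"
    proof -
      have "\<forall>\<^sub>F z in nhds y. z \<in> pd w \<rho>3"
        using open_pd y by (rule eventually_nhds_in_open)
      moreover have "\<forall>\<^sub>F z in nhds y. (\<Sum>i<N. a i z * s i z) = 0"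
        using a by blast
      ultimately show ?thesis
      proof eventually_elim
        case (elim z)
        have "(\<Sum>i<N. a i z * s i z) = (\<Sum>i<N. a i z * (Pp i z + t i z * W z))"
          using elim(1) \<rho>3(2) by (intro sum.cong refl) (subst sP, auto)
        also have "\<dots> = (\<Sum>j<N. a j z * Pp j z) + a' z * W z"
          by (simp add: a'_def sum_distrib_left algebra_simps sum.distrib)
        finally show ?case using elim by simp
      qed
    qed
    have "hol_near y (if j = N then a' else a j)" if "j \<in> {..N}" for j
      using that a a'n by simp
    then obtain R where R: "0 < R"
      and aR: "\<And>j. j \<in> {..N} \<Longrightarrow> (if j = N then a' else a j) hol_on pd y R"
      and yR: "\<And>z. z \<in> pd y R \<Longrightarrow> z \<in> pd w \<rho>3 \<and> (\<Sum>j<N. a j z * Pp j z) + a' z * W z = 0"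
      by (rule hol_near_pd[OF finite_atMost _ ev]) (assumption | rule that)+
    have a'R: "a' hol_on pd y R"
      using aR[of N] by simp
    have ajR: "a j hol_on pd y R" if "j < N" for j
      using aR[of j] that by simp
    have subR: "pd y R \<subseteq> pd w \<rho>3" "pd y R \<subseteq> pd w \<rho>1" "pd y R \<subseteq> pd w \<epsilon>"
      using yR \<rho>31 \<rho>3(2) by blast+
    have Sn: "S - {n} \<subseteq> UNIV - {n}"
      by blast
    have AU: "dep_on (UNIV - {n}) (pd y R) (A l)" if "l \<le> b" for l
      by (rule dep_on_mono[OF dep_on_subset[OF A[OF that] subR(2)] Sn])
    have PU: "dep_on (UNIV - {n}) (pd y R) (P j l)" if "j < N" for j l
      by (rule dep_on_mono[OF dep_on_subset[OF P[OF that] subR(3)] Sn])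
    obtain r' \<epsilon>' where "division_at n c y r' \<epsilon>' R b A"
      by (rule division_at_exists[where b = b and A = A and c = c, OF R AU Ab])
    then interpret E: division_at n c y r' \<epsilon>' R b A .
    have \<epsilon>': "0 < \<epsilon>'" "pd y \<epsilon>' \<subseteq> pd y R"
      using E.eps E.sub by auto
    \<comment> \<open>The first \<open>N\<close> entries are reduced by \<open>W\<close>. The last
      polynomial is the one produced by \<open>division_relation\<close> from the remainders formed
      with the \<open>P j\<close>; the subtracted quotient multiples are then exactly a combination
      of the relations \<open>Inr m\<close>.\<close>
    define x where "x i z = (let (j, k) = i in if j = N then - (\<Sum>j<N. E.rem (a j) (P j) k z) else E.rem (a j) A k z)"
      for i z
    have aU: "dep_on UNIV (pd y R) (a j)" if "j < N" for j
      using ajR[OF that] by (simp add: dep_on_def vec_eq_iff[symmetric])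
    have xU: "dep_on (UNIV - {n}) (pd y \<epsilon>') (x i)" if "i \<in> I" for i
    proof -
      obtain j k where i: "i = (j, k)"
        by (cases i)
      have jN: "j \<le> N"
        using that by (simp add: I_def i)
      have "dep_on (UNIV - {n}) (pd y \<epsilon>') (E.rem (a j) (P j) k)" if "j < N" for j
        by (rule E.dep_on_rem[OF aU[OF that] AU PU[OF that]])
      moreover have "dep_on (UNIV - {n}) (pd y \<epsilon>') (E.rem (a j) A k)" if "j < N"
        by (rule E.dep_on_rem[OF aU[OF that] AU AU])
      ultimately show ?thesis
        unfolding x_def i using jN by (auto intro!: dep_on_intros)
    qed
    have adiv: "a j z = (\<Sum>k<b. x (j, k) z * (z $ n - c) ^ k) + E.quo (a j) z * W z"
      if "j < N" "z \<in> pd y \<epsilon>'" for j z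
      using E.division[OF ajR[OF that(1)] that(2)] that(1) by (simp add: x_def W_def)
    have a'div: "a' z = (\<Sum>k<b. x (N, k) z * (z $ n - c) ^ k) - (\<Sum>j<N. E.quo (a j) z * Pp j z)"
      if "z \<in> pd y \<epsilon>'" for z
    proof -
      have "a' z = (\<Sum>k<b. (- (\<Sum>j<N. E.rem (a j) (P j) k z)) * (z $ n - c) ^ k)
          - (\<Sum>j<N. E.quo (a j) z * (\<Sum>l\<le>b. P j l z * (z $ n - c) ^ l))"
        by (rule E.division_relation[OF finite_lessThan _ a'R _ _ that])
          (use ajR PU yR in \<open>auto simp: Pp_def W_def\<close>)
      then show ?thesis by (simp add: x_def Pp_def)
    qed
    \<comment> \<open>Neither \<open>x\<close> nor \<open>sys\<close> involves the coordinate
      \<open>n\<close>. Moving that coordinate alone turns the relation into a polynomial in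
      \<open>v - c\<close> with fixed coefficients that vanishes on a disc, so every coefficient is
      zero.\<close>
    have xrel: "(\<Sum>i\<in>I. x i z * sys e i z) = 0" if z: "z \<in> pd y \<epsilon>'" and e: "e < 2*b" for z e
    proof (rule polyfun_zero_on_ball[OF \<epsilon>'(1) _ e])
      fix v assume "v \<in> ball (y $ n) \<epsilon>'"
      then have z': "upd n z v \<in> pd y \<epsilon>'"
        using z by (intro upd_in_pd) auto
      have zw: "z \<in> pd w \<epsilon>" "upd n z v \<in> pd w \<epsilon>"
        using z z' \<epsilon>'(2) subR(3) by blast+
      have "x i z = x i (upd n z v)" if "i \<in> I" for i
        by (rule dep_onD[OF xU[OF that] z z']) auto
      moreover have "sys e i z = sys e i (upd n z v)" if "i \<in> I" for e i
        by (rule dep_onD[OF sys[OF that] zw]) auto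
      ultimately have "(\<Sum>e<2*b. (\<Sum>i\<in>I. x i z * sys e i z) * (v - c) ^ e) =
          (\<Sum>e<2*b. (\<Sum>i\<in>I. x i (upd n z v) * sys e i (upd n z v)) * (v - c) ^ e)"
        by simp
      also have "\<dots> = (\<Sum>j\<le>N. (\<Sum>k<b. x (j, k) (upd n z v) * (v - c) ^ k) *
          (\<Sum>l\<le>b. C j l (upd n z v) * (v - c) ^ l))"
        by (rule conv[symmetric])
      also have "\<dots> = (\<Sum>j<N. (a j (upd n z v) - E.quo (a j) (upd n z v) * W (upd n z v)) * Pp j (upd n z v))
          + (a' (upd n z v) + (\<Sum>j<N. E.quo (a j) (upd n z v) * Pp j (upd n z v))) * W (upd n z v)"
        using adiv[OF _ z'] a'div[OF z']
        by (simp add: C_def Pp_def W_def lessThan_Suc_atMost[symmetric])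
      also have "\<dots> = (\<Sum>j<N. a j (upd n z v) * Pp j (upd n z v)) + a' (upd n z v) * W (upd n z v)"
        by (simp add: algebra_simps sum_subtractf sum_distrib_left sum_distrib_right)
      also have "\<dots> = 0"
        using yR z' \<epsilon>'(2) by blast
      finally show "(\<Sum>e<2*b. (\<Sum>i\<in>I. x i z * sys e i z) * (v - c) ^ e) = 0" .
    qed
    have y\<epsilon>: "\<forall>\<^sub>F z in nhds y. z \<in> pd y \<epsilon>'"
      using \<epsilon>'(1) by (intro eventually_nhds_in_open open_pd) simp
    have xn: "hol_near y (x i)" if "i \<in> I" for i
      by (rule dep_on_hol_near[OF xU[OF that] open_pd]) (use \<epsilon>'(1) in simp)
    have xe: "\<forall>\<^sub>F z in nhds y. (\<Sum>i\<in>I. x i z * sys e i z) = 0" if "e \<in> {..<2*b}" for e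
      using y\<epsilon> by (rule eventually_mono) (use xrel that in simp)
    obtain d where d: "\<And>l. l \<in> {..<N'} \<Longrightarrow> hol_near y (d l)"
      "\<And>i. i \<in> I \<Longrightarrow> \<forall>\<^sub>F z in nhds y. x i z = (\<Sum>l<N'. d l z * G l i z)"
      by (rule gen_relD[OF G y, of x]) (use xn xe in blast)+
    have dI: "\<forall>\<^sub>F z in nhds y. \<forall>i\<in>I. x i z = (\<Sum>l<N'. d l z * G l i z)"
      by (rule eventually_ball_finite) (use d(2) \<open>finite I\<close> in auto)
    \<comment> \<open>The coefficients of the Koszul relations \<open>Inr m\<close> are the
      quotients of the entries by \<open>W\<close>.\<close>
    define f where "f \<kappa> = (case \<kappa> of Inl l \<Rightarrow> d l | Inr m \<Rightarrow> E.quo (a m))" for \<kappa>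
    have "hol_near y (E.quo (a m))" if "m < N" for m
      by (rule dep_on_hol_near[OF E.dep_on_quo[OF aU[OF that] UNIV_I AU] open_pd])
        (use \<epsilon>'(1) in auto)
    then have fn: "hol_near y (f \<kappa>)" if "\<kappa> \<in> \<Lambda>" for \<kappa>
      using that d(1) by (auto simp: f_def \<Lambda>_def)
    have fa: "\<forall>\<^sub>F z in nhds y. \<forall>i<N. a i z = (\<Sum>\<kappa>\<in>\<Lambda>. f \<kappa> z * H \<kappa> i z)"
      using dI y\<epsilon>
    proof eventually_elim
      case (elim z)
      have XG: "(\<Sum>l<N'. d l z * (\<Sum>k<b. G l (j, k) z * (z $ n - c) ^ k)) = (\<Sum>k<b. x (j, k) z * (z $ n - c) ^ k)"
        if "j \<le> N" for j
      proof -
        have "(\<Sum>k<b. x (j, k) z * (z $ n - c) ^ k) = (\<Sum>k<b. (\<Sum>l<N'. d l z * G l (j, k) z) * (z $ n - c) ^ k)"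
          using elim(1) that by (intro sum.cong) (auto simp: I_def)
        also have "\<dots> = (\<Sum>l<N'. d l z * (\<Sum>k<b. G l (j, k) z * (z $ n - c) ^ k))"
          unfolding sum_distrib_left sum_distrib_right mult.assoc by (rule sum.swap)
        finally show ?thesis by simp
      qed
      have fY: "(\<Sum>\<kappa>\<in>\<Lambda>. f \<kappa> z * Y \<kappa> j z) = a j z" if "j < N" for j
      proof -
        have "(\<Sum>m<N. E.quo (a m) z * (if j = m then W z else 0)) = E.quo (a j) z * W z"
          using that by (simp add: sum_mult_delta)
        then show ?thesis
          using that XG[of j] adiv[OF that elim(2)] by (simp add: sumL f_def Y_def)
      qed
      have fN: "(\<Sum>\<kappa>\<in>\<Lambda>. f \<kappa> z * Y \<kappa> N z) = a' z"
        using XG[of N] a'div[OF elim(2)] by (simp add: sumL f_def Y_def sum_negf)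
      \<comment> \<open>The combination of the \<open>Y\<close> is \<open>a\<close> in the first
        \<open>N\<close> entries and \<open>a'\<close> in the last. By the definition of
        \<open>a'\<close> the corrections in place \<open>q0\<close> therefore cancel in total, and
        the \<open>H\<close> combine to \<open>a\<close> with the same coefficients.\<close>
      have "(\<Sum>\<kappa>\<in>\<Lambda>. f \<kappa> z * (Y \<kappa> N z - (\<Sum>m<N. Y \<kappa> m z * t m z))) =
          a' z - (\<Sum>m<N. (\<Sum>\<kappa>\<in>\<Lambda>. f \<kappa> z * Y \<kappa> m z) * t m z)"
        unfolding right_diff_distrib sum_subtractf fN sum_distrib_left sum_distrib_right mult.assoc
        by (subst sum.swap) (rule refl)
      also have "\<dots> = 0"
        by (simp add: fY a'_def)
      finally have f0: "(\<Sum>\<kappa>\<in>\<Lambda>. f \<kappa> z * (Y \<kappa> N z - (\<Sum>m<N. Y \<kappa> m z * t m z))) = 0" .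
      have "(\<Sum>\<kappa>\<in>\<Lambda>. f \<kappa> z * ((Y \<kappa> N z - (\<Sum>m<N. Y \<kappa> m z * t m z)) * Q z)) = 0"
        unfolding mult.assoc[symmetric] sum_distrib_right[symmetric] f0 by simp
      then have "a i z = (\<Sum>\<kappa>\<in>\<Lambda>. f \<kappa> z * H \<kappa> i z)" if "i < N" for i
        using fY[OF that] by (cases "i = q0") (simp_all add: H_def distrib_left sum.distrib)
      then show ?case by blast
    qed
    show "\<exists>c. (\<forall>l\<in>\<Lambda>. hol_near y (c l)) \<and> (\<forall>i\<in>{..<N}. \<forall>\<^sub>F z in nhds y. a i z = (\<Sum>l\<in>\<Lambda>. c l z * H l i z))"
    proof (intro exI[of _ f] conjI ballI fn)
      show "\<forall>\<^sub>F z in nhds y. a i z = (\<Sum>\<kappa>\<in>\<Lambda>. f \<kappa> z * H \<kappa> i z)" if "i \<in> {..<N}" for i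
        using fa by (rule eventually_mono) (use that in blast)
    qed
  qed
  then show ?thesis by (rule fin_relI[OF \<rho>3(1)])
qed

section \<open>Regular directions and the induction on the variables\<close>

lemma common_radius:
  assumes "\<And>i. i < N \<Longrightarrow> \<exists>\<rho>>0. dep_on S (pd w \<rho>) (s i)"
  obtains \<rho> where "0 < \<rho>" "\<And>i. i < (N::nat) \<Longrightarrow> dep_on S (pd w \<rho>) (s i)"
proof -
  have "\<forall>\<^sub>F \<rho> in at_right 0. dep_on S (pd w \<rho>) (s i)" if i: "i < N" for i
  proof -
    obtain \<rho> where "0 < \<rho>" "dep_on S (pd w \<rho>) (s i)"
      using assms[OF i] by blast
    then show ?thesis
      unfolding eventually_at_right[OF \<open>0 < \<rho>\<close>]
      by (intro exI[of _ \<rho>] conjI allI impI dep_on_subset[OF \<open>dep_on S (pd w \<rho>) (s i)\<close> pd_mono]) auto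
  qed
  then have "\<forall>\<^sub>F \<rho> in at_right 0. \<forall>i\<in>{..<N}. dep_on S (pd w \<rho>) (s i)"
    by (intro eventually_ball_finite) auto
  moreover have "\<forall>\<^sub>F \<rho> in at_right (0::real). 0 < \<rho>"
    by (rule eventually_at_right_less)
  ultimately have "\<forall>\<^sub>F \<rho> in at_right (0::real). 0 < \<rho> \<and> (\<forall>i\<in>{..<N}. dep_on S (pd w \<rho>) (s i))"
    by (rule eventually_conj[rotated])
  then obtain \<rho> where "0 < \<rho>" "\<forall>i\<in>{..<N}. dep_on S (pd w \<rho>) (s i)"
    using eventually_happens trivial_limit_at_right_real by blast
  then show ?thesis using that by blast
qed

text \<open>The line through \<open>w\<close> and a point where \<open>f\<close> is nonzero becomes
  the axis \<open>n\<close> after a shear, provided that the point differs from \<open>w\<close> in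
  coordinate \<open>n\<close>. By the identity theorem \<open>f\<close> then has nonzero values on
  this line arbitrarily close to \<open>w\<close>. All radii are covered because the polydisc is
  shrunk only after the shear is known.\<close>

lemma exists_regular_shear:
  fixes f :: "complex ^ 'm \<Rightarrow> complex"
  assumes \<rho>: "0 < \<rho>" and f: "f hol_on pd w \<rho>" and p: "p \<in> pd w \<rho>" "f p \<noteq> 0"
  obtains u where "u $ n = 0" "\<And>\<rho>'. 0 < \<rho>' \<Longrightarrow> \<exists>x\<in>ball (w $ n) \<rho>'. f (shear n w u (upd n w x)) \<noteq> 0"
proof -
  have "open (pd w \<rho> \<inter> f -` (- {0}))"
    by (intro continuous_open_preimage hol_on_imp_continuous_on f open_pd) auto
  then obtain d where d: "0 < d" "pd p d \<subseteq> pd w \<rho> \<inter> f -` (- {0})"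
    using pd_subset_open[of "pd w \<rho> \<inter> f -` (- {0})" p] p by auto
  \<comment> \<open>A small move inside the set where \<open>f\<close> is nonzero separates
    coordinate \<open>n\<close> from \<open>w $ n\<close>.\<close>
  define p' where "p' = (if p $ n = w $ n then upd n p (p $ n + of_real (d / 2)) else p)"
  have "p' \<in> pd p d"
    using d(1) by (auto simp: p'_def dist_norm intro!: upd_in_pd)
  then have p': "p' \<in> pd w \<rho>" "f p' \<noteq> 0"
    using d(2) by blast+
  have p'n: "p' $ n \<noteq> w $ n"
    using d(1) by (simp add: p'_def)
  \<comment> \<open>The direction from \<open>w\<close> to \<open>p'\<close>, scaled so that
    \<open>v $ n = 1\<close>; the line is then parametrised by its own coordinate
    \<open>n\<close>.\<close>
  define v where "v = (\<chi> j. (p' $ j - w $ j) / (p' $ n - w $ n))"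
  define u where "u = upd n v 0"
  have line: "shear n w u (upd n w x) = w + (x - w $ n) *s v" for x
    using p'n by (simp add: shear_def u_def v_def vec_eq_iff)
  define g where "g x = f (w + (x - w $ n) *s v)" for x
  define B where "B = (\<lambda>x. w + (x - w $ n) *s v) -` pd w \<rho>"
  have aff: "(\<lambda>x. w + (x - w $ n) *s v) = (\<lambda>x. (w - (w $ n) *s v) + x *s v)"
    by (auto simp: vec_eq_iff algebra_simps)
  have "open B"
    unfolding B_def aff
    by (intro open_vimage open_pd continuous_intros linear_continuous_on bounded_linear_scalar_left)
  have "convex B"
  \<comment> \<open>The line meets the convex polydisc in a convex, hence connected, set of
    parameters, as the identity theorem requires.\<close>
  proof -
    have *: "y \<in> (\<lambda>z. z - a) ` pd w \<rho> \<longleftrightarrow> a + y \<in> pd w \<rho>" for a y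
      by (auto simp: image_iff intro: bexI[of _ "a + y"])
    have "B = (\<lambda>x. x *s v) -` ((\<lambda>z. z - (w - (w $ n) *s v)) ` pd w \<rho>)"
      unfolding B_def aff set_eq_iff vimage_eq * by blast
    then show ?thesis
      by (simp add: convex_linear_vimage bounded_linear.linear[OF bounded_linear_scalar_left]
          convex_translation_subtract convex_pd)
  qed
  have gB: "g holomorphic_on B"
    unfolding holomorphic_on_def
  proof
    fix x assume "x \<in> B"
    then have "cdiff f (w + (x - w $ n) *s v)"
      using f by (simp add: B_def hol_on_iff_cdiff)
    then have "cdiff f ((w - (w $ n) *s v) + x *s v)"
      by (simp only: fun_cong[OF aff])
    from cdiff_line[OF this] have "g field_differentiable at x"
      by (simp only: g_def[abs_def] fun_cong[OF aff])
    then show "g field_differentiable at x within B"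
      by (rule field_differentiable_at_within)
  qed
  have wB: "w $ n \<in> B"
    using \<rho> by (simp add: B_def)
  have "(p' $ n - w $ n) * v $ j = p' $ j - w $ j" for j
    using p'n by (simp add: v_def)
  then have "w + (p' $ n - w $ n) *s v = p'"
    by (simp only: vec_eq_iff vector_add_component vector_smult_component) simp
  then have pB: "p' $ n \<in> B" "g (p' $ n) \<noteq> 0"
    using p' by (simp_all add: B_def g_def)
  show ?thesis
  proof (rule that)
    show "u $ n = 0" by (simp add: u_def)
    fix \<rho>' :: real assume \<rho>': "0 < \<rho>'"
    show "\<exists>x\<in>ball (w $ n) \<rho>'. f (shear n w u (upd n w x)) \<noteq> 0"
    proof (rule ccontr)
      assume "\<not> ?thesis"
      then have "g x = 0" if "x \<in> ball (w $ n) \<rho>' \<inter> B" for x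
        using that by (auto simp: line g_def)
      moreover have "w $ n islimpt (ball (w $ n) \<rho>' \<inter> B)"
        using \<rho>' wB \<open>open B\<close> by (intro interior_limit_point) (simp add: interior_open open_Int)
      ultimately have "g (p' $ n) = 0"
        using analytic_continuation[OF gB \<open>open B\<close> convex_connected[OF \<open>convex B\<close>], of "ball (w $ n) \<rho>' \<inter> B" "w $ n"]
          wB pB(1) by blast
      with pB(2) show False by simp
    qed
  qed
qed

text \<open>If some function is nonzero at \<open>w\<close>, or if all vanish on the polydisc, the
  generators are explicit. Otherwise some function vanishes at \<open>w\<close> but not identically,
  and a shear makes it regular in the variable \<open>n\<close> for \<open>oka_step\<close>. With
  \<open>S\<close> empty the functions are constant on the polydisc and this last case cannot
  occur.\<close>

theorem Oka:
  fixes s :: "nat \<Rightarrow> complex ^ 'm \<Rightarrow> complex"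
  assumes "finite S" and "\<And>i. i < N \<Longrightarrow> \<exists>\<rho>>0. dep_on S (pd w \<rho>) (s i)"
  shows "fin_rel S w {()} {..<N} (\<lambda>_. s)"
  using assms
proof (induction S arbitrary: s N rule: finite_induct)
  case empty
  obtain \<rho> where \<rho>: "0 < \<rho>" "\<And>i. i < N \<Longrightarrow> dep_on {} (pd w \<rho>) (s i)"
    using common_radius[of N "{}" w s] empty by blast
  show ?case
  proof (cases "\<exists>q<N. s q w \<noteq> 0")
    case True
    then show ?thesis
      using fin_rel_nonzero[of \<rho> N "{}" w s, OF \<rho>] by blast
  next
    case False
    have "s i z = 0" if "i < N" "z \<in> pd w \<rho>" for i z
      using dep_onD[OF \<rho>(2)[OF that(1)] that(2), of w] \<rho>(1) False that(1) by simp
    then show ?thesis by (rule fin_rel_zero[OF \<rho>(1)])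
  qed
next
  case (insert n S)
  obtain \<rho> where \<rho>: "0 < \<rho>" "\<And>i. i < N \<Longrightarrow> dep_on (insert n S) (pd w \<rho>) (s i)"
    using common_radius[of N "insert n S" w s] insert.prems by blast
  consider (nonzero) q where "q < N" "s q w \<noteq> 0" | (zero) "\<And>i z. i < N \<Longrightarrow> z \<in> pd w \<rho> \<Longrightarrow> s i z = 0"
    | (regular) q p where "\<And>i. i < N \<Longrightarrow> s i w = 0" "q < N" "p \<in> pd w \<rho>" "s q p \<noteq> 0"
    by blast
  then show ?case
  proof cases
    case nonzero
    then show ?thesis
      using fin_rel_nonzero[of \<rho> N "insert n S" w s, OF \<rho>] by blast
  next
    case zero
    then show ?thesis by (rule fin_rel_zero[OF \<rho>(1)])
  next
    case regular
    obtain u where u: "u $ n = 0"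
      "\<And>\<rho>'. 0 < \<rho>' \<Longrightarrow> \<exists>x\<in>ball (w $ n) \<rho>'. s q (shear n w u (upd n w x)) \<noteq> 0"
      by (rule exists_regular_shear[OF \<rho>(1) dep_on_hol[OF \<rho>(2)[OF regular(2)]] regular(3,4)]) blast
    obtain \<rho>' where \<rho>': "0 < \<rho>'" "shear n w u ` pd w \<rho>' \<subseteq> pd w \<rho>"
      by (rule shear_pd[OF \<rho>(1)])
    obtain x0 where x0: "x0 \<in> ball (w $ n) \<rho>'" "s q (shear n w u (upd n w x0)) \<noteq> 0"
      using u(2)[OF \<rho>'(1)] by blast
    have "fin_rel (insert n S) w {()} {..<N} (\<lambda>_ i z. s i (shear n w u z))"
    proof (rule oka_step[OF _ _ \<rho>'(1)])
      show "fin_rel (insert n S - {n}) w E {..<M} t"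
        if "finite E" "\<And>e i. e \<in> E \<Longrightarrow> i < M \<Longrightarrow> \<exists>\<rho>>0. dep_on (insert n S - {n}) (pd w \<rho>) (t e i)"
        for M :: nat and E :: "nat set" and t
      proof -
        have S: "insert n S - {n} = S"
          using insert.hyps by auto
        show ?thesis
          unfolding S by (rule fin_rel_vector[where S = S and w = w and E = E and n = M and s = t])
              (use insert.IH that S in auto)
      qed
      show "dep_on (insert n S) (pd w \<rho>') (\<lambda>z. s i (shear n w u z))" if "i < N" for i
        by (rule dep_on_shear[OF \<rho>(2)[OF that] _ \<rho>'(2)]) simp
      show "s q (shear n w u w) = 0"
        using regular(1,2) by (simp add: shear_center)
    qed (use regular x0 in auto)
    then show ?thesis
      by (rule fin_rel_shear[OF insertI1 u(1)])
  qed
qed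

corollary Oka_local:
  fixes s :: "nat \<Rightarrow> complex ^ 'm \<Rightarrow> complex"
  assumes U: "open U" "w \<in> U" and s: "\<And>i. i < n \<Longrightarrow> s i hol_on U"
  obtains \<rho> N G where "0 < \<rho>" "pd w \<rho> \<subseteq> U" "gen_rel UNIV (pd w \<rho>) {()} {..<n} (\<lambda>_. s) {..<N::nat} G"
proof -
  obtain \<rho>1 where \<rho>1: "0 < \<rho>1" "pd w \<rho>1 \<subseteq> U"
    by (rule pd_subset_open[OF U])
  have "dep_on UNIV (pd w \<rho>1) (s i)" if "i < n" for i
    using s[OF that] \<rho>1(2) by (auto simp: dep_on_def hol_on_iff_cdiff vec_eq_iff[symmetric])
  then have "fin_rel UNIV w {()} {..<n} (\<lambda>_. s)"
    using \<rho>1(1) by (intro Oka) auto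
  then obtain \<rho>2 N G where \<rho>2: "0 < \<rho>2" "gen_rel UNIV (pd w \<rho>2) {()} {..<n} (\<lambda>_. s) {..<N::nat} G"
    by (auto simp: fin_rel_def)
  show ?thesis
  proof (rule that)
    show "0 < min \<rho>1 \<rho>2" using \<rho>1 \<rho>2 by simp
    show "pd w (min \<rho>1 \<rho>2) \<subseteq> U" using \<rho>1(2) pd_mono[of "min \<rho>1 \<rho>2" \<rho>1 w] by simp
    show "gen_rel UNIV (pd w (min \<rho>1 \<rho>2)) {()} {..<n} (\<lambda>_. s) {..<N} G"
      by (rule gen_rel_subset[OF \<rho>2(2) pd_mono]) simp
  qed
qed

section \<open>Families of holomorphic functions\<close>

text \<open>The radius and the finite set are chosen before the member \<open>x\<close>: this is the
  uniformity at stake. Members are named by an index set because the induction replaces the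
  functions by remainders, while the generators must remain the same indices. Tuples of length
  \<open>p\<close> occur because one division produces several coefficients.\<close>

definition unif_gen :: "'m set \<Rightarrow> complex ^ 'm \<Rightarrow> 'x set \<Rightarrow> nat \<Rightarrow> ('x \<Rightarrow> nat \<Rightarrow> complex ^ 'm \<Rightarrow> complex) \<Rightarrow> bool" where
  "unif_gen S w X p f \<longleftrightarrow> (\<exists>\<rho>>0. \<exists>B\<subseteq>X. finite B \<and> (\<forall>x\<in>X. \<exists>c. (\<forall>b\<in>B. dep_on S (pd w \<rho>) (c b)) \<and>
     (\<forall>i<p. \<forall>z\<in>pd w \<rho>. f x i z = (\<Sum>b\<in>B. c b z * f b i z))))"

lemma unif_genI:
  assumes "0 < \<rho>" "finite B" "B \<subseteq> X" "\<And>x b. \<lbrakk>x \<in> X; b \<in> B\<rbrakk> \<Longrightarrow> dep_on S (pd w \<rho>) (c x b)"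
    "\<And>x i z. \<lbrakk>x \<in> X; i < p; z \<in> pd w \<rho>\<rbrakk> \<Longrightarrow> f x i z = (\<Sum>b\<in>B. c x b z * f b i z)"
  shows "unif_gen S w X p f"
  unfolding unif_gen_def
proof (intro exI[of _ \<rho>] exI[of _ B] conjI ballI assms(1-3))
  fix x assume x: "x \<in> X"
  show "\<exists>c. (\<forall>b\<in>B. dep_on S (pd w \<rho>) (c b)) \<and> (\<forall>i<p. \<forall>z\<in>pd w \<rho>. f x i z = (\<Sum>b\<in>B. c b z * f b i z))"
    by (intro exI[of _ "c x"] conjI ballI allI impI assms(4,5) x)
qed

lemma unif_genE:
  assumes "unif_gen S w X p f" "0 < \<rho>0"
  obtains \<rho> B c where "0 < \<rho>" "\<rho> \<le> \<rho>0" "finite B" "B \<subseteq> X"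
    "\<And>x b. \<lbrakk>x \<in> X; b \<in> B\<rbrakk> \<Longrightarrow> dep_on S (pd w \<rho>) (c x b)"
    "\<And>x i z. \<lbrakk>x \<in> X; i < p; z \<in> pd w \<rho>\<rbrakk> \<Longrightarrow> f x i z = (\<Sum>b\<in>B. c x b z * f b i z)"
proof -
  obtain \<rho> B where \<rho>: "0 < \<rho>" and B: "finite B" "B \<subseteq> X"
    and ex: "\<forall>x\<in>X. \<exists>c. (\<forall>b\<in>B. dep_on S (pd w \<rho>) (c b)) \<and> (\<forall>i<p. \<forall>z\<in>pd w \<rho>. f x i z = (\<Sum>b\<in>B. c b z * f b i z))"
    using assms(1) unfolding unif_gen_def by blast
  obtain c where c: "\<forall>x\<in>X. (\<forall>b\<in>B. dep_on S (pd w \<rho>) (c x b)) \<and>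
      (\<forall>i<p. \<forall>z\<in>pd w \<rho>. f x i z = (\<Sum>b\<in>B. c x b z * f b i z))"
    using bchoice[OF ex] by blast
  have sub: "pd w (min \<rho> \<rho>0) \<subseteq> pd w \<rho>"
    by (rule pd_mono) simp
  show ?thesis
  proof (rule that[of "min \<rho> \<rho>0" B c])
    show "dep_on S (pd w (min \<rho> \<rho>0)) (c x b)" if "x \<in> X" "b \<in> B" for x b
      using c that by (intro dep_on_subset[OF _ sub]) blast
    show "f x i z = (\<Sum>b\<in>B. c x b z * f b i z)" if "x \<in> X" "i < p" "z \<in> pd w (min \<rho> \<rho>0)" for x i z
      using c that sub by blast
  qed (use \<rho> B assms(2) in simp_all)
qed

text \<open>Merges two expansions whose generating sets may overlap.\<close>

lemma sum_Un_if:
  fixes f :: "'a \<Rightarrow> 'b::semiring_0"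
  assumes "finite B1" "finite B2"
  shows "(\<Sum>b\<in>B1 \<union> B2. ((if b \<in> B1 then \<alpha> b else 0) + (if b \<in> B2 then \<beta> b else 0)) * f b) =
    (\<Sum>b\<in>B1. \<alpha> b * f b) + (\<Sum>b\<in>B2. \<beta> b * f b)"
proof -
  have "(\<Sum>b\<in>B1 \<union> B2. (if b \<in> B1 then \<alpha> b else 0) * f b) = (\<Sum>b\<in>B1. \<alpha> b * f b)"
    by (rule sum.mono_neutral_cong_right) (use assms in auto)
  moreover have "(\<Sum>b\<in>B1 \<union> B2. (if b \<in> B2 then \<beta> b else 0) * f b) = (\<Sum>b\<in>B2. \<beta> b * f b)"
    by (rule sum.mono_neutral_cong_right) (use assms in auto)
  ultimately show ?thesis
    by (simp only: distrib_right sum.distrib)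
qed

text \<open>By induction on the length: generators \<open>B1\<close> for the last component are
  subtracted so as to make that component zero, and the shorter tuples \<open>f'\<close> left over
  have generators \<open>B2\<close>. Each \<open>f' h\<close> is itself \<open>f h\<close> minus a
  combination over \<open>B1\<close>, so \<open>B1 \<union> B2\<close> generates the original
  tuples.\<close>

lemma unif_gen_vector:
  assumes scalar: "\<And>g \<rho>. \<lbrakk>0 < \<rho>; \<And>x. x \<in> X \<Longrightarrow> dep_on S (pd w \<rho>) (g x)\<rbrakk> \<Longrightarrow> unif_gen S w X 1 (\<lambda>x _. g x)"
    and "0 < \<rho>" "\<And>x i. x \<in> X \<Longrightarrow> i < p \<Longrightarrow> dep_on S (pd w \<rho>) (f x i)"
  shows "unif_gen S w X p f"
  using assms(2,3)
proof (induction p arbitrary: f \<rho>)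
  case 0
  then show ?case by (intro unif_genI[where \<rho> = 1 and B = "{}"]) auto
next
  case (Suc p)
  have "unif_gen S w X 1 (\<lambda>x _. f x p)"
    by (rule scalar[OF Suc.prems(1)]) (use Suc.prems(2) in simp)
  then obtain \<rho>1 B1 c1 where \<rho>1: "0 < \<rho>1" "\<rho>1 \<le> \<rho>" and B1: "finite B1" "B1 \<subseteq> X"
    and c1: "\<And>x b. \<lbrakk>x \<in> X; b \<in> B1\<rbrakk> \<Longrightarrow> dep_on S (pd w \<rho>1) (c1 x b)"
    and f1: "\<And>x i z. \<lbrakk>x \<in> X; i < (1::nat); z \<in> pd w \<rho>1\<rbrakk> \<Longrightarrow> f x p z = (\<Sum>b\<in>B1. c1 x b z * f b p z)"
    by (rule unif_genE[OF _ Suc.prems(1)]) (assumption | rule that)+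
  define f' where "f' x i z = f x i z - (\<Sum>b\<in>B1. c1 x b z * f b i z)" for x i z
  have "dep_on S (pd w \<rho>1) (f' x i)" if "x \<in> X" "i < p" for x i
    unfolding f'_def using that B1(2)
    by (intro dep_on_intros c1 dep_on_subset[OF Suc.prems(2) pd_mono[OF \<rho>1(2)]]) auto
  then have "unif_gen S w X p f'"
    by (rule Suc.IH[OF \<rho>1(1)])
  then obtain \<rho>2 B2 c2 where \<rho>2: "0 < \<rho>2" "\<rho>2 \<le> \<rho>1" and B2: "finite B2" "B2 \<subseteq> X"
    and c2: "\<And>x b. \<lbrakk>x \<in> X; b \<in> B2\<rbrakk> \<Longrightarrow> dep_on S (pd w \<rho>2) (c2 x b)"
    and f2: "\<And>x i z. \<lbrakk>x \<in> X; i < p; z \<in> pd w \<rho>2\<rbrakk> \<Longrightarrow> f' x i z = (\<Sum>b\<in>B2. c2 x b z * f' b i z)"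
    by (rule unif_genE[OF _ \<rho>1(1)]) (assumption | rule that)+
  have sub: "pd w \<rho>2 \<subseteq> pd w \<rho>1"
    by (rule pd_mono[OF \<rho>2(2)])
  \<comment> \<open>Collects the coefficient of \<open>f b\<close> after each \<open>f' h\<close>
    has been expanded as \<open>f h\<close> minus its combination over \<open>B1\<close>.\<close>
  define c where "c x b z = (if b \<in> B1 then c1 x b z - (\<Sum>h\<in>B2. c2 x h z * c1 h b z) else 0)
      + (if b \<in> B2 then c2 x b z else 0)" for x b z
  show ?case
  proof (rule unif_genI[OF \<rho>2(1), where B = "B1 \<union> B2" and c = c])
    show "dep_on S (pd w \<rho>2) (c x b)" if "x \<in> X" "b \<in> B1 \<union> B2" for x b
      unfolding c_def using that B2(2) by (intro dep_on_intros c2 dep_on_subset[OF c1 sub]) auto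
    fix x i z assume x: "x \<in> X" and i: "i < Suc p" and z: "z \<in> pd w \<rho>2"
    \<comment> \<open>The component removed by \<open>B1\<close> is zero for every member, so the
      identity obtained for \<open>i < p\<close> extends to \<open>i = p\<close>.\<close>
    have f'p: "f' x p z = 0" if "x \<in> X" for x
      using f1[OF that, of 0 z] z sub by (auto simp: f'_def)
    have "f' x i z = (\<Sum>h\<in>B2. c2 x h z * f' h i z)"
    proof (cases "i = p")
      case True
      have "f' h p z = 0" if "h \<in> B2" for h
        using f'p that B2(2) by blast
      then show ?thesis using True f'p[OF x] by simp
    qed (use f2 x i z in simp)
    then have "f x i z = (\<Sum>b\<in>B1. c1 x b z * f b i z) + (\<Sum>h\<in>B2. c2 x h z * (f h i z - (\<Sum>b\<in>B1. c1 h b z * f b i z)))"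
      unfolding f'_def by (simp add: algebra_simps)
    also have "\<dots> = (\<Sum>b\<in>B1. c1 x b z * f b i z) + (\<Sum>h\<in>B2. c2 x h z * f h i z)
        - (\<Sum>h\<in>B2. \<Sum>b\<in>B1. c2 x h z * (c1 h b z * f b i z))"
      by (simp add: right_diff_distrib sum_subtractf sum_distrib_left)
    also have "(\<Sum>h\<in>B2. \<Sum>b\<in>B1. c2 x h z * (c1 h b z * f b i z)) = (\<Sum>b\<in>B1. (\<Sum>h\<in>B2. c2 x h z * c1 h b z) * f b i z)"
      unfolding sum_distrib_right mult.assoc by (rule sum.swap)
    also have "(\<Sum>b\<in>B1. c1 x b z * f b i z) + (\<Sum>h\<in>B2. c2 x h z * f h i z) - \<dots> = (\<Sum>b\<in>B1 \<union> B2. c x b z * f b i z)"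
      unfolding c_def sum_Un_if[OF B1(1) B2(1)] by (simp add: left_diff_distrib sum_subtractf)
    finally show "f x i z = (\<Sum>b\<in>B1 \<union> B2. c x b z * f b i z)" .
  qed (use B1 B2 in auto)
qed

lemma unif_gen_shear:
  assumes n: "n \<in> S" "u $ n = 0" and ug: "unif_gen S w X p (\<lambda>x i z. f x i (shear n w u z))"
  shows "unif_gen S w X p f"
proof -
  obtain \<rho> B c where \<rho>: "0 < \<rho>" "\<rho> \<le> 1" and B: "finite B" "B \<subseteq> X"
    and c: "\<And>x b. \<lbrakk>x \<in> X; b \<in> B\<rbrakk> \<Longrightarrow> dep_on S (pd w \<rho>) (c x b)"
    and f: "\<And>x i z. \<lbrakk>x \<in> X; i < p; z \<in> pd w \<rho>\<rbrakk> \<Longrightarrow>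
      f x i (shear n w u z) = (\<Sum>b\<in>B. c x b z * f b i (shear n w u z))"
    by (rule unif_genE[OF ug zero_less_one]) (assumption | rule that)+
  obtain \<rho>' where \<rho>': "0 < \<rho>'" "shear n w (- u) ` pd w \<rho>' \<subseteq> pd w \<rho>"
    by (rule shear_pd[OF \<rho>(1)])
  show ?thesis
  proof (rule unif_genI[OF \<rho>'(1) B, where c = "\<lambda>x b z. c x b (shear n w (- u) z)"])
    show "dep_on S (pd w \<rho>') (\<lambda>z. c x b (shear n w (- u) z))" if "x \<in> X" "b \<in> B" for x b
      by (rule dep_on_shear[OF c[OF that] n(1) \<rho>'(2)])
    show "f x i z = (\<Sum>b\<in>B. c x b (shear n w (- u) z) * f b i z)" if "x \<in> X" "i < p" "z \<in> pd w \<rho>'" for x i z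
      using f[OF that(1,2), of "shear n w (- u) z"] that(3) \<rho>'(2) shear_shear[OF n(2)] by force
  qed
qed

lemma unif_gen_nonzero:
  assumes \<rho>: "0 < \<rho>" and f: "\<And>x. x \<in> X \<Longrightarrow> dep_on S (pd w \<rho>) (f x)" and x0: "x0 \<in> X" "f x0 w \<noteq> 0"
  shows "unif_gen S w X 1 (\<lambda>x _. f x)"
proof -
  obtain \<rho>2 where \<rho>2: "0 < \<rho>2" "pd w \<rho>2 \<subseteq> pd w \<rho>" "\<And>z. z \<in> pd w \<rho>2 \<Longrightarrow> f x0 z \<noteq> 0"
    by (rule dep_on_nonzero_near[OF \<rho> f[OF x0(1)] x0(2)]) (assumption | rule that)+
  show ?thesis
    by (rule unif_genI[OF \<rho>2(1), where B = "{x0}" and c = "\<lambda>x _ z. f x z * inverse (f x0 z)"])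
      (use x0(1) \<rho>2(3) in \<open>auto intro!: dep_on_mult dep_on_inverse dep_on_subset[OF f \<rho>2(2)]\<close>)
qed

text \<open>All members of the family are divided on one polydisc by the same \<open>W = Q f\<^bsub>x0\<^esub>\<close>; the induction hypothesis
  for the tuples of remainder coefficients then yields the new generators up to a multiple of \<open>f\<^bsub>x0\<^esub>\<close>.\<close>

lemma unif_gen_step:
  assumes n: "n \<in> S"
    and IH: "\<And>p g \<rho>. \<lbrakk>0 < \<rho>; \<And>x i. x \<in> X \<Longrightarrow> i < p \<Longrightarrow> dep_on (S - {n}) (pd w \<rho>) (g x i)\<rbrakk>
      \<Longrightarrow> unif_gen (S - {n}) w X p g"
    and \<rho>: "0 < \<rho>" and f: "\<And>x. x \<in> X \<Longrightarrow> dep_on S (pd w \<rho>) (f x)"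
    and x0: "x0 \<in> X" "f x0 w = 0" "v \<in> ball (w $ n) \<rho>" "f x0 (upd n w v) \<noteq> 0"
  shows "unif_gen S w X 1 (\<lambda>x _. f x)"
proof -
  define c where "c = w $ n"
  obtain \<rho>1 b A Q r \<epsilon> where \<rho>1: "0 < \<rho>1" "\<rho>1 \<le> \<rho>"
    and A: "\<And>l. l \<le> b \<Longrightarrow> dep_on (S - {n}) (pd w \<rho>1) (A l)"
    and Q: "dep_on S (pd w \<rho>1) Q"
    and QA: "\<And>z. z \<in> pd w \<rho>1 \<Longrightarrow> (\<Sum>l\<le>b. A l z * (z $ n - c) ^ l) = Q z * f x0 z"
    and "division_at n c w r \<epsilon> \<rho>1 b A"
    by (rule regular_division[OF \<rho> f[OF x0(1)] n x0(2-4), folded c_def]) (assumption | rule that)+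
  interpret D: division_at n c w r \<epsilon> \<rho>1 b A by fact
  have f1: "dep_on S (pd w \<rho>1) (f x)" if "x \<in> X" for x
    by (rule dep_on_subset[OF f[OF that] pd_mono[OF \<rho>1(2)]])
  have "unif_gen (S - {n}) w X b (\<lambda>x. D.rem (f x) A)"
    by (rule IH[of \<epsilon>]) (use D.eps f1 A in \<open>auto intro: D.dep_on_rem\<close>)
  then obtain \<rho>2 B d where \<rho>2: "0 < \<rho>2" "\<rho>2 \<le> \<epsilon>" and B: "finite B" "B \<subseteq> X"
    and d: "\<And>x h. \<lbrakk>x \<in> X; h \<in> B\<rbrakk> \<Longrightarrow> dep_on (S - {n}) (pd w \<rho>2) (d x h)"
    and dr: "\<And>x k z. \<lbrakk>x \<in> X; k < b; z \<in> pd w \<rho>2\<rbrakk> \<Longrightarrow> D.rem (f x) A k z = (\<Sum>h\<in>B. d x h z * D.rem (f h) A k z)"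
    by (rule unif_genE[OF _ D.eps(1)]) (assumption | rule that)+
  have sub: "pd w \<rho>2 \<subseteq> pd w \<epsilon>" "pd w \<rho>2 \<subseteq> pd w \<rho>1"
    using pd_mono[OF \<rho>2(2), of w] D.sub by auto
  define t where "t x = D.quo (f x)" for x
  have t: "dep_on S (pd w \<rho>2) (t x)" if "x \<in> X" for x
    unfolding t_def by (rule dep_on_subset[OF D.dep_on_quo[OF f1[OF that] n A] sub(1)])
  \<comment> \<open>Substituting the remainders leaves \<open>f x\<close> equal to the combination
    of the \<open>f h\<close> with coefficients \<open>d\<close> plus
    \<open>(t x - (sum of d h * t h)) * W\<close>, and \<open>W = Q * f x0\<close> makes the last
    term a multiple of \<open>f x0\<close>. The two conditionals are added because \<open>x0\<close>
    may itself lie in \<open>B\<close>.\<close>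
  define e where "e x h z = (if h \<in> B then d x h z else 0) +
      (if h \<in> {x0} then (t x z - (\<Sum>h\<in>B. d x h z * t h z)) * Q z else 0)" for x h z
  show ?thesis
  proof (rule unif_genI[OF \<rho>2(1), where B = "B \<union> {x0}" and c = e])
    show "dep_on S (pd w \<rho>2) (e x h)" if "x \<in> X" "h \<in> B \<union> {x0}" for x h
      unfolding e_def using that B(2)
      by (intro dep_on_intros t dep_on_subset[OF Q sub(2)] dep_on_mono[OF d Diff_subset]) auto
    fix x i z assume x: "x \<in> X" and "i < (1::nat)" and z: "z \<in> pd w \<rho>2"
    define W where "W = (\<Sum>l\<le>b. A l z * (z $ n - c) ^ l)"
    have W: "W = Q z * f x0 z"
      using QA z sub(2) unfolding W_def by blast
    have div: "f h z = (\<Sum>k<b. D.rem (f h) A k z * (z $ n - c) ^ k) + t h z * W" if "h \<in> X" for h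
      using D.division[OF dep_on_hol[OF f1[OF that]]] z sub(1) unfolding t_def W_def by blast
    have "(\<Sum>k<b. D.rem (f x) A k z * (z $ n - c) ^ k) = (\<Sum>k<b. (\<Sum>h\<in>B. d x h z * D.rem (f h) A k z) * (z $ n - c) ^ k)"
      using dr[OF x _ z] by simp
    also have "\<dots> = (\<Sum>h\<in>B. d x h z * (\<Sum>k<b. D.rem (f h) A k z * (z $ n - c) ^ k))"
      unfolding sum_distrib_left sum_distrib_right mult.assoc by (rule sum.swap)
    also have "\<dots> = (\<Sum>h\<in>B. d x h z * (f h z - t h z * W))"
      using div B(2) by (intro sum.cong) auto
    finally have "f x z = (\<Sum>h\<in>B. d x h z * (f h z - t h z * W)) + t x z * W"
      using div[OF x] by simp
    also have "\<dots> = (\<Sum>h\<in>B. d x h z * f h z) + (t x z - (\<Sum>h\<in>B. d x h z * t h z)) * W"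
      by (simp add: algebra_simps sum_subtractf sum_distrib_left)
    also have "\<dots> = (\<Sum>h\<in>B \<union> {x0}. e x h z * f h z)"
      unfolding e_def sum_Un_if[OF B(1) finite.intros(2)[OF finite.intros(1)]] by (simp add: W)
    finally show "f x z = (\<Sum>h\<in>B \<union> {x0}. e x h z * f h z)" .
  qed (use B x0 in auto)
qed

text \<open>The case distinction is that of \<open>Oka\<close>: a member nonzero at \<open>w\<close>
  generates alone, a family that vanishes identically has the empty set as generators, and otherwise
  a shear prepares one member for \<open>unif_gen_step\<close>.\<close>

theorem unif_gen_scalar:
  assumes "finite S" "0 < \<rho>" "\<And>x. x \<in> X \<Longrightarrow> dep_on S (pd w \<rho>) (f x)"
  shows "unif_gen S w X 1 (\<lambda>x _. f x)"
  using assms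
proof (induction S arbitrary: f \<rho> rule: finite_induct)
  case (insert n S)
  consider (nonzero) x where "x \<in> X" "f x w \<noteq> 0" | (zero) "\<And>x z. x \<in> X \<Longrightarrow> z \<in> pd w \<rho> \<Longrightarrow> f x z = 0"
    | (regular) x p where "x \<in> X" "f x w = 0" "p \<in> pd w \<rho>" "f x p \<noteq> 0"
    by blast
  then show ?case
  proof cases
    case nonzero
    then show ?thesis
      using unif_gen_nonzero[of \<rho> X "insert n S" w f] insert.prems by blast
  next
    case zero
    then show ?thesis
      by (intro unif_genI[OF insert.prems(1), where B = "{}"]) auto
  next
    case regular
    obtain u where u: "u $ n = 0"
      "\<And>\<rho>'. 0 < \<rho>' \<Longrightarrow> \<exists>v\<in>ball (w $ n) \<rho>'. f x (shear n w u (upd n w v)) \<noteq> 0"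
      by (rule exists_regular_shear[OF insert.prems(1) dep_on_hol[OF insert.prems(2)[OF regular(1)]] regular(3,4)]) blast
    obtain \<rho>' where \<rho>': "0 < \<rho>'" "shear n w u ` pd w \<rho>' \<subseteq> pd w \<rho>"
      by (rule shear_pd[OF insert.prems(1)])
    obtain v where v: "v \<in> ball (w $ n) \<rho>'" "f x (shear n w u (upd n w v)) \<noteq> 0"
      using u(2)[OF \<rho>'(1)] by blast
    have S: "insert n S - {n} = S"
      using insert.hyps by auto
    have "unif_gen (insert n S) w X 1 (\<lambda>x _ z. f x (shear n w u z))"
    proof (rule unif_gen_step[OF insertI1 _ \<rho>'(1)])
      show "unif_gen (insert n S - {n}) w X p g"
        if "0 < \<rho>" "\<And>x i. x \<in> X \<Longrightarrow> i < p \<Longrightarrow> dep_on (insert n S - {n}) (pd w \<rho>) (g x i)" for p g \<rho>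
        unfolding S by (rule unif_gen_vector[where \<rho> = \<rho>]) (use insert.IH that S in auto)
      show "dep_on (insert n S) (pd w \<rho>') (\<lambda>z. f x (shear n w u z))" if "x \<in> X" for x
        by (rule dep_on_shear[OF insert.prems(2)[OF that] insertI1 \<rho>'(2)])
      show "f x (shear n w u w) = 0"
        using regular(2) by (simp add: shear_center)
    qed (use regular v in auto)
    then show ?thesis
      by (rule unif_gen_shear[OF insertI1 u(1)])
  qed
next
  case empty
  show ?case
  proof (cases "\<exists>x\<in>X. f x w \<noteq> 0")
    case True
    then show ?thesis
      using unif_gen_nonzero[of \<rho> X "{}" w f] empty by blast
  next
    case False
    have "f x z = 0" if "x \<in> X" "z \<in> pd w \<rho>" for x z
      using dep_onD[OF empty(2)[OF that(1)] that(2), of w] empty(1) False that(1) by simp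
    then show ?thesis
      by (intro unif_genI[OF empty(1), where B = "{}"]) auto
  qed
qed

corollary finite_generators:
  fixes M :: "(complex ^ 'm \<Rightarrow> complex) set"
  assumes U: "open U" "w \<in> U" and M: "\<And>f. f \<in> M \<Longrightarrow> f hol_on U"
  obtains \<rho> B c where "0 < \<rho>" "pd w \<rho> \<subseteq> U" "finite B" "B \<subseteq> M"
    "\<And>f b. \<lbrakk>f \<in> M; b \<in> B\<rbrakk> \<Longrightarrow> c f b hol_on pd w \<rho>"
    "\<And>f z. \<lbrakk>f \<in> M; z \<in> pd w \<rho>\<rbrakk> \<Longrightarrow> f z = (\<Sum>b\<in>B. c f b z * b z)"
proof -
  obtain \<rho>1 where \<rho>1: "0 < \<rho>1" "pd w \<rho>1 \<subseteq> U"
    by (rule pd_subset_open[OF U])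
  have "dep_on UNIV (pd w \<rho>1) f" if "f \<in> M" for f
    using M[OF that] \<rho>1(2) by (auto simp: dep_on_def hol_on_iff_cdiff vec_eq_iff[symmetric])
  then have "unif_gen UNIV w M 1 (\<lambda>f _. f)"
    by (intro unif_gen_scalar[OF _ \<rho>1(1)]) auto
  then obtain \<rho> B c where \<rho>: "0 < \<rho>" "\<rho> \<le> \<rho>1" and B: "finite B" "B \<subseteq> M"
    and c: "\<And>f b. \<lbrakk>f \<in> M; b \<in> B\<rbrakk> \<Longrightarrow> dep_on UNIV (pd w \<rho>) (c f b)"
    and f: "\<And>f i z. \<lbrakk>f \<in> M; i < (1::nat); z \<in> pd w \<rho>\<rbrakk> \<Longrightarrow> f z = (\<Sum>b\<in>B. c f b z * b z)"
    by (rule unif_genE[OF _ \<rho>1(1)]) (assumption | rule that)+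
  show ?thesis
  proof (rule that[OF \<rho>(1) _ B])
    show "pd w \<rho> \<subseteq> U"
      using pd_mono[OF \<rho>(2), of w] \<rho>1(2) by blast
    show "c f b hol_on pd w \<rho>" if "f \<in> M" "b \<in> B" for f b
      by (rule dep_on_hol[OF c[OF that]])
    show "f z = (\<Sum>b\<in>B. c f b z * b z)" if "f \<in> M" "z \<in> pd w \<rho>" for f z
      by (rule f[OF that(1) _ that(2), of 0]) simp
  qed
qed

section \<open>The sheaf generated by a set of holomorphic functions\<close>

lemma mem_hol_ring: "f \<in> carrier (hol_ring U) \<longleftrightarrow> f hol_on U \<and> zero_outside U f"
  by (simp add: hol_ring_def)

lemma hol_ring_simps:
  "f \<otimes>\<^bsub>hol_ring U\<^esub> g = (\<lambda>z. f z * g z)" "f \<oplus>\<^bsub>hol_ring U\<^esub> g = (\<lambda>z. f z + g z)"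
  "\<zero>\<^bsub>hol_ring U\<^esub> = (\<lambda>_. 0)" "\<one>\<^bsub>hol_ring U\<^esub> = restr U (\<lambda>_. 1)"
  by (simp_all add: hol_ring_def)

lemma eventually_restr: "\<lbrakk>open V; w \<in> V\<rbrakk> \<Longrightarrow> \<forall>\<^sub>F z in nhds w. restr V f z = f z"
  by (rule eventually_mono[OF eventually_nhds_in_open[of V w]]) (auto simp: restr_def)

lemma cdiff_restr: "\<lbrakk>cdiff f z; open V; z \<in> V\<rbrakk> \<Longrightarrow> cdiff (restr V f) z"
  by (rule cdiff_cong[OF _ eventually_restr])

lemma restr_in_hol_ring: "\<lbrakk>f hol_on V; open V\<rbrakk> \<Longrightarrow> restr V f \<in> carrier (hol_ring V)"
  by (auto simp: mem_hol_ring hol_on_iff_cdiff zero_outside_def intro: cdiff_restr) (simp add: restr_def)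

lemma hol_ring_add: "\<lbrakk>f \<in> carrier (hol_ring U); g \<in> carrier (hol_ring U)\<rbrakk> \<Longrightarrow> (\<lambda>z. f z + g z) \<in> carrier (hol_ring U)"
  by (auto simp: mem_hol_ring hol_on_iff_cdiff zero_outside_def intro: cdiff_add)

lemma hol_ring_mult: "\<lbrakk>f \<in> carrier (hol_ring U); g \<in> carrier (hol_ring U)\<rbrakk> \<Longrightarrow> (\<lambda>z. f z * g z) \<in> carrier (hol_ring U)"
  by (auto simp: mem_hol_ring hol_on_iff_cdiff zero_outside_def intro: cdiff_mult)

lemma hol_ring_uminus: "f \<in> carrier (hol_ring U) \<Longrightarrow> (\<lambda>z. - f z) \<in> carrier (hol_ring U)"
  by (auto simp: mem_hol_ring hol_on_iff_cdiff zero_outside_def intro: cdiff_uminus)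

lemma hol_ring_zero: "(\<lambda>_. 0) \<in> carrier (hol_ring U)"
  by (auto simp: mem_hol_ring hol_on_iff_cdiff zero_outside_def intro: cdiff_const)

lemma restr_one_mult: "f \<in> carrier (hol_ring U) \<Longrightarrow> (\<lambda>z. restr U (\<lambda>_. 1) z * f z) = f"
  by (auto simp: mem_hol_ring zero_outside_def restr_def)

lemma cring_hol_ring:
  assumes "open U"
  shows "cring (hol_ring U)"
proof (rule cringI)
  show "abelian_group (hol_ring U)"
  proof (rule abelian_groupI)
    show "\<exists>g\<in>carrier (hol_ring U). g \<oplus>\<^bsub>hol_ring U\<^esub> f = \<zero>\<^bsub>hol_ring U\<^esub>" if "f \<in> carrier (hol_ring U)" for f
      by (rule bexI[OF _ hol_ring_uminus[OF that]]) (simp add: hol_ring_simps)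
  qed (auto simp: hol_ring_simps add_ac intro: hol_ring_add hol_ring_zero)
  show "Group.comm_monoid (hol_ring U)"
  proof (rule comm_monoidI)
    show "\<one>\<^bsub>hol_ring U\<^esub> \<in> carrier (hol_ring U)"
      unfolding hol_ring_simps
      by (rule restr_in_hol_ring[OF _ assms]) (simp add: hol_on_iff_cdiff cdiff_const)
  qed (auto simp: hol_ring_simps mult_ac hol_ring_mult restr_one_mult[unfolded mult.commute[of "restr _ _ _"]] restr_one_mult)
qed (auto simp: hol_ring_simps distrib_right)

subsection \<open>Stalks\<close>

lemma germ_eq_iff: "germ w f = germ w g \<longleftrightarrow> (\<forall>\<^sub>F z in nhds w. f z = g z)"
proof
  assume "germ w f = germ w g"
  moreover have "f \<in> germ w f" by (simp add: germ_def)
  ultimately show "\<forall>\<^sub>F z in nhds w. f z = g z" by (simp add: germ_def)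
next
  assume *: "\<forall>\<^sub>F z in nhds w. f z = g z"
  show "germ w f = germ w g"
    unfolding germ_def
  proof (intro Collect_cong iffI)
    show "\<forall>\<^sub>F z in nhds w. h z = g z" if "\<forall>\<^sub>F z in nhds w. h z = f z" for h
      using that * by eventually_elim simp
    show "\<forall>\<^sub>F z in nhds w. h z = f z" if "\<forall>\<^sub>F z in nhds w. h z = g z" for h
      using that * by eventually_elim simp
  qed
qed

lemma carrier_hol_stalk: "A \<in> carrier (hol_stalk w) \<longleftrightarrow> (\<exists>f. hol_near w f \<and> A = germ w f)"
  unfolding hol_stalk_def hol_near_def hol_on_iff_cdiff eventually_nhds by auto

lemma germ_in_hol_stalk: "hol_near w f \<Longrightarrow> germ w f \<in> carrier (hol_stalk w)"
  by (auto simp: carrier_hol_stalk)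

lemma germ_binop:
  "{h. \<exists>f'\<in>germ w f. \<exists>g'\<in>germ w g. \<forall>\<^sub>F z in nhds w. h z = F (f' z) (g' z)} = germ w (\<lambda>z. F (f z) (g z))"
proof (intro equalityI subsetI)
  fix h assume "h \<in> {h. \<exists>f'\<in>germ w f. \<exists>g'\<in>germ w g. \<forall>\<^sub>F z in nhds w. h z = F (f' z) (g' z)}"
  then obtain f' g' where "\<forall>\<^sub>F z in nhds w. f' z = f z" "\<forall>\<^sub>F z in nhds w. g' z = g z"
    "\<forall>\<^sub>F z in nhds w. h z = F (f' z) (g' z)"
    by (auto simp: germ_def)
  then have "\<forall>\<^sub>F z in nhds w. h z = F (f z) (g z)"
    by eventually_elim simp
  then show "h \<in> germ w (\<lambda>z. F (f z) (g z))"
    by (simp add: germ_def)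
next
  fix h assume "h \<in> germ w (\<lambda>z. F (f z) (g z))"
  then show "h \<in> {h. \<exists>f'\<in>germ w f. \<exists>g'\<in>germ w g. \<forall>\<^sub>F z in nhds w. h z = F (f' z) (g' z)}"
    by (intro CollectI bexI[of _ f] bexI[of _ g]) (simp_all add: germ_def)
qed

lemma hol_stalk_simps:
  "germ w f \<otimes>\<^bsub>hol_stalk w\<^esub> germ w g = germ w (\<lambda>z. f z * g z)"
  "germ w f \<oplus>\<^bsub>hol_stalk w\<^esub> germ w g = germ w (\<lambda>z. f z + g z)"
  "\<zero>\<^bsub>hol_stalk w\<^esub> = germ w (\<lambda>_. 0)"
  using germ_binop[of w f g "(*)"] germ_binop[of w f g "(+)"] by (simp_all add: hol_stalk_def)

lemma abelian_monoid_hol_stalk: "abelian_monoid (hol_stalk w)"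
proof (rule abelian_monoidI)
  fix A B assume "A \<in> carrier (hol_stalk w)" "B \<in> carrier (hol_stalk w)"
  then obtain f g where "hol_near w f" "A = germ w f" "hol_near w g" "B = germ w g"
    by (auto simp: carrier_hol_stalk)
  then show "A \<oplus>\<^bsub>hol_stalk w\<^esub> B \<in> carrier (hol_stalk w)"
    by (simp add: hol_stalk_simps germ_in_hol_stalk hol_near_add)
next
  show "\<zero>\<^bsub>hol_stalk w\<^esub> \<in> carrier (hol_stalk w)"
    by (simp add: hol_stalk_simps germ_in_hol_stalk hol_near_const)
qed (auto simp: carrier_hol_stalk hol_stalk_simps add_ac)

lemma finsum_hol_stalk:
  "(\<And>i. i < n \<Longrightarrow> hol_near w (f i)) \<Longrightarrow>
    (\<Oplus>\<^bsub>hol_stalk w\<^esub>i\<in>{..<n::nat}. germ w (f i)) = germ w (\<lambda>z. \<Sum>i<n. f i z)"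
proof (induction n)
  case 0
  then show ?case
    by (simp add: abelian_monoid.finsum_empty[OF abelian_monoid_hol_stalk] hol_stalk_simps)
next
  case (Suc n)
  have "(\<lambda>i. germ w (f i)) \<in> {..<n} \<rightarrow> carrier (hol_stalk w)" "germ w (f n) \<in> carrier (hol_stalk w)"
    using Suc.prems by (auto intro: germ_in_hol_stalk)
  then show ?case
    using Suc by (simp add: lessThan_Suc abelian_monoid.finsum_insert[OF abelian_monoid_hol_stalk]
        hol_stalk_simps add.commute)
qed

text \<open>Membership of a germ in the generated stalk, expressed with representatives; sums in the
  ring of germs become pointwise sums.\<close>

definition locally_gen :: "(complex ^ 'm \<Rightarrow> complex) set \<Rightarrow> complex ^ 'm \<Rightarrow> (complex ^ 'm \<Rightarrow> complex) \<Rightarrow> bool" where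
  "locally_gen M w f \<longleftrightarrow> (\<exists>(n::nat) g h. (\<forall>i<n. g i \<in> M \<and> hol_near w (h i)) \<and>
     (\<forall>\<^sub>F z in nhds w. f z = (\<Sum>i<n. g i z * h i z)))"

lemma locally_genI:
  fixes n :: nat
  assumes "\<And>i. i < n \<Longrightarrow> g i \<in> M" "\<And>i. i < n \<Longrightarrow> hol_near w (h i)"
    "\<forall>\<^sub>F z in nhds w. f z = (\<Sum>i<n. g i z * h i z)"
  shows "locally_gen M w f"
  unfolding locally_gen_def using assms by (intro exI[of _ n] exI[of _ g] exI[of _ h]) simp

lemma locally_genE:
  assumes "locally_gen M w f"
  obtains n :: nat and g h where "\<And>i. i < n \<Longrightarrow> g i \<in> M" "\<And>i. i < n \<Longrightarrow> hol_near w (h i)"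
    "\<forall>\<^sub>F z in nhds w. f z = (\<Sum>i<n. g i z * h i z)"
  using assms unfolding locally_gen_def by (elim exE conjE) (rule that, simp_all)

lemma germ_in_generated_stalk:
  assumes M: "\<And>g. g \<in> M \<Longrightarrow> hol_near w g"
  shows "germ w f \<in> generated_stalk M w \<longleftrightarrow> locally_gen M w f"
proof
  assume "germ w f \<in> generated_stalk M w"
  then obtain n :: nat and g H where f: "germ w f = (\<Oplus>\<^bsub>hol_stalk w\<^esub>i\<in>{..<n}. germ w (g i) \<otimes>\<^bsub>hol_stalk w\<^esub> H i)"
    and gH: "\<forall>i<n. g i \<in> M \<and> H i \<in> carrier (hol_stalk w)"
    by (auto simp: generated_stalk_def)
  then have "\<forall>i\<in>{..<n}. \<exists>h. hol_near w h \<and> H i = germ w h"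
    by (auto simp: carrier_hol_stalk)
  then obtain h where h: "\<forall>i\<in>{..<n}. hol_near w (h i) \<and> H i = germ w (h i)"
    by (rule bchoice[THEN exE])
  have "(\<Oplus>\<^bsub>hol_stalk w\<^esub>i\<in>{..<n}. germ w (g i) \<otimes>\<^bsub>hol_stalk w\<^esub> H i) =
      (\<Oplus>\<^bsub>hol_stalk w\<^esub>i\<in>{..<n}. germ w (\<lambda>z. g i z * h i z))"
    using gH h M by (intro abelian_monoid.finsum_cong'[OF abelian_monoid_hol_stalk])
      (auto simp: hol_stalk_simps intro!: germ_in_hol_stalk hol_near_mult)
  also have "\<dots> = germ w (\<lambda>z. \<Sum>i<n. g i z * h i z)"
    using gH h M by (intro finsum_hol_stalk hol_near_mult) auto
  finally have "\<forall>\<^sub>F z in nhds w. f z = (\<Sum>i<n. g i z * h i z)"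
    using f by (simp add: germ_eq_iff)
  then show "locally_gen M w f"
    using gH h by (intro locally_genI[of n g M w h f]) auto
next
  assume "locally_gen M w f"
  then obtain n :: nat and g h where gh: "\<And>i. i < n \<Longrightarrow> g i \<in> M" "\<And>i. i < n \<Longrightarrow> hol_near w (h i)"
    and f: "\<forall>\<^sub>F z in nhds w. f z = (\<Sum>i<n. g i z * h i z)"
    by (rule locally_genE) (assumption | rule that)+
  have "germ w f = germ w (\<lambda>z. \<Sum>i<n. g i z * h i z)"
    using f by (simp add: germ_eq_iff)
  also have "\<dots> = (\<Oplus>\<^bsub>hol_stalk w\<^esub>i\<in>{..<n}. germ w (g i) \<otimes>\<^bsub>hol_stalk w\<^esub> germ w (h i))"
    unfolding hol_stalk_simps
    using gh M by (intro finsum_hol_stalk[symmetric] hol_near_mult) auto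
  finally have "germ w f = (\<Oplus>\<^bsub>hol_stalk w\<^esub>i\<in>{..<n}. germ w (g i) \<otimes>\<^bsub>hol_stalk w\<^esub> germ w (h i))" .
  then show "germ w f \<in> generated_stalk M w"
    unfolding generated_stalk_def
    by (intro CollectI exI[of _ n] exI[of _ g] exI[of _ "\<lambda>i. germ w (h i)"]) (auto intro: gh germ_in_hol_stalk)
qed

lemma locally_gen_cong:
  assumes "locally_gen M w f" "\<forall>\<^sub>F z in nhds w. g z = f z"
  shows "locally_gen M w g"
proof -
  obtain n :: nat and k h where kh: "\<And>i. i < n \<Longrightarrow> k i \<in> M" "\<And>i. i < n \<Longrightarrow> hol_near w (h i)"
    and f: "\<forall>\<^sub>F z in nhds w. f z = (\<Sum>i<n. k i z * h i z)"
    using assms(1) by (rule locally_genE) (assumption | rule that)+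
  from f assms(2) have "\<forall>\<^sub>F z in nhds w. g z = (\<Sum>i<n. k i z * h i z)"
    by eventually_elim simp
  with kh show ?thesis by (rule locally_genI)
qed

lemma locally_gen_zero: "locally_gen M w (\<lambda>_. 0)"
  by (rule locally_genI[of 0]) simp_all

lemma locally_gen_member: "f \<in> M \<Longrightarrow> locally_gen M w f"
  by (rule locally_genI[of 1 "\<lambda>_. f" M w "\<lambda>_ _. 1"]) (simp_all add: hol_near_const)

lemma locally_gen_mult:
  assumes "locally_gen M w f" "hol_near w a"
  shows "locally_gen M w (\<lambda>z. a z * f z)"
proof -
  obtain n :: nat and g h where gh: "\<And>i. i < n \<Longrightarrow> g i \<in> M" "\<And>i. i < n \<Longrightarrow> hol_near w (h i)"
    and f: "\<forall>\<^sub>F z in nhds w. f z = (\<Sum>i<n. g i z * h i z)"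
    using assms(1) by (rule locally_genE) (assumption | rule that)+
  from f have "\<forall>\<^sub>F z in nhds w. a z * f z = (\<Sum>i<n. g i z * (a z * h i z))"
    by eventually_elim (simp add: sum_distrib_left mult_ac)
  with gh show ?thesis
    by (intro locally_genI[of n g M w "\<lambda>i z. a z * h i z"] hol_near_mult assms(2))
qed

lemma locally_gen_add:
  assumes "locally_gen M w f" "locally_gen M w f'"
  shows "locally_gen M w (\<lambda>z. f z + f' z)"
proof -
  obtain n :: nat and g h where gh: "\<And>i. i < n \<Longrightarrow> g i \<in> M" "\<And>i. i < n \<Longrightarrow> hol_near w (h i)"
    and f: "\<forall>\<^sub>F z in nhds w. f z = (\<Sum>i<n. g i z * h i z)"
    using assms(1) by (rule locally_genE) (assumption | rule that)+
  obtain n' :: nat and g' h' where gh': "\<And>i. i < n' \<Longrightarrow> g' i \<in> M" "\<And>i. i < n' \<Longrightarrow> hol_near w (h' i)"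
    and f': "\<forall>\<^sub>F z in nhds w. f' z = (\<Sum>i<n'. g' i z * h' i z)"
    using assms(2) by (rule locally_genE) (assumption | rule that)+
  define G H where "G i = (if i < n then g i else g' (i - n))" and "H i = (if i < n then h i else h' (i - n))" for i
  have GH: "(\<Sum>i<n+k. G i z * H i z) = (\<Sum>i<n. g i z * h i z) + (\<Sum>i<k. g' i z * h' i z)" for k z
    by (induction k) (simp_all add: G_def H_def add.assoc)
  from f f' have "\<forall>\<^sub>F z in nhds w. f z + f' z = (\<Sum>i<n+n'. G i z * H i z)"
    by eventually_elim (simp add: GH)
  then show ?thesis
    using gh gh' by (intro locally_genI[of "n + n'" G M w H]) (auto simp: G_def H_def)
qed

subsection \<open>The sheaf axioms\<close>

locale hol_family =
  fixes \<Omega> :: "(complex ^ 'm::finite) set" and M :: "(complex ^ 'm \<Rightarrow> complex) set"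
  assumes open_domain: "open \<Omega>" and holomorphic_members: "\<And>f. f \<in> M \<Longrightarrow> f hol_on \<Omega>"
begin

lemma carrier_generated_sheaf:
  assumes "U \<subseteq> \<Omega>"
  shows "f \<in> carrier (generated_sheaf M U) \<longleftrightarrow> f \<in> carrier (hol_ring U) \<and> (\<forall>w\<in>U. locally_gen M w f)"
proof -
  have "germ w f \<in> generated_stalk M w \<longleftrightarrow> locally_gen M w f" if "w \<in> U" for w
    by (rule germ_in_generated_stalk) (use that assms open_domain holomorphic_members hol_on_hol_near in blast)
  then show ?thesis
    by (simp add: generated_sheaf_def)
qed

lemma generated_sheaf_simps:
  "f \<oplus>\<^bsub>generated_sheaf M U\<^esub> g = (\<lambda>z. f z + g z)" "a \<odot>\<^bsub>generated_sheaf M U\<^esub> f = (\<lambda>z. a z * f z)"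
  "\<zero>\<^bsub>generated_sheaf M U\<^esub> = (\<lambda>_. 0)"
  by (simp_all add: generated_sheaf_def hol_ring_simps)

lemma hol_near_hol_ring: "\<lbrakk>f \<in> carrier (hol_ring U); open U; w \<in> U\<rbrakk> \<Longrightarrow> hol_near w f"
  by (rule hol_on_hol_near) (simp_all add: mem_hol_ring)

lemma generated_sheaf_smult:
  assumes "U \<subseteq> \<Omega>" "open U" "a \<in> carrier (hol_ring U)" "f \<in> carrier (generated_sheaf M U)"
  shows "(\<lambda>z. a z * f z) \<in> carrier (generated_sheaf M U)"
  using assms by (auto simp: carrier_generated_sheaf intro!: hol_ring_mult locally_gen_mult hol_near_hol_ring)

lemma generated_sheaf_abelian_group:
  assumes U: "U \<subseteq> \<Omega>"
  shows "abelian_group (generated_sheaf M U)"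
proof (rule abelian_groupI)
  fix f assume f: "f \<in> carrier (generated_sheaf M U)"
  have "locally_gen M w (\<lambda>z. - f z)" if "w \<in> U" for w
    using locally_gen_mult[of M w f "\<lambda>_. -1"] f that by (simp add: carrier_generated_sheaf[OF U] hol_near_const)
  then have "(\<lambda>z. - f z) \<in> carrier (generated_sheaf M U)"
    using f by (simp add: carrier_generated_sheaf[OF U] hol_ring_uminus)
  then show "\<exists>g\<in>carrier (generated_sheaf M U). g \<oplus>\<^bsub>generated_sheaf M U\<^esub> f = \<zero>\<^bsub>generated_sheaf M U\<^esub>"
    by (rule bexI[rotated]) (simp add: generated_sheaf_simps)
qed (auto simp: generated_sheaf_simps carrier_generated_sheaf[OF U] add_ac
    intro: hol_ring_add hol_ring_zero locally_gen_add locally_gen_zero)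

lemma generated_sheaf_module:
  assumes "open U" "U \<subseteq> \<Omega>"
  shows "Module.module (hol_ring U) (generated_sheaf M U)"
proof (rule module.intro[OF cring_hol_ring[OF assms(1)] generated_sheaf_abelian_group[OF assms(2)]], unfold_locales)
qed (use assms in \<open>auto simp: generated_sheaf_simps hol_ring_simps distrib_left distrib_right mult.assoc
    carrier_generated_sheaf[OF assms(2)] restr_one_mult
    intro: hol_ring_mult locally_gen_mult hol_near_hol_ring\<close>)

lemma finsum_generated_sheaf:
  assumes U: "U \<subseteq> \<Omega>"
  shows "(\<And>i. i < n \<Longrightarrow> f i \<in> carrier (generated_sheaf M U)) \<Longrightarrow>
    (\<Oplus>\<^bsub>generated_sheaf M U\<^esub>i\<in>{..<n::nat}. f i) = (\<lambda>z. \<Sum>i<n. f i z)"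
proof (induction n)
  case 0
  then show ?case
    by (simp add: abelian_monoid.finsum_empty[OF abelian_group.axioms(1)[OF generated_sheaf_abelian_group[OF U]]]
        generated_sheaf_simps)
next
  case (Suc n)
  have "f \<in> {..<n} \<rightarrow> carrier (generated_sheaf M U)" "f n \<in> carrier (generated_sheaf M U)"
    using Suc.prems by auto
  then show ?case
    using Suc by (simp add: lessThan_Suc generated_sheaf_simps add.commute
        abelian_monoid.finsum_insert[OF abelian_group.axioms(1)[OF generated_sheaf_abelian_group[OF U]]])
qed

lemma generated_sheaf_restr:
  assumes "U \<subseteq> \<Omega>" "open V" "V \<subseteq> U" "f \<in> carrier (generated_sheaf M U)"
  shows "restr V f \<in> carrier (generated_sheaf M V)"
proof -
  have "f hol_on V" "\<And>w. w \<in> V \<Longrightarrow> locally_gen M w f"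
    using assms by (auto simp: carrier_generated_sheaf mem_hol_ring hol_on_iff_cdiff)
  then show ?thesis
    using assms by (auto simp: carrier_generated_sheaf intro: restr_in_hol_ring locally_gen_cong eventually_restr)
qed

lemma generated_sheaf_glueing:
  assumes \<U>: "\<And>U. U \<in> \<U> \<Longrightarrow> open U \<and> U \<subseteq> \<Omega>"
    and \<sigma>: "\<And>U. U \<in> \<U> \<Longrightarrow> \<sigma> U \<in> carrier (generated_sheaf M U)"
    and compat: "\<And>U V. \<lbrakk>U \<in> \<U>; V \<in> \<U>\<rbrakk> \<Longrightarrow> restr (U \<inter> V) (\<sigma> U) = restr (U \<inter> V) (\<sigma> V)"
  shows "\<exists>!t. t \<in> carrier (generated_sheaf M (\<Union>\<U>)) \<and> (\<forall>U\<in>\<U>. restr U t = \<sigma> U)"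
proof -
  have X: "\<Union>\<U> \<subseteq> \<Omega>"
    using \<U> by blast
  \<comment> \<open>Compatibility makes the value independent of the chosen member of the cover; the
    value zero outside the union is forced by the encoding of sections.\<close>
  define t where "t z = (if z \<in> \<Union>\<U> then \<sigma> (SOME U. U \<in> \<U> \<and> z \<in> U) z else 0)" for z
  have t: "t z = \<sigma> U z" if "U \<in> \<U>" "z \<in> U" for U z
  proof -
    define V where "V = (SOME U. U \<in> \<U> \<and> z \<in> U)"
    have V: "V \<in> \<U> \<and> z \<in> V"
      unfolding V_def by (rule someI[of _ U]) (use that in blast)
    have "t z = \<sigma> V z"
      using that by (auto simp: t_def V_def)
    also have "\<sigma> V z = \<sigma> U z"
      using fun_cong[OF compat[OF conjunct1[OF V] that(1)], of z] V that(2) by (simp add: restr_def)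
    finally show ?thesis .
  qed
  have near: "\<forall>\<^sub>F z in nhds w. t z = \<sigma> U z" if "U \<in> \<U>" "w \<in> U" for U w
    by (rule eventually_mono[OF eventually_nhds_in_open[of U w]]) (use that \<U> t in auto)
  have \<sigma>U: "cdiff (\<sigma> U) w" "locally_gen M w (\<sigma> U)" if "U \<in> \<U>" "w \<in> U" for U w
    using \<sigma>[OF that(1)] \<U>[OF that(1)] that(2)
    by (auto simp: carrier_generated_sheaf mem_hol_ring hol_on_iff_cdiff)
  have zero: "zero_outside U (\<sigma> U)" if "U \<in> \<U>" for U
    using \<sigma>[OF that] \<U>[OF that] by (simp add: carrier_generated_sheaf mem_hol_ring)
  show ?thesis
  proof (rule ex1I[of _ t])
    have "t hol_on \<Union>\<U>"
      unfolding hol_on_iff_cdiff using cdiff_cong[OF \<sigma>U(1) near] by blast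
    moreover have "zero_outside (\<Union>\<U>) t"
      by (simp add: zero_outside_def t_def)
    moreover have "locally_gen M w t" if "w \<in> \<Union>\<U>" for w
      using that locally_gen_cong[OF \<sigma>U(2) near] by blast
    moreover have "restr U t = \<sigma> U" if "U \<in> \<U>" for U
      using t[OF that] zero[OF that] by (auto simp: restr_def zero_outside_def)
    ultimately show "t \<in> carrier (generated_sheaf M (\<Union>\<U>)) \<and> (\<forall>U\<in>\<U>. restr U t = \<sigma> U)"
      by (simp add: carrier_generated_sheaf[OF X] mem_hol_ring)
  next
    fix t' assume t': "t' \<in> carrier (generated_sheaf M (\<Union>\<U>)) \<and> (\<forall>U\<in>\<U>. restr U t' = \<sigma> U)"
    show "t' = t"
    proof
      fix z
      show "t' z = t z"
      proof (cases "z \<in> \<Union>\<U>")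
        case True
        then obtain U where U: "U \<in> \<U>" "z \<in> U" by blast
        then have "restr U t' z = \<sigma> U z" using t' by simp
        then show ?thesis using t[OF U] U by (simp add: restr_def)
      next
        case False
        then show ?thesis
          using t' by (simp add: carrier_generated_sheaf[OF X] mem_hol_ring zero_outside_def t_def)
      qed
    qed
  qed
qed

lemma hol_module_sheaf_generated: "hol_module_sheaf \<Omega> (generated_sheaf M) (\<lambda>_. restr)"
proof (rule hol_module_sheaf.intro)
  show "restr V s \<in> carrier (generated_sheaf M V)"
    if "open U" "U \<subseteq> \<Omega>" "open V" "V \<subseteq> U" "s \<in> carrier (generated_sheaf M U)" for U V s
    by (rule generated_sheaf_restr[OF that(2-5)])
  show "restr U s = s" if "open U" "U \<subseteq> \<Omega>" "s \<in> carrier (generated_sheaf M U)" for U s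
    using that by (auto simp: carrier_generated_sheaf mem_hol_ring zero_outside_def restr_def)
  show "\<exists>!t. t \<in> carrier (generated_sheaf M (\<Union>\<U>)) \<and> (\<forall>U\<in>\<U>. restr U t = \<sigma> U)"
    if "\<And>U. U \<in> \<U> \<Longrightarrow> open U \<and> U \<subseteq> \<Omega>" "\<And>U. U \<in> \<U> \<Longrightarrow> \<sigma> U \<in> carrier (generated_sheaf M U)"
      "\<And>U V. U \<in> \<U> \<Longrightarrow> V \<in> \<U> \<Longrightarrow> restr (U \<inter> V) (\<sigma> U) = restr (U \<inter> V) (\<sigma> V)" for \<U> \<sigma>
    by (rule generated_sheaf_glueing) (use that in blast)+
qed (auto simp: generated_sheaf_simps restr_def fun_eq_iff intro: generated_sheaf_module)

end

subsection \<open>Coherence\<close>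

lemma relations_simps:
  "a \<oplus>\<^bsub>relations F r U n s V\<^esub> b = (\<lambda>i z. a i z + b i z)"
  "c \<odot>\<^bsub>relations F r U n s V\<^esub> a = (\<lambda>i z. c z * a i z)"
  "\<zero>\<^bsub>relations F r U n s V\<^esub> = (\<lambda>_ _. 0)"
  by (simp_all add: relations_def)

context hol_family
begin

text \<open>A section near \<open>y\<close> is a combination of finitely many members of
  \<open>M\<close> that depend on \<open>y\<close> and on the section. All of them expand in the
  same finite \<open>B\<close> with coefficients holomorphic on the whole of
  \<open>pd x \<rho>\<close>, so \<open>B\<close> generates at every \<open>y\<close> in it.\<close>

lemma finite_type_generated: "finite_type (generated_sheaf M) (\<lambda>_. restr) \<Omega>"
  unfolding finite_type_def
proof
  fix x assume x: "x \<in> \<Omega>"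
  obtain \<rho> B c where \<rho>: "0 < \<rho>" "pd x \<rho> \<subseteq> \<Omega>" and B: "finite B" "B \<subseteq> M"
    and c: "\<And>f b. \<lbrakk>f \<in> M; b \<in> B\<rbrakk> \<Longrightarrow> c f b hol_on pd x \<rho>"
    and fB: "\<And>f z. \<lbrakk>f \<in> M; z \<in> pd x \<rho>\<rbrakk> \<Longrightarrow> f z = (\<Sum>b\<in>B. c f b z * b z)"
    by (rule finite_generators[OF open_domain x holomorphic_members]) (assumption | rule that)+
  obtain e where e: "bij_betw e {..<card B} B"
    using bij_betw_from_nat_into_finite[OF B(1)] by blast
  have eM: "e i \<in> M" "e i \<in> B" if "i < card B" for i
    using bij_betwE[OF e] that B(2) by auto
  define s where "s i = restr (pd x \<rho>) (e i)" for i
  have s: "s i \<in> carrier (generated_sheaf M (pd x \<rho>))" if "i < card B" for i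
  proof -
    have "e i hol_on pd x \<rho>"
      using holomorphic_members[OF eM(1)[OF that]] \<rho>(2) by (auto simp: hol_on_iff_cdiff)
    moreover have "locally_gen M w (s i)" if "w \<in> pd x \<rho>" for w
      unfolding s_def
      by (rule locally_gen_cong[OF locally_gen_member eventually_restr[OF open_pd that]])
        (rule eM(1)[OF \<open>i < card B\<close>])
    ultimately show ?thesis
      unfolding carrier_generated_sheaf[OF \<rho>(2)] by (auto simp: s_def intro: restr_in_hol_ring open_pd)
  qed
  have gen: "\<exists>V' a. open V' \<and> y \<in> V' \<and> V' \<subseteq> V \<and> (\<forall>i<card B. a i \<in> carrier (hol_ring V')) \<and>
      restr V' t = (\<Oplus>\<^bsub>generated_sheaf M V'\<^esub>i\<in>{..<card B}. a i \<odot>\<^bsub>generated_sheaf M V'\<^esub> restr V' (s i))"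
    if y: "y \<in> pd x \<rho>" and V: "open V" "y \<in> V" "V \<subseteq> pd x \<rho>" and t: "t \<in> carrier (generated_sheaf M V)"
    for y V t
  proof -
    have V\<Omega>: "V \<subseteq> \<Omega>" using V(3) \<rho>(2) by blast
    then have "locally_gen M y t"
      using t V(2) by (simp add: carrier_generated_sheaf)
    then obtain m :: nat and g h where gh: "\<And>i. i < m \<Longrightarrow> g i \<in> M" "\<And>i. i < m \<Longrightarrow> hol_near y (h i)"
      and tg: "\<forall>\<^sub>F z in nhds y. t z = (\<Sum>i<m. g i z * h i z)"
      by (rule locally_genE) (assumption | rule that)+
    \<comment> \<open>Inserts the expansions of the \<open>g k\<close> in \<open>B\<close> into the
      local expression of \<open>t\<close> by the \<open>g k\<close>.\<close>
    define a where "a i z = (\<Sum>k<m. c (g k) (e i) z * h k z)" for i z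
    have a: "hol_near y (a i)" if "i \<in> {..<card B}" for i
      unfolding a_def using that gh y
      by (intro hol_near_intros) (auto intro: hol_on_hol_near[OF c open_pd] eM)
    have "\<forall>\<^sub>F z in nhds y. z \<in> V"
      using V(1,2) by (rule eventually_nhds_in_open)
    with tg have tV: "\<forall>\<^sub>F z in nhds y. z \<in> V \<and> t z = (\<Sum>i<card B. a i z * e i z)"
    proof eventually_elim
      case (elim z)
      then have z: "z \<in> pd x \<rho>" using V(3) by blast
      have "g k z = (\<Sum>i<card B. c (g k) (e i) z * e i z)" if "k < m" for k
        using fB[OF gh(1)[OF that] z] sum.reindex_bij_betw[OF e, of "\<lambda>b. c (g k) b z * b z"] by simp
      then have "t z = (\<Sum>k<m. (\<Sum>i<card B. c (g k) (e i) z * e i z) * h k z)"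
        using elim(1) by simp
      also have "\<dots> = (\<Sum>i<card B. \<Sum>k<m. c (g k) (e i) z * e i z * h k z)"
        unfolding sum_distrib_right by (rule sum.swap)
      also have "\<dots> = (\<Sum>i<card B. a i z * e i z)"
        by (simp add: a_def sum_distrib_left mult_ac)
      finally show ?case using elim(2) by simp
    qed
    obtain \<delta> where \<delta>: "0 < \<delta>" and aV: "\<And>i. i \<in> {..<card B} \<Longrightarrow> a i hol_on pd y \<delta>"
      and ta: "\<And>z. z \<in> pd y \<delta> \<Longrightarrow> z \<in> V \<and> t z = (\<Sum>i<card B. a i z * e i z)"
      by (rule hol_near_pd[where f = a, OF finite_lessThan a tV]) (assumption | rule that)+
    define V' where "V' = pd y \<delta>"
    have V': "open V'" "y \<in> V'" "V' \<subseteq> V" "V' \<subseteq> pd x \<rho>" "V' \<subseteq> \<Omega>"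
      using ta V(3) V\<Omega> \<delta> by (auto simp: V'_def open_pd)
    have aR: "restr V' (a i) \<in> carrier (hol_ring V')" if "i < card B" for i
      using aV[of i] that by (intro restr_in_hol_ring V') (simp add: V'_def)
    have "(\<Oplus>\<^bsub>generated_sheaf M V'\<^esub>i\<in>{..<card B}. restr V' (a i) \<odot>\<^bsub>generated_sheaf M V'\<^esub> restr V' (s i)) =
        (\<lambda>z. \<Sum>i<card B. restr V' (a i) z * restr V' (s i) z)"
      unfolding generated_sheaf_simps
      by (rule finsum_generated_sheaf[OF V'(5)], rule generated_sheaf_smult[OF V'(5,1) aR])
        (auto intro: generated_sheaf_restr[OF \<rho>(2) V'(1,4) s])
    also have "\<dots> = restr V' t"
      using ta V'(4) by (auto simp: restr_def fun_eq_iff s_def V'_def[symmetric])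
    finally show ?thesis
      using V' aR by (intro exI[of _ V'] exI[of _ "\<lambda>i. restr V' (a i)"]) simp
  qed
  show "\<exists>W (n::nat) s. open W \<and> x \<in> W \<and> W \<subseteq> \<Omega> \<and> (\<forall>i<n. s i \<in> carrier (generated_sheaf M W)) \<and>
      (\<forall>y\<in>W. \<forall>V t. open V \<and> y \<in> V \<and> V \<subseteq> W \<and> t \<in> carrier (generated_sheaf M V) \<longrightarrow>
        (\<exists>V' a. open V' \<and> y \<in> V' \<and> V' \<subseteq> V \<and> (\<forall>i<n. a i \<in> carrier (hol_ring V')) \<and>
          restr V' t = (\<Oplus>\<^bsub>generated_sheaf M V'\<^esub>i\<in>{..<n}. a i \<odot>\<^bsub>generated_sheaf M V'\<^esub> restr V' (s i))))"
    by (rule exI[of _ "pd x \<rho>"], rule exI[of _ "card B"], rule exI[of _ s])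
      (intro conjI allI ballI impI open_pd \<rho>(2) s gen, use \<rho>(1) in auto)
qed

context
  fixes U :: "(complex ^ 'm) set" and n :: nat and s :: "nat \<Rightarrow> complex ^ 'm \<Rightarrow> complex"
  assumes U: "open U" "U \<subseteq> \<Omega>" and s: "\<And>i. i < n \<Longrightarrow> s i \<in> carrier (generated_sheaf M U)"
begin

abbreviation Rel where "Rel V \<equiv> relations (generated_sheaf M) (\<lambda>_. restr) U n s V"

text \<open>Turns the sum in the module of sections into a condition on values, which is the form of
  a relation in \<open>gen_rel\<close>.\<close>

lemma carrier_Rel:
  assumes V: "open V" "V \<subseteq> U"
  shows "a \<in> carrier (Rel V) \<longleftrightarrow> (\<forall>i<n. a i \<in> carrier (hol_ring V)) \<and> (\<forall>i\<ge>n. a i = (\<lambda>_. 0)) \<and>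
    (\<forall>z\<in>V. (\<Sum>i<n. a i z * s i z) = 0)"
proof (cases "\<forall>i<n. a i \<in> carrier (hol_ring V)")
  case True
  have V\<Omega>: "V \<subseteq> \<Omega>" using V(2) U(2) by blast
  have "(\<Oplus>\<^bsub>generated_sheaf M V\<^esub>i\<in>{..<n}. a i \<odot>\<^bsub>generated_sheaf M V\<^esub> restr V (s i)) =
      (\<lambda>z. \<Sum>i<n. a i z * restr V (s i) z)"
    unfolding generated_sheaf_simps
    by (rule finsum_generated_sheaf[OF V\<Omega>], rule generated_sheaf_smult[OF V\<Omega> V(1)])
      (use True in \<open>auto intro: generated_sheaf_restr[OF U(2) V s]\<close>)
  moreover have "(\<lambda>z. \<Sum>i<n. a i z * restr V (s i) z) = (\<lambda>_. 0) \<longleftrightarrow> (\<forall>z\<in>V. (\<Sum>i<n. a i z * s i z) = 0)"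
  proof -
    have "(\<Sum>i<n. a i z * restr V (s i) z) = (if z \<in> V then \<Sum>i<n. a i z * s i z else 0)" for z
      by (simp add: restr_def)
    then show ?thesis
      by (auto simp: fun_eq_iff)
  qed
  ultimately show ?thesis
    using True by (simp add: relations_def generated_sheaf_simps(3))
qed (auto simp: relations_def)

lemma Rel_smult:
  assumes V: "open V" "V \<subseteq> U" and "c \<in> carrier (hol_ring V)" "a \<in> carrier (Rel V)"
  shows "(\<lambda>i z. c z * a i z) \<in> carrier (Rel V)"
  using assms(3,4) unfolding carrier_Rel[OF V]
  by (auto simp: hol_ring_mult mult.assoc sum_distrib_left[symmetric])

lemma abelian_monoid_Rel:
  assumes V: "open V" "V \<subseteq> U"
  shows "abelian_monoid (Rel V)"
  by (rule abelian_monoidI)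
    (auto simp: relations_simps carrier_Rel[OF V] add_ac hol_ring_zero hol_ring_add distrib_right sum.distrib)

lemma finsum_Rel:
  assumes V: "open V" "V \<subseteq> U"
  shows "(\<And>l. l < N \<Longrightarrow> f l \<in> carrier (Rel V)) \<Longrightarrow>
    (\<Oplus>\<^bsub>Rel V\<^esub>l\<in>{..<N::nat}. f l) = (\<lambda>i z. \<Sum>l<N. f l i z)"
proof (induction N)
  case 0
  then show ?case
    by (simp add: abelian_monoid.finsum_empty[OF abelian_monoid_Rel[OF V]] relations_simps)
next
  case (Suc N)
  have "f \<in> {..<N} \<rightarrow> carrier (Rel V)" "f N \<in> carrier (Rel V)"
    using Suc.prems by auto
  then show ?case
    using Suc by (simp add: lessThan_Suc relations_simps add.commute
        abelian_monoid.finsum_insert[OF abelian_monoid_Rel[OF V]])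
qed

lemma finite_type_Rel: "finite_type Rel (\<lambda>_ V a i. restr V (a i)) U"
  unfolding finite_type_def
proof
  fix x assume x: "x \<in> U"
  have "s i hol_on U" if "i < n" for i
    using s[OF that] by (simp add: carrier_generated_sheaf[OF U(2)] mem_hol_ring)
  then obtain \<rho> N G where \<rho>: "0 < \<rho>" "pd x \<rho> \<subseteq> U" and G: "gen_rel UNIV (pd x \<rho>) {()} {..<n} (\<lambda>_. s) {..<N::nat} G"
    by (rule Oka_local[OF U(1) x]) (assumption | rule that)+
  \<comment> \<open>Restriction and padding by zero from index \<open>n\<close> on meet the
    conventions of \<open>relations\<close> for sections and tuples.\<close>
  define S where "S l i = (if i < n then restr (pd x \<rho>) (G l i) else (\<lambda>_. 0))" for l i
  have S: "S l \<in> carrier (Rel (pd x \<rho>))" if "l < N" for l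
  proof -
    have "(\<Sum>i<n. S l i z * s i z) = 0" if "z \<in> pd x \<rho>" for z
      using gen_rel_zero[OF G, of l "()" z] that \<open>l < N\<close> by (simp add: S_def restr_def)
    moreover have "S l i \<in> carrier (hol_ring (pd x \<rho>))" if "i < n" for i
      using dep_on_hol[OF gen_rel_dep[OF G, of l i]] that \<open>l < N\<close>
      by (auto simp: S_def intro: restr_in_hol_ring open_pd)
    ultimately show ?thesis
      unfolding carrier_Rel[OF open_pd \<rho>(2)] by (auto simp: S_def)
  qed
  have gen: "\<exists>V' a. open V' \<and> y \<in> V' \<and> V' \<subseteq> V \<and> (\<forall>l<N. a l \<in> carrier (hol_ring V')) \<and>
      (\<lambda>i. restr V' (t i)) = (\<Oplus>\<^bsub>Rel V'\<^esub>l\<in>{..<N}. a l \<odot>\<^bsub>Rel V'\<^esub> (\<lambda>i. restr V' (S l i)))"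
    if y: "y \<in> pd x \<rho>" and V: "open V" "y \<in> V" "V \<subseteq> pd x \<rho>" and t: "t \<in> carrier (Rel V)" for y V t
  proof -
    have VU: "V \<subseteq> U" using V(3) \<rho>(2) by blast
    note t' = t[unfolded carrier_Rel[OF V(1) VU]]
    have Vn: "\<forall>\<^sub>F z in nhds y. z \<in> V"
      using V(1,2) by (rule eventually_nhds_in_open)
    have tn: "hol_near y (t i)" if "i \<in> {..<n}" for i
      using t' that V by (intro hol_near_hol_ring[of _ V]) auto
    have t0: "\<forall>\<^sub>F z in nhds y. (\<Sum>i<n. t i z * s i z) = 0"
      using Vn by (rule eventually_mono) (use t' in blast)
    obtain c where c: "\<And>l. l \<in> {..<N} \<Longrightarrow> hol_near y (c l)"
      "\<And>i. i \<in> {..<n} \<Longrightarrow> \<forall>\<^sub>F z in nhds y. t i z = (\<Sum>l<N. c l z * G l i z)"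
      by (rule gen_relD[OF G y, of t]) (use tn t0 in blast)+
    have "\<forall>\<^sub>F z in nhds y. \<forall>i\<in>{..<n}. t i z = (\<Sum>l<N. c l z * G l i z)"
      by (rule eventually_ball_finite) (use c(2) in auto)
    with Vn have tV: "\<forall>\<^sub>F z in nhds y. z \<in> V \<and> (\<forall>i\<in>{..<n}. t i z = (\<Sum>l<N. c l z * G l i z))"
      by (rule eventually_conj)
    obtain \<delta> where \<delta>: "0 < \<delta>" and cV: "\<And>l. l \<in> {..<N} \<Longrightarrow> c l hol_on pd y \<delta>"
      and tc: "\<And>z. z \<in> pd y \<delta> \<Longrightarrow> z \<in> V \<and> (\<forall>i\<in>{..<n}. t i z = (\<Sum>l<N. c l z * G l i z))"
      by (rule hol_near_pd[where f = c, OF finite_lessThan c(1) tV]) (assumption | rule that)+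
    define V' where "V' = pd y \<delta>"
    have V': "open V'" "y \<in> V'" "V' \<subseteq> V" "V' \<subseteq> pd x \<rho>" "V' \<subseteq> U"
      using tc V(3) VU \<delta> by (auto simp: V'_def open_pd)
    have cR: "restr V' (c l) \<in> carrier (hol_ring V')" if "l < N" for l
      using cV[of l] that by (intro restr_in_hol_ring V') (simp add: V'_def)
    have SR: "(\<lambda>i. restr V' (S l i)) \<in> carrier (Rel V')" if "l < N" for l
    proof -
      note Sl = S[OF that, unfolded carrier_Rel[OF open_pd \<rho>(2)]]
      have "restr V' (S l i) \<in> carrier (hol_ring V')" if "i < n" for i
        using Sl that V'(4) by (intro restr_in_hol_ring V') (auto simp: mem_hol_ring hol_on_iff_cdiff)
      then show ?thesis
        unfolding carrier_Rel[OF V'(1,5)] using Sl V'(4) by (auto simp: restr_def fun_eq_iff)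
    qed
    have "(\<Oplus>\<^bsub>Rel V'\<^esub>l\<in>{..<N}. restr V' (c l) \<odot>\<^bsub>Rel V'\<^esub> (\<lambda>i. restr V' (S l i))) =
        (\<lambda>i z. \<Sum>l<N. restr V' (c l) z * restr V' (S l i) z)"
      unfolding relations_simps
      by (rule finsum_Rel[OF V'(1,5)], rule Rel_smult[OF V'(1,5) cR SR])
    also have "\<dots> = (\<lambda>i. restr V' (t i))"
    proof (intro ext)
      fix i z
      show "(\<Sum>l<N. restr V' (c l) z * restr V' (S l i) z) = restr V' (t i) z"
        using tc[of z] V'(4) t' by (cases "z \<in> V'"; cases "i < n") (auto simp: restr_def S_def V'_def)
    qed
    finally show ?thesis
      using V' cR by (intro exI[of _ V'] exI[of _ "\<lambda>l. restr V' (c l)"]) simp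
  qed
  show "\<exists>W (m::nat) S. open W \<and> x \<in> W \<and> W \<subseteq> U \<and> (\<forall>l<m. S l \<in> carrier (Rel W)) \<and>
      (\<forall>y\<in>W. \<forall>V t. open V \<and> y \<in> V \<and> V \<subseteq> W \<and> t \<in> carrier (Rel V) \<longrightarrow>
        (\<exists>V' a. open V' \<and> y \<in> V' \<and> V' \<subseteq> V \<and> (\<forall>l<m. a l \<in> carrier (hol_ring V')) \<and>
          (\<lambda>i. restr V' (t i)) = (\<Oplus>\<^bsub>Rel V'\<^esub>l\<in>{..<m}. a l \<odot>\<^bsub>Rel V'\<^esub> (\<lambda>i. restr V' (S l i)))))"
    by (rule exI[of _ "pd x \<rho>"], rule exI[of _ N], rule exI[of _ S])
      (intro conjI allI ballI impI open_pd \<rho>(2) S gen, use \<rho>(1) in auto)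
qed

end

theorem coherent_sheaf_generated: "coherent_sheaf \<Omega> (generated_sheaf M) (\<lambda>_. restr)"
  by (intro coherent_sheaf.intro coherent_sheaf_axioms.intro hol_module_sheaf_generated
      finite_type_generated finite_type_Rel)

end

theorem proposition1p4:
  fixes \<Omega> :: "(complex ^ 'm) set"
    and M :: "(complex ^ 'm \<Rightarrow> complex) set"
    and ip :: "(complex ^ 'm \<Rightarrow> complex) \<Rightarrow> (complex ^ 'm \<Rightarrow> complex) \<Rightarrow> complex"
  assumes "open \<Omega>" and "connected \<Omega>" and "\<Omega> \<noteq> {}" and "bounded \<Omega>"
    and "class_B1 \<Omega> M ip"
  shows "coherent_sheaf \<Omega> (generated_sheaf M) (\<lambda>_. restr)"
proof -
  interpret hol_family \<Omega> M
    by unfold_locales (use assms(1) class_B1.holomorphic[OF assms(5)] in auto)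
  show ?thesis by (rule coherent_sheaf_generated)
qed

end
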